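(* For any norm $\nu$ on $\mathbb{R}^d$, $d=m+n$, the set $\widehat D_\nu\subset M_{m,n}(\mathbb{R})$ has Lebesgue measure zero.
   Context: $B_\nu(r)=\{\mathbf{x}\in\mathbb{R}^d:\nu(\mathbf{x})<r\}$; $\Delta_\nu$ is the smallest covolume of a lattice in $\mathbb{R}^d$ meeting $B_\nu(1)$ only in $0$. For positive $\psi$, $A\in D_\nu(\psi)$ means: for every sufficiently large $t>0$ there exist $\mathbf{q}\in\mathbb{Z}^n\smallsetminus\{0\}$, $\mathbf{p}\in\mathbb{Z}^m$ with $(A\mathbf{q}-\mathbf{p},\mathbf{q})\in\operatorname{diag}(\psi(t)I_m,tI_n)B_\nu(\Delta_\nu^{-1/d})$. $\widehat D_\nu=\bigcup_{c<1}D_\nu(c\psi_{n/m})$ with $\psi_{n/m}(t)=t^{-n/m}$. *)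

theory Defs
  imports "HOL-Analysis.Analysis"
begin

definition is_norm :: "('a::real_vector \<Rightarrow> real) \<Rightarrow> bool" where
  "is_norm \<nu> \<longleftrightarrow>
     (\<forall>x. 0 \<le> \<nu> x) \<and> (\<forall>x. \<nu> x = 0 \<longleftrightarrow> x = 0) \<and>
     (\<forall>a x. \<nu> (a *\<^sub>R x) = \<bar>a\<bar> * \<nu> x) \<and>
     (\<forall>x y. \<nu> (x + y) \<le> \<nu> x + \<nu> y)"

definition nu_ball :: "('a::real_vector \<Rightarrow> real) \<Rightarrow> real \<Rightarrow> 'a set" where
  "nu_ball \<nu> r = {x. \<nu> x < r}"

definition int_vecs :: "(real^'k::finite) set" where
  "int_vecs = {z. \<forall>i. z $ i \<in> \<int>}"

definition lattice_basis :: "real^'k^'k \<Rightarrow> (real^'k::finite) set \<Rightarrow> bool" where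
  "lattice_basis g L \<longleftrightarrow> invertible g \<and> L = (\<lambda>z. g *v z) ` int_vecs"

definition is_lattice :: "(real^'k::finite) set \<Rightarrow> bool" where
  "is_lattice L \<longleftrightarrow> (\<exists>g. lattice_basis g L)"

text \<open>The covolume does not depend on the basis, see \<open>covolume_eq\<close> below.\<close>

definition covolume :: "(real^'k::finite) set \<Rightarrow> real" where
  "covolume L = (THE v. \<exists>g. lattice_basis g L \<and> v = \<bar>det g\<bar>)"

text \<open>The smallest covolume is written as an infimum; the two agree because the minimum is
  attained (Mahler compactness).\<close>

definition critical_covolume :: "(real^'k::finite \<Rightarrow> real) \<Rightarrow> real" where
  "critical_covolume \<nu> = Inf {covolume L | L. is_lattice L \<and> L \<inter> nu_ball \<nu> 1 = {0}}"

text \<open>With \<open>d = m + n\<close>, the space \<open>\<real>\<^sup>d\<close> is \<^typ>\<open>real^('m + 'n)\<close>: the \<open>Inl\<close> coordinates are the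
  first \<open>m\<close> ones and the \<open>Inr\<close> coordinates the last \<open>n\<close>.\<close>

definition join_vec :: "real^'m \<Rightarrow> real^'n \<Rightarrow> real^('m::finite + 'n::finite)" where
  "join_vec x y = (\<chi> i. case i of Inl j \<Rightarrow> x $ j | Inr k \<Rightarrow> y $ k)"

definition block_diag :: "real \<Rightarrow> real \<Rightarrow> real^('m::finite + 'n::finite)^('m + 'n)" where
  "block_diag a b =
     (\<chi> i j. if i = j then (case i of Inl _ \<Rightarrow> a | Inr _ \<Rightarrow> b) else 0)"

definition D_set ::
  "(real^('m::finite + 'n::finite) \<Rightarrow> real) \<Rightarrow> (real \<Rightarrow> real) \<Rightarrow> (real^'n^'m) set" where
  "D_set \<nu> \<psi> = {A. \<forall>\<^sub>F t in at_top. \<exists>q \<in> int_vecs - {0}. \<exists>p \<in> int_vecs.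
     join_vec (A *v q - p) q \<in>
       (\<lambda>x. block_diag (\<psi> t) t *v x) `
         nu_ball \<nu> (critical_covolume \<nu> powr (- 1 / real CARD('m + 'n)))}"

definition psi_exp :: "real \<Rightarrow> real \<Rightarrow> real" where
  "psi_exp a t = t powr (- a)"

text \<open>The sets \<^const>\<open>D_set\<close> are only meant for positive \<open>\<psi>\<close>, so \<open>c\<close> ranges over \<open>0 < c < 1\<close>.\<close>

definition D_hat :: "(real^('m::finite + 'n::finite) \<Rightarrow> real) \<Rightarrow> (real^'n^'m) set" where
  "D_hat \<nu> = (\<Union>c\<in>{0<..<1}. D_set \<nu> (\<lambda>t. c * psi_exp (real CARD('n) / real CARD('m)) t))"

lemma lattice_basis_abs_det_le:
  fixes g h :: "real^'k::finite^'k"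
  assumes "lattice_basis g L" "lattice_basis h L"
  shows "\<bar>det g\<bar> \<le> \<bar>det h\<bar>"
proof -
  have "\<exists>z \<in> int_vecs. column j h = g *v z" for j
  proof -
    have "axis j 1 \<in> (int_vecs :: (real^'k) set)"
      by (auto simp: int_vecs_def axis_def)
    then have "h *v axis j 1 \<in> L"
      using assms(2) by (auto simp: lattice_basis_def)
    then show ?thesis
      using assms(1) by (auto simp: lattice_basis_def matrix_vector_mult_basis)
  qed
  then obtain z where z: "\<And>j. z j \<in> int_vecs" "\<And>j. column j h = g *v z j"
    by metis
  define M :: "real^'k^'k" where "M = (\<chi> i j. z j $ i)"
  have "h = g ** M"
    using z(2) by (simp add: vec_eq_iff matrix_matrix_mult_def M_def column_def matrix_vector_mult_def)
  then have det: "det h = det g * det M"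
    by (simp add: det_mul)
  have "det M \<in> \<int>"
    using z(1) unfolding det_def M_def
    by (intro Ints_sum Ints_mult Ints_prod) (auto simp: int_vecs_def)
  moreover have "det h \<noteq> 0"
    using assms(2) by (simp add: lattice_basis_def invertible_det_nz)
  ultimately have "1 \<le> \<bar>det M\<bar>"
    using det Ints_nonzero_abs_ge1 by auto
  then show ?thesis
    using mult_left_mono[of 1 "\<bar>det M\<bar>" "\<bar>det g\<bar>"] by (simp add: det abs_mult)
qed

lemma covolume_eq: "lattice_basis g L \<Longrightarrow> covolume L = \<bar>det g\<bar>"
  unfolding covolume_def by (rule the_equality) (auto intro: antisym lattice_basis_abs_det_le)

end

theory Submission
  imports Defs
begin

text \<open>
  Write \<open>g\<^sub>t = diag(t\<^bsup>n/m\<^esup>, 1/t)\<close> and \<open>u\<^sub>A\<close> for the unipotent matrix with upper right block \<open>A\<close>. A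
  matrix \<open>A\<close> lies in \<^const>\<open>D_hat\<close> only if the lattices \<open>g\<^sub>t u\<^sub>A \<int>\<^sup>d\<close> eventually avoid a neighbourhood of
  some fixed unimodular lattice, so it suffices that for almost every \<open>A\<close> they return to any given
  neighbourhood of any given unimodular lattice at arbitrarily late times.

  Counting integral vectors shows that, uniformly in \<open>t\<close>, few matrices \<open>X\<close> in a bounded set are such
  that \<open>g\<^sub>t X \<int>\<^sup>d\<close> has a very short vector. As Lebesgue measure on matrices is invariant under \<open>g\<^sub>t\<close>
  and \<open>GL\<^sub>d(\<int>)\<close>, a Poincare recurrence argument inside a compact set of lattices makes the flow
  nonwandering. Contracted unipotents can be absorbed into returns, so the closure of a flow invariant
  open set of lattices is invariant under all transvections: the flow is topologically transitive.
  Transitivity and the expansion of \<open>u\<^sub>A\<close> under \<open>g\<^sub>t\<close> imply that from every lattice some \<open>g\<^sub>t u\<^sub>B\<close> leads into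
  the target. Almost every orbit \<open>g\<^sub>t u\<^sub>A \<int>\<^sup>d\<close> returns to a compact set, and at such times a fixed
  proportion of a small ball around \<open>A\<close> enters the target; hence the set of \<open>A\<close> that never do so
  from some time on has no density points.
\<close>

section \<open>Linear images of Lebesgue measure\<close>

text \<open>The condition \<open>c < 1\<close> is what gives the target an interior. Once
  \<open>c\<close> is absorbed into the norm, the ball in question has critical covolume c^m < 1, so
  there are unimodular lattices that miss it with room to spare, and small perturbations of them
  still do. This room is also spent on moving \<open>c\<close> and the radius to rational values,
  which reduces an uncountable union to countably many null sets. Dense orbits alone say nothing
  about null sets. The link to measure is that the target is reached from every lattice by a
  unipotent followed by the flow: unipotents form a space of the same dimension as that of
  \<open>A\<close>, the flow rescales balls in it, and one successful unipotent becomes a fixed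
  proportion of volume. For this the part of a perturbation that is not unipotent has to be stripped
  off first. Recurrence needs finite volume, while Lebesgue measure on matrices is infinite and the
  quotient by \<open>GLZ\<close> is never formed. Instead the translated pieces are collected inside
  one ball of matrices, which is where reduced bases come in.\<close>

text \<open>The library computes the measure of linear images only for vectors with a well-ordered
  index type, so indices are wrapped in a type carrying an arbitrary well-order.\<close>

typedef 'a wo = "UNIV :: 'a set" ..

lemma bij_Rep_wo: "bij (Rep_wo :: 'a wo \<Rightarrow> 'a)"
  by (metis Abs_wo_inverse Rep_wo_inverse UNIV_I bijI')

instance wo :: (finite) finite
proof
  show "finite (UNIV :: 'a wo set)"
    using bij_betw_finite[OF bij_Rep_wo[where 'a = 'a]] by simp
qed

instantiation wo :: (finite) wellorder
begin

definition wo_index :: "'a wo \<Rightarrow> nat" where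
  "wo_index = (SOME f. inj f)"

definition less_eq_wo :: "'a wo \<Rightarrow> 'a wo \<Rightarrow> bool" where
  "x \<le> y \<longleftrightarrow> wo_index x \<le> wo_index y"

definition less_wo :: "'a wo \<Rightarrow> 'a wo \<Rightarrow> bool" where
  "x < y \<longleftrightarrow> wo_index x < wo_index y"

lemma inj_wo_index: "inj (wo_index :: 'a wo \<Rightarrow> nat)"
proof -
  have "\<exists>f :: 'a wo \<Rightarrow> nat. inj f"
    using finite_imp_inj_to_nat_seg[of "UNIV :: 'a wo set"] by auto
  then show ?thesis
    unfolding wo_index_def by (rule someI_ex)
qed

instance
proof
  fix x y z :: "'a wo"
  show "x < y \<longleftrightarrow> x \<le> y \<and> \<not> y \<le> x" "x \<le> x" "x \<le> y \<or> y \<le> x"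
    by (auto simp: less_eq_wo_def less_wo_def)
  show "x \<le> z" if "x \<le> y" "y \<le> z"
    using that by (simp add: less_eq_wo_def)
  show "x = y" if "x \<le> y" "y \<le> x"
  proof (rule injD[OF inj_wo_index])
    show "wo_index x = wo_index y"
      using that unfolding less_eq_wo_def by (rule antisym)
  qed
next
  fix P :: "'a wo \<Rightarrow> bool" and a
  assume step: "\<And>x. (\<And>y. y < x \<Longrightarrow> P y) \<Longrightarrow> P x"
  show "P a"
    by (rule measure_induct_rule[of wo_index]) (rule step, simp add: less_wo_def)
qed

end

section \<open>Coordinates of a Euclidean space and volume\<close>

lemma bij_betw_axis_Basis: "bij_betw (\<lambda>i. axis i 1) UNIV (Basis :: (real^'w::finite) set)"
  by (auto simp: bij_betw_def inj_on_def axis_eq_axis Basis_vec_def)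

lemma bij_betw_axis_axis_Basis:
  "bij_betw (\<lambda>(i, j). axis i (axis j 1)) UNIV (Basis :: (real^'v::finite^'w::finite) set)"
  by (auto simp: bij_betw_def inj_on_def axis_eq_axis Basis_vec_def axis_eq_0_iff)

lemma borel_measurable_linear:
  fixes f :: "'a::euclidean_space \<Rightarrow> 'b::euclidean_space"
  shows "linear f \<Longrightarrow> f \<in> borel_measurable borel"
  using linear_conv_bounded_linear linear_continuous_on borel_measurable_continuous_onI by blast

text \<open>\<open>lborel\<close> is determined by its values on boxes, and reading a box in the
  coordinates given by \<open>e\<close> only reindexes the product of its side lengths.\<close>

lemma emeasure_lborel_basis_image:
  fixes e :: "'w::finite \<Rightarrow> 'a::euclidean_space"
  assumes e: "bij_betw e UNIV Basis" and S: "S \<in> sets borel"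
  defines "\<phi> \<equiv> \<lambda>x::real^'w. \<Sum>i\<in>UNIV. (x $ i) *\<^sub>R e i"
  shows "emeasure lborel (\<phi> ` S) = emeasure lborel S" "\<phi> ` S \<in> sets borel"
proof -
  have e_in: "e i \<in> Basis" for i
    using e by (auto simp: bij_betw_def)
  have e_inj: "inj e" using e by (simp add: bij_betw_def)
  have inner_e: "\<phi> x \<bullet> e i = x $ i" for x i
    by (simp add: \<phi>_def inner_sum_left inner_Basis e_in inj_eq[OF e_inj] if_distrib sum.delta cong: if_cong)
  define \<psi> where "\<psi> = (\<lambda>y::'a. \<chi> i. y \<bullet> e i)"
  have \<psi>\<phi>: "\<psi> (\<phi> x) = x" for x
    by (simp add: \<psi>_def inner_e vec_eq_iff)
  have \<phi>\<psi>: "\<phi> (\<psi> y) = y" for y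
  proof -
    have "\<phi> (\<psi> y) = (\<Sum>i\<in>UNIV. (y \<bullet> e i) *\<^sub>R e i)"
      by (simp add: \<phi>_def \<psi>_def)
    also have "\<dots> = (\<Sum>b\<in>Basis. (y \<bullet> b) *\<^sub>R b)"
      by (rule sum.reindex_bij_betw[OF e])
    finally show ?thesis by (simp add: euclidean_representation)
  qed
  have [measurable]: "\<phi> \<in> borel_measurable borel" "\<psi> \<in> borel_measurable borel"
    unfolding \<phi>_def \<psi>_def by (intro borel_measurable_continuous_onI continuous_intros)+
  have im: "\<phi> ` S = \<psi> -` S"
    using \<psi>\<phi> \<phi>\<psi> by (auto intro: image_eqI[where x = "\<psi> _"])
  show borel: "\<phi> ` S \<in> sets borel"
    unfolding im using measurable_sets[of \<psi> borel borel S] S by simp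
  have "lborel = distr lborel borel \<phi>"
  proof (rule lborel_eqI)
    fix l u :: 'a assume le: "\<And>b. b \<in> Basis \<Longrightarrow> l \<bullet> b \<le> u \<bullet> b"
    have Basis_eq: "Basis = range e" using e by (auto simp: bij_betw_def)
    have "\<phi> -` box l u = box (\<psi> l) (\<psi> u)"
      by (auto simp: box_def Basis_eq inner_e \<psi>_def Basis_vec_def inner_axis)
    moreover have "emeasure lborel (box (\<psi> l) (\<psi> u)) = (\<Prod>b\<in>Basis. (\<psi> u - \<psi> l) \<bullet> b)"
      using le e_in by (subst emeasure_lborel_box) (auto simp: \<psi>_def Basis_vec_def inner_axis)
    moreover have "(\<Prod>b\<in>Basis. (\<psi> u - \<psi> l) \<bullet> b) = (\<Prod>i\<in>UNIV. (u - l) \<bullet> e i)"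
      by (subst prod.reindex_bij_betw[OF bij_betw_axis_Basis, symmetric])
        (simp add: \<psi>_def inner_axis inner_diff_left)
    moreover have "\<dots> = (\<Prod>b\<in>Basis. (u - l) \<bullet> b)"
      by (rule prod.reindex_bij_betw[OF e])
    ultimately show "emeasure (distr lborel borel \<phi>) (box l u) = (\<Prod>b\<in>Basis. (u - l) \<bullet> b)"
      by (simp add: emeasure_distr)
  qed simp
  then have "emeasure lborel (\<phi> ` S) = emeasure lborel (\<phi> -` \<phi> ` S)"
    using borel emeasure_distr[of \<phi> lborel borel "\<phi> ` S"] by simp
  also have "\<phi> -` \<phi> ` S = S"
    using inj_on_inverseI[of UNIV \<psi> \<phi>] \<psi>\<phi> by (intro inj_vimage_image_eq) blast
  finally show "emeasure lborel (\<phi> ` S) = emeasure lborel S" .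
qed

text \<open>Conjugation by the coordinate map turns \<open>f\<close> into \<open>F\<close> on
  vectors with ordered indices, where the factor is a determinant. Only its existence is recorded:
  for multiplication by a matrix on a space of matrices the value is found more easily from
  multiplicativity.\<close>

lemma linear_scales_measure:
  fixes f :: "'a::euclidean_space \<Rightarrow> 'a" and e :: "'w::finite \<Rightarrow> 'a"
  assumes e: "bij_betw e UNIV Basis" and f: "linear f" "inj f"
  shows "\<exists>c::real>0. \<forall>S. S \<in> sets borel \<longrightarrow> bounded S \<longrightarrow>
           f ` S \<in> sets borel \<and> measure lborel (f ` S) = c * measure lborel S"
proof -
  define e' :: "'w wo \<Rightarrow> 'a" where "e' = e \<circ> Rep_wo"
  have e': "bij_betw e' UNIV Basis"
    unfolding e'_def by (rule bij_betw_trans[OF bij_Rep_wo e])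
  define \<phi> where "\<phi> = (\<lambda>x::real^('w wo). \<Sum>i\<in>UNIV. (x $ i) *\<^sub>R e' i)"
  define \<psi> where "\<psi> = (\<lambda>y::'a. (\<chi> i. y \<bullet> e' i) :: real^('w wo))"
  have \<phi>\<psi>: "\<phi> (\<psi> y) = y" for y
  proof -
    have "\<phi> (\<psi> y) = (\<Sum>i\<in>UNIV. (y \<bullet> e' i) *\<^sub>R e' i)"
      by (simp add: \<phi>_def \<psi>_def)
    also have "\<dots> = (\<Sum>b\<in>Basis. (y \<bullet> b) *\<^sub>R b)"
      by (rule sum.reindex_bij_betw[OF e'])
    finally show ?thesis by (simp add: euclidean_representation)
  qed
  have e'_in: "e' i \<in> Basis" and e'_inj: "inj e'" for i
    using e' by (auto simp: bij_betw_def)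
  have \<psi>\<phi>: "\<psi> (\<phi> x) = x" for x
    by (simp add: \<phi>_def \<psi>_def vec_eq_iff inner_sum_left inner_Basis e'_in inj_eq[OF e'_inj]
        if_distrib sum.delta cong: if_cong)
  have lin: "linear \<phi>" "linear \<psi>"
    unfolding \<phi>_def \<psi>_def
    by (auto intro!: linearI simp: scaleR_left_distrib sum.distrib scaleR_sum_right inner_add_left vec_eq_iff)
  define F where "F = \<psi> \<circ> f \<circ> \<phi>"
  have "inj \<phi>" "inj \<psi>"
    using \<psi>\<phi> \<phi>\<psi> by (auto intro: inj_on_inverseI)
  then have F: "linear F" "inj F"
    unfolding F_def using lin f by (auto intro!: linear_compose inj_compose)
  have detF: "\<bar>det (matrix F)\<bar> > 0"
    using F by (simp add: det_nz_iff_inj)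
  have F_meas: "measure lborel (F ` S) = \<bar>det (matrix F)\<bar> * measure lborel S"
    if S: "S \<in> sets borel" "bounded S" "F ` S \<in> sets borel" for S
  proof -
    have "S \<in> lmeasurable"
      using S by (intro bounded_set_imp_lmeasurable) auto
    then show ?thesis
      using measure_linear_image[OF F(1), of S] S by (simp add: measure_completion)
  qed
  show ?thesis
  proof (intro exI conjI allI impI)
    show "\<bar>det (matrix F)\<bar> > 0" by fact
  next
    fix S :: "'a set" assume S: "S \<in> sets borel" "bounded S"
    obtain g where g: "linear g" "\<And>x. g (f x) = x" "\<And>x. f (g x) = x"
      using linear_injective_isomorphism[OF f] by auto
    have "f ` S = g -` S"
      using g by (auto intro: image_eqI[where x = "g _"])
    moreover have "g \<in> borel_measurable borel"
      using g(1) by (rule borel_measurable_linear)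
    ultimately show fS: "f ` S \<in> sets borel"
      using measurable_sets[of g borel borel S] S by simp
    have borel\<psi>: "\<psi> ` T \<in> sets borel" if "T \<in> sets borel" for T
    proof -
      have "\<psi> ` T = \<phi> -` T" using \<psi>\<phi> \<phi>\<psi> by (auto intro: image_eqI[where x = "\<phi> _"])
      moreover have "\<phi> \<in> borel_measurable borel"
        using lin(1) by (rule borel_measurable_linear)
      ultimately show ?thesis using measurable_sets[of \<phi> borel borel T] that by simp
    qed
    have eq: "\<phi> ` \<psi> ` T = T" for T
      by (simp add: image_image \<phi>\<psi>)
    have m\<psi>: "measure lborel (\<psi> ` T) = measure lborel T" if "T \<in> sets borel" for T
      using emeasure_lborel_basis_image(1)[OF e' borel\<psi>[OF that]] eq[of T]
      unfolding \<phi>_def by (simp add: measure_def)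
    have "F ` \<psi> ` S = \<psi> ` f ` S"
      by (simp add: F_def image_image \<phi>\<psi>)
    moreover have "bounded (\<psi> ` S)"
      using S(2) lin(2) bounded_linear_image linear_conv_bounded_linear by blast
    ultimately show "measure lborel (f ` S) = \<bar>det (matrix F)\<bar> * measure lborel S"
      using F_meas[of "\<psi> ` S"] borel\<psi>[OF S(1)] borel\<psi>[OF fS] m\<psi>[OF S(1)] m\<psi>[OF fS] by simp
  qed
qed

section \<open>Elementary row operations\<close>

definition row_op :: "'k \<Rightarrow> 'k \<Rightarrow> real \<Rightarrow> real^'l^'k \<Rightarrow> real^'l^'k::finite" where
  "row_op i j s X = (\<chi> a. if a = i then X $ i + s *\<^sub>R X $ j else X $ a)"

definition diag_mat :: "('k \<Rightarrow> real) \<Rightarrow> real^'k^'k::finite" where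
  "diag_mat f = (\<chi> i j. if i = j then f i else 0)"

text \<open>This turns out to be the special linear group, see
  \<open>matrix_eq_row_op_products\<close>. The induction rule serves twice: for multiplicative
  functions of matrices and for sets invariant under single row operations.\<close>

inductive_set row_op_products :: "(real^'k^'k::finite) set" where
  one: "mat 1 \<in> row_op_products"
| step: "X \<in> row_op_products \<Longrightarrow> i \<noteq> j \<Longrightarrow> row_op i j s X \<in> row_op_products"

lemma row_op_matrix_mult: "row_op i j s (X ** Y) = row_op i j s X ** Y"
  by (auto simp: row_op_def vec_eq_iff matrix_matrix_mult_def sum_distrib_left sum.distrib algebra_simps)

lemma row_op_eq_mult: "row_op i j s X = row_op i j s (mat 1) ** X"
  by (metis matrix_mul_lid row_op_matrix_mult)

lemma diag_mat_mult_component: "(diag_mat f ** X) $ a = f a *\<^sub>R X $ a"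
  by (simp add: diag_mat_def matrix_matrix_mult_def vec_eq_iff if_distrib[of "\<lambda>x. x * _"] cong: if_cong)

lemma diag_mat_mult_diag_mat: "diag_mat f ** diag_mat g = diag_mat (\<lambda>i. f i * g i)"
  by (simp add: vec_eq_iff diag_mat_mult_component) (simp add: diag_mat_def)

lemma det_diag_mat: "det (diag_mat f) = prod f UNIV"
  by (subst det_diagonal) (auto simp: diag_mat_def)

lemma diag_mat_1: "diag_mat (\<lambda>_. 1) = mat 1"
  by (simp add: diag_mat_def mat_def)

lemma row_op_products_mult:
  "X \<in> row_op_products \<Longrightarrow> Y \<in> row_op_products \<Longrightarrow> X ** Y \<in> row_op_products"
  by (induction rule: row_op_products.induct)
    (auto simp: row_op_matrix_mult[symmetric] intro: row_op_products.step)

lemma det_row_op: "i \<noteq> j \<Longrightarrow> det (row_op i j s X) = det (X :: real^'k^'k::finite)"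
proof -
  assume "i \<noteq> j"
  have "row_op i j s X = (\<chi> k. if k = i then row i X + s *s row j X else row k X)"
    by (simp add: row_op_def row_def vec_eq_iff)
  then show ?thesis
    using det_row_operation[OF \<open>i \<noteq> j\<close>, of X s] by simp
qed

lemma det_row_op_products: "X \<in> row_op_products \<Longrightarrow> det X = 1"
  by (induction rule: row_op_products.induct) (auto simp: det_row_op)

lemma diag_mat_row_op:
  assumes "f j \<noteq> 0"
  shows "diag_mat f ** row_op i j s X = row_op i j (s * f i / f j) (diag_mat f ** X)"
  using assms by (auto simp: vec_eq_iff diag_mat_mult_component) (auto simp: row_op_def diag_mat_mult_component algebra_simps)

text \<open>Conjugation by \<open>diag_mat f\<close> rescales the parameter of a row operation by
  \<open>f i / f j\<close>, so diagonal factors can be collected on the right.\<close>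

lemma diag_mat_normalizes_row_op_products:
  assumes "X \<in> row_op_products" "\<And>i. f i \<noteq> 0"
  shows "\<exists>X' \<in> row_op_products. diag_mat f ** X = X' ** diag_mat f"
  using assms(1)
proof induction
  case one
  show ?case by (intro bexI[of _ "mat 1"]) (auto intro: row_op_products.one)
next
  case (step X i j s)
  then show ?case
    using assms(2) by (metis diag_mat_row_op row_op_matrix_mult row_op_products.step)
qed

definition single_diag :: "'k \<Rightarrow> real \<Rightarrow> real^'k^'k::finite" where
  "single_diag i a = diag_mat (\<lambda>x. if x = i then a else 1)"

text \<open>If w(a) denotes three alternating row operations with parameters a, -1/a, a, then the
  word in the proof is w(a) w(-1), the usual expression of a diagonal element of SL(2).\<close>

lemma pair_diag_in_row_op_products:
  assumes "i \<noteq> j" "a \<noteq> 0"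
  shows "diag_mat (\<lambda>x. if x = i then a else if x = j then 1 / a else 1) \<in> row_op_products"
proof -
  have "diag_mat (\<lambda>x. if x = i then a else if x = j then 1 / a else 1) =
    row_op i j a (row_op j i (- 1 / a) (row_op i j a (row_op i j (- 1) (row_op j i 1 (row_op i j (- 1) (mat 1))))))"
    using assms by (auto simp: vec_eq_iff row_op_def diag_mat_def mat_def)
  then show ?thesis
    using assms by (auto intro!: row_op_products.intros)
qed

text \<open>Products of an element of \<open>row_op_products\<close> with a diagonal matrix that is
  trivial away from \<open>k0\<close> are closed under multiplication, and every invertible
  elementary matrix has this form. Comparing determinants identifies the remaining entry.\<close>

lemma matrix_eq_row_op_products:
  fixes A :: "real^'k^'k::finite" and k0 :: 'k
  assumes "det A \<noteq> 0"
  shows "\<exists>E \<in> row_op_products. A = E ** single_diag k0 (det A)"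
proof -
  define D where "D = single_diag k0"
  define Q where "Q = (\<lambda>A. \<exists>E \<in> row_op_products. \<exists>b. b \<noteq> 0 \<and> A = E ** D b)"
  have Q_mult: "Q (A ** B)" if AB: "Q A" "Q B" for A B
  proof -
    obtain E b F c where *: "E \<in> row_op_products" "F \<in> row_op_products" "b \<noteq> 0" "c \<noteq> 0"
      "A = E ** D b" "B = F ** D c"
      using AB unfolding Q_def by blast
    have "\<exists>F' \<in> row_op_products. D b ** F = F' ** D b"
      unfolding D_def single_diag_def
      by (rule diag_mat_normalizes_row_op_products) (use * in auto)
    then obtain F' where F': "F' \<in> row_op_products" "D b ** F = F' ** D b"
      by blast
    have "A ** B = E ** (D b ** F) ** D c"
      by (simp add: * matrix_mul_assoc)
    also have "\<dots> = (E ** F') ** (D b ** D c)"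
      by (simp add: F' matrix_mul_assoc)
    also have "D b ** D c = D (b * c)"
      by (auto simp: D_def single_diag_def diag_mat_mult_diag_mat intro!: arg_cong[of _ _ diag_mat])
    finally show ?thesis
      unfolding Q_def using * F'
      by (intro bexI[of _ "E ** F'"] exI[of _ "b * c"]) (auto intro: row_op_products_mult)
  qed
  have Q_row_op: "Q (row_op i j s A)" if "Q A" "i \<noteq> j" for A i j s
    using that unfolding Q_def by (fastforce simp: row_op_matrix_mult intro: row_op_products.step)
  have Q_single: "Q (single_diag i a)" if "a \<noteq> 0" for i a
  proof (cases "i = k0")
    case True
    then show ?thesis unfolding Q_def D_def
      using that by (intro bexI[of _ "mat 1"] exI[of _ a]) (auto intro: row_op_products.one)
  next
    case False
    have "single_diag i a = diag_mat (\<lambda>x. if x = i then a else if x = k0 then 1 / a else 1) ** D a"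
      using False that by (auto simp: D_def single_diag_def diag_mat_mult_diag_mat intro!: arg_cong[of _ _ diag_mat])
    then show ?thesis unfolding Q_def
      using pair_diag_in_row_op_products[OF False that] that by blast
  qed
  have Q_diag: "Q (diag_mat f)" if f: "\<And>i. f i \<noteq> 0" for f
  proof -
    have "Q (diag_mat (\<lambda>i. if i \<in> K then f i else 1))" if "finite K" for K
      using that
    proof induction
      case empty
      have "Q (single_diag k0 1)" by (rule Q_single) simp
      moreover have "single_diag k0 1 = diag_mat (\<lambda>i. if i \<in> {} then f i else 1)"
        by (simp add: single_diag_def)
      ultimately show ?case by simp
    next
      case (insert x K)
      have "diag_mat (\<lambda>i. if i \<in> insert x K then f i else 1) =
          single_diag x (f x) ** diag_mat (\<lambda>i. if i \<in> K then f i else 1)"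
        using insert by (auto simp: single_diag_def diag_mat_mult_diag_mat intro!: arg_cong[of _ _ diag_mat])
      then show ?case using Q_mult Q_single f insert by metis
    qed
    from this[of UNIV] show ?thesis by simp
  qed
  have "det A \<noteq> 0 \<longrightarrow> Q A"
  proof (rule induct_matrix_elementary_alt[of "\<lambda>A. det A \<noteq> 0 \<longrightarrow> Q A" A])
    show "det (A ** B) \<noteq> 0 \<longrightarrow> Q (A ** B)" if "det A \<noteq> 0 \<longrightarrow> Q A" "det B \<noteq> 0 \<longrightarrow> Q B" for A B
      using that Q_mult by (auto simp: det_mul)
    show "det A \<noteq> 0 \<longrightarrow> Q A" if "row i A = 0" for A and i :: 'k
      using that by (simp add: det_zero_row)
    show "det A \<noteq> 0 \<longrightarrow> Q A" if "\<And>i j. i \<noteq> j \<Longrightarrow> A $ i $ j = 0" for A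
    proof
      assume nz: "det A \<noteq> 0"
      have A: "A = diag_mat (\<lambda>i. A $ i $ i)"
        using that by (auto simp: diag_mat_def vec_eq_iff)
      then have "prod (\<lambda>i. A $ i $ i) UNIV \<noteq> 0"
        using nz by (metis det_diag_mat)
      then show "Q A" by (subst A) (rule Q_diag, simp)
    qed
    show "det (\<chi> i j. mat 1 $ i $ Transposition.transpose m n j) \<noteq> 0 \<longrightarrow>
        Q (\<chi> i j. mat 1 $ i $ Transposition.transpose m n j)" if mn: "m \<noteq> n" for m n :: 'k
    proof
      \<comment> \<open>A transposition has determinant -1, so it needs one sign besides row
        operations.\<close>
      have "(\<chi> i j. mat 1 $ i $ Transposition.transpose m n j) =
          row_op m n 1 (row_op n m (- 1) (row_op m n 1 (single_diag m (- 1))))"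
        using mn by (auto simp: vec_eq_iff row_op_def diag_mat_def single_diag_def mat_def Transposition.transpose_def)
      then show "Q (\<chi> i j. mat 1 $ i $ Transposition.transpose m n j)"
        using mn by (auto intro!: Q_row_op Q_single)
    qed
    show "det (\<chi> i j. of_bool (i = m \<and> j = n \<or> i = j)) \<noteq> 0 \<longrightarrow>
        Q (\<chi> i j. of_bool (i = m \<and> j = n \<or> i = j))" if mn: "m \<noteq> n" for m n :: 'k
    proof
      have "(\<chi> i j. of_bool (i = m \<and> j = n \<or> i = j)) = row_op m n 1 (single_diag m 1)"
        using mn by (auto simp: vec_eq_iff row_op_def diag_mat_def single_diag_def)
      then show "Q (\<chi> i j. of_bool (i = m \<and> j = n \<or> i = j))"
        using mn by (auto intro!: Q_row_op Q_single)
    qed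
  qed
  then obtain E b where E: "E \<in> row_op_products" "b \<noteq> 0" "A = E ** D b"
    using assms unfolding Q_def by blast
  have "det A = b"
    by (simp add: E(3) det_mul det_row_op_products[OF E(1)] D_def single_diag_def det_diag_mat)
  then show ?thesis using E unfolding D_def by blast
qed

text \<open>Conjugation by \<open>single_diag i 2\<close> doubles the parameter of a row operation,
  and so does squaring. Hence the value of \<open>c\<close> at a row operation equals its own
  square, and positivity leaves only 1.\<close>

lemma multiplicative_row_op_products:
  fixes c :: "real^'k^'k::finite \<Rightarrow> real"
  assumes mult: "\<And>A B. det A \<noteq> 0 \<Longrightarrow> det B \<noteq> 0 \<Longrightarrow> c (A ** B) = c A * c B"
    and pos: "\<And>A. det A \<noteq> 0 \<Longrightarrow> c A > 0"
    and X: "X \<in> row_op_products"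
  shows "c X = 1"
proof -
  have one: "c (mat 1) = 1"
    using mult[of "mat 1" "mat 1"] pos[of "mat 1"] by simp
  have trans: "c (row_op i j s (mat 1)) = 1" if ij: "i \<noteq> j" for i j s
  proof -
    define t where "t = (\<lambda>s. row_op i j s (mat 1))"
    have det_t: "det (t s) = 1" for s
      using ij by (simp add: t_def det_row_op)
    have det_d: "det (single_diag i 2) \<noteq> 0"
      by (simp add: single_diag_def det_diag_mat)
    have "single_diag i 2 ** t s = t (2 * s) ** single_diag i 2"
      unfolding t_def single_diag_def using ij
      by (subst diag_mat_row_op) (auto simp: row_op_matrix_mult[symmetric] mult.commute)
    then have "c (single_diag i 2) * c (t s) = c (t (2 * s)) * c (single_diag i 2)"
      using mult det_t det_d by (metis zero_neq_one)
    then have "c (t s) = c (t (2 * s))"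
      using pos[OF det_d] by simp
    moreover have "t (2 * s) = t s ** t s"
      using ij by (simp add: t_def row_op_matrix_mult[symmetric])
        (auto simp: row_op_def vec_eq_iff)
    ultimately have "c (t s) = c (t s) * c (t s)"
      using mult[of "t s" "t s"] det_t by simp
    then show ?thesis
      using pos[of "t s"] det_t unfolding t_def by simp
  qed
  from X show ?thesis
  proof induction
    case (step X i j s)
    then show ?case
      using trans[of i j s] mult[of "row_op i j s (mat 1)" X] det_row_op_products[OF step(1)]
      by (simp add: det_row_op row_op_eq_mult[of i j s X])
  qed (rule one)
qed

text \<open>The only factor left over from \<open>row_op_products\<close> is a diagonal sign, an
  involution, so its value is a positive number with square 1.\<close>

lemma multiplicative_abs_det_1:
  fixes c :: "real^'k^'k::finite \<Rightarrow> real"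
  assumes mult: "\<And>A B. det A \<noteq> 0 \<Longrightarrow> det B \<noteq> 0 \<Longrightarrow> c (A ** B) = c A * c B"
    and pos: "\<And>A. det A \<noteq> 0 \<Longrightarrow> c A > 0"
    and A: "\<bar>det A\<bar> = 1"
  shows "c A = 1"
proof -
  fix k0 :: 'k
  have "single_diag k0 a ** single_diag k0 a = mat 1" if "\<bar>a\<bar> = 1" for a
    unfolding single_diag_def diag_mat_mult_diag_mat diag_mat_1[symmetric]
    using that by (intro arg_cong[of _ _ diag_mat]) (auto simp: abs_if split: if_splits)
  note sq = this[OF A]
  have d: "det (single_diag k0 (det A)) = det A"
    by (simp add: single_diag_def det_diag_mat)
  have nz: "det A \<noteq> 0" using A by auto
  have "c (mat 1) = 1"
    using mult[of "mat 1" "mat 1"] pos[of "mat 1"] by simp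
  then have "c (single_diag k0 (det A)) * c (single_diag k0 (det A)) = 1"
    using mult[of "single_diag k0 (det A)" "single_diag k0 (det A)"] sq d nz by simp
  then have 1: "c (single_diag k0 (det A)) = 1"
    using pos[of "single_diag k0 (det A)"] d nz
    by (metis less_eq_real_def mult_cancel_right1 mult_less_cancel_right1 not_less square_eq_1_iff zero_less_one abs_1 abs_of_pos)
  obtain E where E: "E \<in> row_op_products" "A = E ** single_diag k0 (det A)"
    using matrix_eq_row_op_products[OF nz] by blast
  have "c A = c E * c (single_diag k0 (det A))"
    using mult[of E "single_diag k0 (det A)"] det_row_op_products[OF E(1)] d nz E(2) by simp
  then show ?thesis
    using 1 multiplicative_row_op_products[of c, OF mult pos E(1)] by simp
qed

section \<open>Scaling factors of multiplication by a matrix\<close>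

lemma bounded_image_linear:
  fixes f :: "'a::euclidean_space \<Rightarrow> 'b::euclidean_space"
  assumes "linear f" "bounded S"
  shows "bounded (f ` S)"
  by (rule bounded_linear_image[OF assms(2)]) (use assms(1) linear_conv_bounded_linear in blast)

text \<open>The image of the unit cube names the factor of \<open>linear_scales_measure\<close>,
  which makes it a function of the map, fit for statements of multiplicativity.\<close>

lemma measure_scaled_by_image_unit_cube:
  fixes f :: "'a::euclidean_space \<Rightarrow> 'a" and e :: "'w::finite \<Rightarrow> 'a"
  assumes e: "bij_betw e UNIV Basis" and f: "linear f" "inj f"
  shows "measure lborel (f ` cbox 0 One) > 0"
    and "S \<in> sets borel \<Longrightarrow> bounded S \<Longrightarrow> f ` S \<in> sets borel"
    and "S \<in> sets borel \<Longrightarrow> bounded S \<Longrightarrow>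
      measure lborel (f ` S) = measure lborel (f ` cbox 0 One) * measure lborel S"
proof -
  obtain c :: real where c: "c > 0" "\<And>S. S \<in> sets borel \<Longrightarrow> bounded S \<Longrightarrow>
           f ` S \<in> sets borel \<and> measure lborel (f ` S) = c * measure lborel S"
    using linear_scales_measure[OF e f] by blast
  have "measure lborel (cbox 0 One :: 'a set) = 1"
    by (simp add: content_unit)
  then have "measure lborel (f ` cbox 0 One) = c"
    using c(2)[of "cbox 0 One"] by simp
  then show "measure lborel (f ` cbox 0 One) > 0"
    and "S \<in> sets borel \<Longrightarrow> bounded S \<Longrightarrow> f ` S \<in> sets borel"
    and "S \<in> sets borel \<Longrightarrow> bounded S \<Longrightarrow>
      measure lborel (f ` S) = measure lborel (f ` cbox 0 One) * measure lborel S"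
    using c by auto
qed

lemma measure_scale_multiplicative:
  fixes f g :: "'a::euclidean_space \<Rightarrow> 'a" and e :: "'w::finite \<Rightarrow> 'a"
  assumes e: "bij_betw e UNIV Basis" and f: "linear f" "inj f" and g: "linear g" "inj g"
  shows "measure lborel ((f \<circ> g) ` cbox 0 One) =
    measure lborel (f ` cbox 0 One) * measure lborel (g ` cbox 0 One)"
proof -
  have "bounded (g ` cbox 0 One)"
    by (rule bounded_image_linear[OF g(1) bounded_cbox])
  moreover have "g ` cbox 0 One \<in> sets borel"
    by (rule measure_scaled_by_image_unit_cube(2)[OF e g]) auto
  ultimately show ?thesis
    using measure_scaled_by_image_unit_cube(3)[OF e f] unfolding image_comp[symmetric] by blast
qed

lemma linear_matrix_mult:
  "linear (\<lambda>X::real^'k::finite^'k. A ** X)" "linear (\<lambda>X::real^'k::finite^'k. X ** A)"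
  by (auto intro!: linearI simp: matrix_matrix_mult_def vec_eq_iff sum_distrib_left sum.distrib algebra_simps)

lemma inj_matrix_mult:
  fixes A :: "real^'k::finite^'k"
  assumes "det A \<noteq> 0"
  shows "inj (\<lambda>X::real^'k^'k. A ** X)" "inj (\<lambda>X::real^'k^'k. X ** A)" "inj ((*v) A)"
proof -
  obtain B where B: "A ** B = mat 1" "B ** A = mat 1"
    using assms by (metis invertible_det_nz invertible_def)
  show "inj (\<lambda>X::real^'k^'k. A ** X)"
    by (rule inj_on_inverseI[where g = "\<lambda>X. B ** X"]) (simp add: matrix_mul_assoc B)
  show "inj (\<lambda>X::real^'k^'k. X ** A)"
    by (rule inj_on_inverseI[where g = "\<lambda>X. X ** B"]) (simp add: matrix_mul_assoc[symmetric] B)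
  show "inj ((*v) A)"
    by (rule inj_on_inverseI[where g = "\<lambda>X. B *v X"]) (simp add: matrix_vector_mul_assoc B)
qed

text \<open>The factor is 1 on \<open>row_op_products\<close>, so only the effect of the stretch
  \<open>single_diag k0 (det A)\<close> on the unit cube has to be measured.\<close>

lemma measure_matrix_vector_image:
  fixes A :: "real^'k::finite^'k"
  assumes A: "det A \<noteq> 0" and S: "S \<in> sets borel" "bounded S"
  shows "(*v) A ` S \<in> sets borel" "measure lborel ((*v) A ` S) = \<bar>det A\<bar> * measure lborel S"
proof -
  note e = bij_betw_axis_Basis[where 'w = 'k]
  define c where "c = (\<lambda>A::real^'k^'k. measure lborel ((*v) A ` cbox 0 One))"
  note sc = measure_scaled_by_image_unit_cube[OF e matrix_vector_mul_linear inj_matrix_mult(3)]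
  show "(*v) A ` S \<in> sets borel"
    by (rule sc(2)[OF A S])
  have mult: "c (A ** B) = c A * c B" if "det A \<noteq> 0" "det B \<noteq> 0" for A B
  proof -
    have "(*v) (A ** B) = (*v) A \<circ> (*v) B"
      by (auto simp: matrix_vector_mul_assoc)
    then show ?thesis unfolding c_def
      using measure_scale_multiplicative[OF e matrix_vector_mul_linear inj_matrix_mult(3)[OF that(1)]
          matrix_vector_mul_linear inj_matrix_mult(3)[OF that(2)]] by simp
  qed
  fix k0 :: 'k
  obtain E where E: "E \<in> row_op_products" "A = E ** single_diag k0 (det A)"
    using matrix_eq_row_op_products[OF A] by blast
  have pos: "\<And>A. det A \<noteq> 0 \<Longrightarrow> c A > 0"
    unfolding c_def by (rule sc(1))
  have d: "det (single_diag k0 (det A)) = det A"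
    by (simp add: single_diag_def det_diag_mat)
  have "c E = 1"
    by (rule multiplicative_row_op_products[OF mult pos E(1)])
  then have "c A = c (single_diag k0 (det A))"
    using mult[of E "single_diag k0 (det A)"] E(2) A d det_row_op_products[OF E(1)] by simp
  also have "\<dots> = \<bar>det A\<bar>"
  proof -
    define m where "m = (\<lambda>b::real^'k. if b = axis k0 1 then det A else 1)"
    have "(*v) (single_diag k0 (det A)) = (\<lambda>x. \<Sum>k\<in>Basis. (m k * (x \<bullet> k)) *\<^sub>R k)"
    proof
      fix x
      have "(\<Sum>k\<in>Basis. (m k * (x \<bullet> k)) *\<^sub>R k) = (\<Sum>i\<in>UNIV. (m (axis i 1) * (x $ i)) *\<^sub>R axis i 1)"
        by (subst sum.reindex_bij_betw[OF e, symmetric]) (simp add: inner_axis)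
      moreover have "(\<Sum>i\<in>UNIV. (m (axis i 1) * (x $ i)) *\<^sub>R axis i 1) $ j = m (axis j 1) * x $ j" for j
        by (simp add: axis_def[of _ 1] if_distrib[of "\<lambda>y. _ * y"] cong: if_cong)
      moreover have "(single_diag k0 (det A) *v x) $ j = (if j = k0 then det A else 1) * x $ j" for j
        by (simp add: matrix_vector_mult_def single_diag_def diag_mat_def if_distrib[of "\<lambda>y. y * _"] cong: if_cong)
      ultimately show "single_diag k0 (det A) *v x = (\<Sum>k\<in>Basis. (m k * (x \<bullet> k)) *\<^sub>R k)"
        by (subst vec_eq_iff) (simp add: m_def axis_eq_axis)
    qed
    moreover have "prod m Basis = det A"
      by (subst prod.reindex_bij_betw[OF e, symmetric]) (simp add: m_def axis_eq_axis)
    ultimately show ?thesis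
      unfolding c_def using content_image_stretch_interval[of m 0 One] by (simp add: content_unit)
  qed
  finally show "measure lborel ((*v) A ` S) = \<bar>det A\<bar> * measure lborel S"
    using sc(3)[OF A S] by (simp add: c_def)
qed

text \<open>Both one-sided multiplications have a positive multiplicative factor, and
  \<open>multiplicative_abs_det_1\<close> leaves 1 as its only value. Later the left factor is the
  flow and the right one a change of lattice basis.\<close>

lemma measure_matrix_matrix_image:
  fixes A B :: "real^'k::finite^'k"
  assumes AB: "\<bar>det A\<bar> = 1" "\<bar>det B\<bar> = 1" and S: "S \<in> sets borel" "bounded S"
  shows "(\<lambda>X::real^'k^'k. A ** X ** B) ` S \<in> sets borel"
    "measure lborel ((\<lambda>X. A ** X ** B) ` S) = measure lborel S"
proof -
  note e = bij_betw_axis_axis_Basis[where 'v = 'k and 'w = 'k]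
  note scl = measure_scaled_by_image_unit_cube[OF e linear_matrix_mult(1) inj_matrix_mult(1)]
  note scr = measure_scaled_by_image_unit_cube[OF e linear_matrix_mult(2) inj_matrix_mult(2)]
  define l where "l = (\<lambda>A::real^'k^'k. measure lborel ((\<lambda>X::real^'k^'k. A ** X) ` cbox 0 One))"
  define r where "r = (\<lambda>A::real^'k^'k. measure lborel ((\<lambda>X::real^'k^'k. X ** A) ` cbox 0 One))"
  have nz: "det A \<noteq> 0" "det B \<noteq> 0" using AB by auto
  have "l A = 1"
  proof (rule multiplicative_abs_det_1[OF _ _ AB(1)])
    fix A B :: "real^'k^'k" assume *: "det A \<noteq> 0" "det B \<noteq> 0"
    show "l (A ** B) = l A * l B" unfolding l_def
      using measure_scale_multiplicative[OF e linear_matrix_mult(1) inj_matrix_mult(1)[OF *(1)]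
            linear_matrix_mult(1) inj_matrix_mult(1)[OF *(2)]] by (simp add: matrix_mul_assoc o_def)
  qed (simp add: l_def scl(1))
  moreover have "r B = 1"
  proof (rule multiplicative_abs_det_1[OF _ _ AB(2)])
    fix A B :: "real^'k^'k" assume *: "det A \<noteq> 0" "det B \<noteq> 0"
    \<comment> \<open>Composing right multiplications reverses the order of the matrices; the
      factors are real numbers and commute.\<close>
    have "r (A ** B) = r B * r A" unfolding r_def
      using measure_scale_multiplicative[OF e linear_matrix_mult(2) inj_matrix_mult(2)[OF *(2)]
            linear_matrix_mult(2) inj_matrix_mult(2)[OF *(1)]] by (simp add: matrix_mul_assoc o_def)
    then show "r (A ** B) = r A * r B" by simp
  qed (simp add: r_def scr(1))
  moreover have im: "(\<lambda>X. A ** X ** B) ` S = (\<lambda>X. X ** B) ` (\<lambda>X. A ** X) ` S"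
    by (simp add: image_image)
  moreover have bd: "bounded ((\<lambda>X. A ** X) ` S)"
    by (rule bounded_image_linear[OF linear_matrix_mult(1) S(2)])
  moreover have bo: "(\<lambda>X. A ** X) ` S \<in> sets borel"
    by (rule scl(2)[OF nz(1) S])
  ultimately show "(\<lambda>X::real^'k^'k. A ** X ** B) ` S \<in> sets borel"
    "measure lborel ((\<lambda>X. A ** X ** B) ` S) = measure lborel S"
    using scr(2,3)[OF nz(2) bo bd] scl(3)[OF nz(1) S] by (auto simp: l_def r_def)
qed

section \<open>Packing and Minkowski's theorem for boxes\<close>

text \<open>Comparing volumes of disjoint translates takes the place of integration: Minkowski's
  theorem and the slab estimate are both derived from this inequality.\<close>

lemma packing_bound:
  fixes S C :: "'a::euclidean_space set"
  assumes F: "finite F" and S: "S \<in> sets borel" "bounded S" and C: "C \<in> sets borel" "bounded C"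
    and sub: "\<And>f. f \<in> F \<Longrightarrow> (+) (v f) ` S \<subseteq> C"
    and disj: "disjoint_family_on (\<lambda>f. (+) (v f) ` S) F"
  shows "real (card F) * measure lborel S \<le> measure lborel C"
proof -
  have fin: "emeasure lborel T \<noteq> \<infinity>" if "bounded T" for T :: "'a set"
    using emeasure_bounded_finite[OF that] by simp
  have im: "(+) w ` S = (\<lambda>x. x - w) -` S" for w :: 'a
    by (auto simp: image_iff) (metis add.commute diff_add_cancel)
  have borel: "(+) w ` S \<in> sets borel" for w :: 'a
    unfolding im using measurable_sets[of "\<lambda>x. x - w" borel borel S] S by simp
  have meas: "measure lborel ((+) w ` S) = measure lborel S" for w :: 'a
    using measure_translation[of w S] S(1) borel[of w] by (simp add: measure_completion)
  have bdd: "bounded ((+) w ` S)" for w :: 'a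
    using S(2) by (rule bounded_translation)
  have "real (card F) * measure lborel S = (\<Sum>f\<in>F. measure lborel ((+) (v f) ` S))"
    by (simp add: meas)
  also have "\<dots> = measure lborel (\<Union>f\<in>F. (+) (v f) ` S)"
    using F borel fin[OF bdd] disj by (intro measure_finite_Union[symmetric]) auto
  also have "\<dots> \<le> measure lborel C"
    using sub C fin[OF C(2)] by (intro measure_mono_fmeasurable) (auto simp: fmeasurable_def top.not_eq_extremum F borel intro!: sets.finite_UN)
  finally show ?thesis .
qed

lemma measure_vec_box:
  fixes a b :: "real^'k::finite"
  assumes "\<And>i. a $ i \<le> b $ i"
  shows "measure lborel (box a b) = (\<Prod>i\<in>UNIV. b $ i - a $ i)"
    "measure lborel (cbox a b) = (\<Prod>i\<in>UNIV. b $ i - a $ i)"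
proof -
  have le: "a \<bullet> k \<le> b \<bullet> k" if "k \<in> Basis" for k
    using assms that by (auto simp: Basis_vec_def inner_axis)
  have eq: "(\<Prod>k\<in>Basis. (b - a) \<bullet> k) = (\<Prod>i\<in>UNIV. b $ i - a $ i)"
    by (subst prod.reindex_bij_betw[OF bij_betw_axis_Basis, symmetric]) (simp add: inner_axis)
  show "measure lborel (box a b) = (\<Prod>i\<in>UNIV. b $ i - a $ i)"
    unfolding eq[symmetric] by (rule measure_lborel_box[OF le])
  show "measure lborel (cbox a b) = (\<Prod>i\<in>UNIV. b $ i - a $ i)"
    unfolding eq[symmetric] by (rule measure_lborel_cbox[OF le])
qed

text \<open>If there were no such vector, the lattice translates of an open box with sides
  \<open>a i\<close> would be disjoint, since differences of its points satisfy the inequalities of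
  the conclusion. This is why the sides are \<open>a i\<close> and not \<open>2 * a i\<close>.
  Packing the translates with coefficients below n into a slightly larger parallelepiped contradicts
  \<open>vol\<close> as n grows.\<close>

lemma minkowski_box:
  fixes M :: "real^'k::finite^'k"
  assumes M: "det M \<noteq> 0" and a: "\<And>i. a i > 0" and vol: "\<bar>det M\<bar> < (\<Prod>i\<in>UNIV. a i)"
  shows "\<exists>z \<in> int_vecs - {0}. \<forall>i. \<bar>(M *v z) $ i\<bar> < a i"
proof (rule ccontr)
  assume no: "\<not> ?thesis"
  define S where "S = box 0 (\<chi> i. a i)"
  have memS: "x \<in> S \<longleftrightarrow> (\<forall>i. 0 < x $ i \<and> x $ i < a i)" for x
    by (simp add: S_def mem_box_cart)
  obtain B where B: "M ** B = mat 1" "B ** M = mat 1"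
    using M by (metis invertible_det_nz invertible_def)
  have "bounded ((*v) B ` S)"
    unfolding S_def by (rule bounded_image_linear[OF matrix_vector_mul_linear bounded_box])
  \<comment> \<open>In lattice coordinates a translate leaves the cube of base points by at most
    \<open>c\<close>, a boundary effect that disappears after division by
    \<open>n ^ CARD('k)\<close>.\<close>
  then obtain c where c: "c > 0" "\<And>x. x \<in> S \<Longrightarrow> norm (B *v x) \<le> c"
    by (auto simp: bounded_pos)
  define F where "F = (\<lambda>n. PiE (UNIV :: 'k set) (\<lambda>_. {..<n::nat}))"
  define v where "v = (\<lambda>f. M *v (\<chi> i. real (f i :: nat)))"
  have bound: "(\<Prod>i\<in>UNIV. a i) \<le> \<bar>det M\<bar> * (1 + 2 * c / real n) ^ CARD('k)" if n: "n > 0" for n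
  proof -
    define Q where "Q = cbox (\<chi> i::'k. - c) (\<chi> i::'k. real n + c)"
    have "real (card (F n)) * measure lborel S \<le> measure lborel ((*v) M ` Q)"
    proof (rule packing_bound)
      show "finite (F n)" by (simp add: F_def finite_PiE)
      show "S \<in> sets borel" "bounded S" by (auto simp: S_def)
      show "(*v) M ` Q \<in> sets borel" 
        by (rule measure_matrix_vector_image[OF M]) (auto simp: Q_def)
      show "bounded ((*v) M ` Q)"
        unfolding Q_def by (rule bounded_image_linear[OF matrix_vector_mul_linear bounded_cbox])
      show "(+) (v f) ` S \<subseteq> (*v) M ` Q" if f: "f \<in> F n" for f
      proof (clarify)
        fix x assume "x \<in> S"
        define y where "y = (\<chi> i. real (f i)) + B *v x"
        have "v f + x = M *v y"
          by (simp add: y_def v_def matrix_vector_right_distrib matrix_vector_mul_assoc B)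
        moreover have "y \<in> Q"
        proof -
          have "- c \<le> y $ i \<and> y $ i \<le> real n + c" for i
          proof -
            have "\<bar>(B *v x) $ i\<bar> \<le> c"
              using c(2)[OF \<open>x \<in> S\<close>] component_le_norm_cart[of "B *v x" i] by linarith
            moreover have "f i < n"
              using f PiE_mem[of f UNIV "\<lambda>_. {..<n}" i] by (simp add: F_def)
            moreover have "y $ i = real (f i) + (B *v x) $ i"
              by (simp add: y_def)
            ultimately show ?thesis
              by (simp add: abs_le_iff)
          qed
          then show ?thesis
            by (simp add: Q_def mem_box_cart)
        qed
        ultimately show "v f + x \<in> (*v) M ` Q" by simp
      qed
      show "disjoint_family_on (\<lambda>f. (+) (v f) ` S) (F n)"
        unfolding disjoint_family_on_def
      proof (intro ballI impI)
        fix f g assume fg: "f \<in> F n" "g \<in> F n" "f \<noteq> g"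
        show "(+) (v f) ` S \<inter> (+) (v g) ` S = {}"
        proof (rule ccontr)
          assume "(+) (v f) ` S \<inter> (+) (v g) ` S \<noteq> {}"
          then obtain x y where xy: "x \<in> S" "y \<in> S" "v f + x = v g + y" by auto
          define z where "z = (\<chi> i. real (f i) - real (g i))"
          have "M *v z = v f - v g"
            unfolding v_def matrix_vector_mult_diff_distrib[symmetric]
            by (rule arg_cong[of _ _ "(*v) M"]) (simp add: z_def vec_eq_iff)
          also have "\<dots> = y - x" using xy(3) by (simp add: algebra_simps)
          finally have "\<bar>(M *v z) $ i\<bar> < a i" for i
            using xy(1,2)[unfolded memS, rule_format, of i] by (simp add: abs_less_iff)
          moreover have "z \<in> int_vecs" by (simp add: z_def int_vecs_def)
          moreover have "z \<noteq> 0" using fg(3) by (auto simp: z_def vec_eq_iff)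
          ultimately show False using no by auto
        qed
      qed
    qed
    also have "\<dots> = \<bar>det M\<bar> * measure lborel Q"
      by (rule measure_matrix_vector_image[OF M]) (auto simp: Q_def)
    also have "measure lborel Q = (real n + 2 * c) ^ CARD('k)"
      unfolding Q_def using c(1) by (subst measure_vec_box) (auto simp: algebra_simps)
    also have "measure lborel S = (\<Prod>i\<in>UNIV. a i)"
      unfolding S_def using a by (subst measure_vec_box) (auto simp: less_imp_le)
    also have "card (F n) = n ^ CARD('k)"
      by (simp add: F_def card_PiE)
    finally have "real n ^ CARD('k) * (\<Prod>i\<in>UNIV. a i) \<le> \<bar>det M\<bar> * (real n + 2 * c) ^ CARD('k)"
      by simp
    moreover have "(real n + 2 * c) ^ CARD('k) = real n ^ CARD('k) * (1 + 2 * c / real n) ^ CARD('k)"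
      using n by (simp add: power_mult_distrib[symmetric] field_simps)
    ultimately show ?thesis
      using n by (simp add: mult.left_commute)
  qed
  have "(\<lambda>n. \<bar>det M\<bar> * (1 + 2 * c / real n) ^ CARD('k)) \<longlonglongrightarrow> \<bar>det M\<bar> * (1 + 0) ^ CARD('k)"
    by (intro tendsto_intros lim_const_over_n)
  then have "(\<Prod>i\<in>UNIV. a i) \<le> \<bar>det M\<bar> * (1 + 0) ^ CARD('k)"
    by (rule LIMSEQ_le_const) (use bound in \<open>auto intro!: exI[of _ 1]\<close>)
  then show False using vol by simp
qed

section \<open>Integral matrices and reduced bases\<close>

lemma norm_matrix_vector_mult_le:
  fixes A :: "real^'n^'m"
  shows "norm (A *v x) \<le> norm A * norm x"
proof -
  have "norm (A *v x) = L2_set (\<lambda>i. \<bar>A $ i \<bullet> x\<bar>) UNIV"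
    by (simp add: norm_vec_def matrix_vector_mult_def inner_vec_def)
  also have "\<dots> \<le> L2_set (\<lambda>i. norm (A $ i) * norm x) UNIV"
    by (intro L2_set_mono Cauchy_Schwarz_ineq2) auto
  also have "\<dots> = norm A * norm x"
    by (simp add: L2_set_left_distrib norm_vec_def)
  finally show ?thesis .
qed

lemma norm_transpose: "norm (transpose A) = norm (A :: real^'n^'m)"
proof -
  have "(\<Sum>i\<in>UNIV. \<Sum>j\<in>UNIV. (A $ j $ i)\<^sup>2) = (\<Sum>j\<in>UNIV. \<Sum>i\<in>UNIV. (A $ j $ i)\<^sup>2)"
    by (rule sum.swap)
  then show ?thesis
    by (simp add: norm_vec_def L2_set_def transpose_def real_sqrt_pow2 sum_nonneg)
qed

lemma norm_matrix_matrix_mult_le: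
  fixes A :: "real^'n^'m" and B :: "real^'p^'n"
  shows "norm (A ** B) \<le> norm A * norm B"
proof -
  have eq: "(A ** B) $ i = transpose B *v (A $ i)" for i
    by (simp add: vec_eq_iff matrix_matrix_mult_def matrix_vector_mult_def transpose_def mult.commute)
  have "norm (A ** B) = L2_set (\<lambda>i. norm ((A ** B) $ i)) UNIV"
    by (simp add: norm_vec_def)
  also have "\<dots> \<le> L2_set (\<lambda>i. norm (A $ i) * norm B) UNIV"
  proof (rule L2_set_mono)
    show "norm ((A ** B) $ i) \<le> norm (A $ i) * norm B" for i
      using norm_matrix_vector_mult_le[of "transpose B" "A $ i"]
      unfolding eq norm_transpose by (simp only: mult.commute)
  qed simp
  also have "\<dots> = norm A * norm B"
    by (simp add: L2_set_left_distrib norm_vec_def)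
  finally show ?thesis .
qed

lemma matrix_inv_mult:
  fixes A :: "real^'k^'k::finite"
  assumes "det A \<noteq> 0"
  shows "A ** matrix_inv A = mat 1" "matrix_inv A ** A = mat 1"
proof -
  have "\<exists>B. A ** B = mat 1 \<and> B ** A = mat 1"
    using assms by (simp add: invertible_det_nz[symmetric] invertible_def)
  from someI_ex[OF this] show "A ** matrix_inv A = mat 1" "matrix_inv A ** A = mat 1"
    by (simp_all add: matrix_inv_def)
qed

section \<open>Integral matrices, \<open>GLZ\<close> and sublattices of bounded index\<close>

definition int_mats :: "(real^'k^'k::finite) set" where
  "int_mats = {N. \<forall>i j. N $ i $ j \<in> \<int>}"

definition GLZ :: "(real^'k^'k::finite) set" where
  "GLZ = {\<gamma> \<in> int_mats. \<exists>\<gamma>' \<in> int_mats. \<gamma> ** \<gamma>' = mat 1 \<and> \<gamma>' ** \<gamma> = mat 1}"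

lemma int_mats_mult: "A \<in> int_mats \<Longrightarrow> B \<in> int_mats \<Longrightarrow> A ** B \<in> int_mats"
  by (auto simp: int_mats_def matrix_matrix_mult_def intro!: Ints_sum)

lemma int_mats_1: "mat 1 \<in> int_mats"
  by (auto simp: int_mats_def mat_def)

lemma int_mats_det: "A \<in> int_mats \<Longrightarrow> det A \<in> \<int>"
  unfolding det_def int_mats_def by (intro Ints_sum Ints_mult Ints_prod) auto

lemma int_mats_vec: "A \<in> int_mats \<Longrightarrow> z \<in> int_vecs \<Longrightarrow> A *v z \<in> int_vecs"
  by (auto simp: int_mats_def int_vecs_def matrix_vector_mult_def intro!: Ints_sum)

lemma GLZ_1: "mat 1 \<in> GLZ"
  by (auto simp: GLZ_def int_mats_1)

lemma GLZ_mult: 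
  assumes "A \<in> GLZ" "B \<in> GLZ"
  shows "A ** B \<in> GLZ"
proof -
  obtain A' B' where *: "A \<in> int_mats" "B \<in> int_mats" "A' \<in> int_mats" "B' \<in> int_mats"
    "A ** A' = mat 1" "A' ** A = mat 1" "B ** B' = mat 1" "B' ** B = mat 1"
    using assms by (auto simp: GLZ_def)
  have "(A ** B) ** (B' ** A') = A ** (B ** B') ** A'" "(B' ** A') ** (A ** B) = B' ** (A' ** A) ** B"
    by (simp_all add: matrix_mul_assoc)
  then show ?thesis
    using * by (auto simp: GLZ_def intro!: int_mats_mult bexI[of _ "B' ** A'"])
qed

lemma GLZ_inverse:
  assumes "A \<in> GLZ"
  obtains A' where "A' \<in> GLZ" "A ** A' = mat 1" "A' ** A = mat 1"
  using assms by (auto simp: GLZ_def)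

lemma GLZ_abs_det: "A \<in> GLZ \<Longrightarrow> \<bar>det A\<bar> = 1"
proof -
  assume A: "A \<in> GLZ"
  obtain A' where A': "A' \<in> GLZ" "A ** A' = mat 1" using GLZ_inverse[OF A] by blast
  have "det A * det A' = 1"
    using A'(2) by (metis det_I det_mul)
  moreover have "det A \<in> \<int>" "det A' \<in> \<int>"
    using A A' by (auto simp: GLZ_def intro: int_mats_det)
  moreover have "\<bar>det A\<bar> \<ge> 1" "\<bar>det A'\<bar> \<ge> 1"
    using calculation by (auto intro!: Ints_nonzero_abs_ge1)
  ultimately show ?thesis
    by (metis abs_ge_zero abs_mult abs_1 mult_le_cancel_left1 mult.right_neutral order_antisym not_one_le_zero mult_left_mono)
qed

lemma GLZ_vec: "A \<in> GLZ \<Longrightarrow> z \<in> int_vecs - {0} \<Longrightarrow> A *v z \<in> int_vecs - {0}"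
proof -
  assume A: "A \<in> GLZ" and z: "z \<in> int_vecs - {0}"
  obtain A' where A': "A' ** A = mat 1" using GLZ_inverse[OF A] by blast
  have "A' *v (A *v z) = z"
    by (simp add: matrix_vector_mul_assoc A')
  then have "A *v z \<noteq> 0" using z by auto
  then show ?thesis
    using A z int_mats_vec by (auto simp: GLZ_def)
qed

text \<open>Cramer's rule: the entries of \<open>det N *\<^sub>R B\<close>, with \<open>B\<close>
  the inverse, are determinants of integral matrices.\<close>

lemma int_mats_adjugate:
  assumes N: "N \<in> int_mats" "det N \<noteq> 0"
  obtains C where "C \<in> int_mats" "N ** C = det N *\<^sub>R mat 1" "C ** N = det N *\<^sub>R mat 1"
proof -
  obtain B where B: "N ** B = mat 1" "B ** N = mat 1"
    using N(2) by (metis invertible_det_nz invertible_def)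
  have "(det N *\<^sub>R B) $ k $ j \<in> \<int>" for k j
  proof -
    define x where "x = B *v axis j 1"
    have "N *v x = axis j 1"
      by (simp add: x_def matrix_vector_mul_assoc B)
    then have "x = (\<chi> k. det (\<chi> i l. if l = k then axis j 1 $ i else N $ i $ l) / det N)"
      using cramer[OF N(2)] by blast
    moreover have "B $ k $ j = x $ k"
      by (simp add: x_def matrix_vector_mult_basis column_def)
    ultimately have "(det N *\<^sub>R B) $ k $ j = det (\<chi> i l. if l = k then axis j 1 $ i else N $ i $ l)"
      using N(2) by simp
    moreover have "det (\<chi> i l. if l = k then axis j 1 $ i else N $ i $ l) \<in> \<int>"
      by (rule int_mats_det) (use N(1) in \<open>auto simp: int_mats_def axis_def\<close>)
    ultimately show ?thesis by simp
  qed
  then have "det N *\<^sub>R B \<in> int_mats" by (simp add: int_mats_def)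
  moreover have "N ** (det N *\<^sub>R B) = det N *\<^sub>R mat 1" "(det N *\<^sub>R B) ** N = det N *\<^sub>R mat 1"
    by (simp_all add: linear_scale[OF linear_matrix_mult(1)] linear_scale[OF linear_matrix_mult(2)] B)
  ultimately show thesis by (rule that)
qed

text \<open>Writing N = N' + det N Y and using C' N' = det N 1 gives N = (1 + Y C') N', and
  symmetrically N' = (1 - Y C) N. The two integral factors are mutually inverse because
  \<open>N\<close> and \<open>N'\<close> can be cancelled.\<close>

lemma GLZ_of_cong:
  fixes N N' :: "real^'k^'k::finite"
  assumes N: "N \<in> int_mats" "det N \<noteq> 0" and N': "N' \<in> int_mats" "det N' = det N"
    and cong: "\<And>i j. \<exists>q \<in> \<int>. N $ i $ j - N' $ i $ j = det N * q"
  shows "\<exists>\<gamma> \<in> GLZ. N = \<gamma> ** N'"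
proof -
  obtain X where X: "\<And>i j. X i j \<in> \<int>" "\<And>i j. N $ i $ j - N' $ i $ j = det N * X i j"
    using cong by metis
  define Y :: "real^'k^'k" where "Y = (\<chi> i j. X i j)"
  have Y: "Y \<in> int_mats" "N = N' + det N *\<^sub>R Y"
    using X by (auto simp: Y_def int_mats_def vec_eq_iff algebra_simps)
  obtain C where C: "C \<in> int_mats" "N ** C = det N *\<^sub>R mat 1" "C ** N = det N *\<^sub>R mat 1"
    using int_mats_adjugate[OF N] by blast
  obtain C' where C': "C' \<in> int_mats" "N' ** C' = det N *\<^sub>R mat 1" "C' ** N' = det N *\<^sub>R mat 1"
    using int_mats_adjugate[OF N'(1)] N N' by metis
  define \<gamma> where "\<gamma> = mat 1 + Y ** C'"
  define \<gamma>' where "\<gamma>' = mat 1 - Y ** C"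
  have ints: "\<gamma> \<in> int_mats" "\<gamma>' \<in> int_mats"
    using int_mats_mult[OF Y(1) C'(1)] int_mats_mult[OF Y(1) C(1)] int_mats_1
    by (auto simp: \<gamma>_def \<gamma>'_def int_mats_def)
  have 1: "\<gamma> ** N' = N"
  proof -
    have "\<gamma> ** N' = N' + Y ** (C' ** N')"
      by (simp add: \<gamma>_def linear_add[OF linear_matrix_mult(2)] matrix_mul_assoc)
    then show ?thesis using Y(2) by (simp add: C' linear_scale[OF linear_matrix_mult(1)])
  qed
  have 2: "\<gamma>' ** N = N'"
  proof -
    have "\<gamma>' ** N = N - Y ** (C ** N)"
      by (simp add: \<gamma>'_def linear_diff[OF linear_matrix_mult(2)] matrix_mul_assoc)
    also have "\<dots> = N - det N *\<^sub>R Y"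
      by (simp add: C linear_scale[OF linear_matrix_mult(1)])
    also have "\<dots> = N'"
      using Y(2) by (metis add_diff_cancel_right')
    finally show ?thesis .
  qed
  have inj: "inj (\<lambda>X::real^'k^'k. X ** N)" "inj (\<lambda>X::real^'k^'k. X ** N')"
    using N N' by (simp_all add: inj_matrix_mult(2))
  have "(\<gamma> ** \<gamma>') ** N = mat 1 ** N" "(\<gamma>' ** \<gamma>) ** N' = mat 1 ** N'"
    using 1 2 by (simp_all add: matrix_mul_assoc[symmetric])
  then have "\<gamma> ** \<gamma>' = mat 1" "\<gamma>' ** \<gamma> = mat 1"
    using injD[OF inj(1)] injD[OF inj(2)] by blast+
  then have "\<gamma> \<in> GLZ"
    using ints by (auto simp: GLZ_def)
  then show ?thesis
    using 1 by blast
qed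

text \<open>Congruence modulo the determinant is what makes the set of classes finite, so that no
  normal form of integral matrices is needed.\<close>

lemma finitely_many_classes:
  fixes J :: real
  obtains \<N> :: "(real^'k^'k::finite) set" where "finite \<N>"
    "\<And>N. N \<in> \<N> \<Longrightarrow> det N \<noteq> 0"
    "\<And>N. N \<in> int_mats \<Longrightarrow> det N \<noteq> 0 \<Longrightarrow> \<bar>det N\<bar> \<le> J \<Longrightarrow> \<exists>N' \<in> \<N>. \<exists>\<gamma> \<in> GLZ. N = \<gamma> ** N'"
proof -
  define A :: "(real^'k^'k) set" where "A = {N \<in> int_mats. det N \<noteq> 0 \<and> \<bar>det N\<bar> \<le> J}"
  define key :: "real^'k^'k \<Rightarrow> int \<times> ('k \<times> 'k \<Rightarrow> int)" where
    "key = (\<lambda>N. (\<lfloor>det N\<rfloor>, \<lambda>(i, j). \<lfloor>N $ i $ j\<rfloor> mod \<lfloor>det N\<rfloor>))"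
  have fl: "of_int \<lfloor>x\<rfloor> = x" if "x \<in> \<int>" for x :: real
    using that by (auto elim: Ints_cases)
  have "key ` A \<subseteq> {-\<lceil>J\<rceil>..\<lceil>J\<rceil>} \<times> PiE UNIV (\<lambda>_. {-\<lceil>J\<rceil>..\<lceil>J\<rceil>})"
  proof (rule image_subsetI)
    fix N assume N: "N \<in> A"
    define D where "D = \<lfloor>det N\<rfloor>"
    have D: "of_int D = det N"
      unfolding D_def using N by (intro fl int_mats_det) (simp add: A_def)
    have D0: "D \<noteq> 0" using D N by (auto simp: A_def)
    have "real_of_int \<bar>D\<bar> \<le> J" using D N by (auto simp: A_def)
    then have DJ: "\<bar>D\<bar> \<le> \<lceil>J\<rceil>" by linarith
    \<comment> \<open>\<open>D\<close> may be negative; the symmetric range covers both signs of the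
      residue.\<close>
    have "x mod D \<in> {-\<lceil>J\<rceil>..\<lceil>J\<rceil>}" for x :: int
      using abs_mod_less[OF D0, of x] DJ by auto
    then show "key N \<in> {-\<lceil>J\<rceil>..\<lceil>J\<rceil>} \<times> PiE UNIV (\<lambda>_. {-\<lceil>J\<rceil>..\<lceil>J\<rceil>})"
      using DJ unfolding key_def D_def[symmetric] by (auto simp: PiE_iff abs_le_iff)
  qed
  then have fin: "finite (key ` A)"
    by (rule finite_subset) (auto intro!: finite_PiE)
  define \<N> where "\<N> = inv_into A key ` key ` A"
  have rep: "\<exists>N' \<in> \<N>. \<exists>\<gamma> \<in> GLZ. N = \<gamma> ** N'" if N: "N \<in> A" for N
  proof -
    define N' where "N' = inv_into A key (key N)"
    have N'A: "N' \<in> A" and k: "key N' = key N"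
      using N by (auto simp: N'_def inv_into_into f_inv_into_f)
    have "\<lfloor>det N'\<rfloor> = \<lfloor>det N\<rfloor>" using k by (simp add: key_def)
    then have det: "det N' = det N"
      using N N'A fl int_mats_det by (metis (no_types, lifting) A_def mem_Collect_eq)
    have "\<exists>q \<in> \<int>. N $ i $ j - N' $ i $ j = det N * q" for i j
    proof -
      have "\<lfloor>N $ i $ j\<rfloor> mod \<lfloor>det N\<rfloor> = \<lfloor>N' $ i $ j\<rfloor> mod \<lfloor>det N\<rfloor>"
        using arg_cong[OF k, of "\<lambda>x. snd x (i, j)"] det by (simp add: key_def)
      then obtain q where q: "\<lfloor>N $ i $ j\<rfloor> - \<lfloor>N' $ i $ j\<rfloor> = \<lfloor>det N\<rfloor> * q"
        by (metis mod_eq_dvd_iff dvdE)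
      have "N $ i $ j \<in> \<int>" "N' $ i $ j \<in> \<int>" "det N \<in> \<int>"
        using N N'A int_mats_det by (auto simp: A_def int_mats_def)
      then have "N $ i $ j - N' $ i $ j = det N * of_int q"
        using arg_cong[OF q, of real_of_int] fl by simp
      then show ?thesis by auto
    qed
    then have "\<exists>\<gamma> \<in> GLZ. N = \<gamma> ** N'"
      using N N'A det by (intro GLZ_of_cong) (auto simp: A_def)
    moreover have "N' \<in> \<N>" using N by (auto simp: N'_def \<N>_def)
    ultimately show ?thesis by blast
  qed
  have sub: "N \<in> A" if "N \<in> \<N>" for N
    using that by (auto simp: \<N>_def inv_into_into)
  show thesis
  proof (rule that[of \<N>])
    show "finite \<N>" using fin by (simp add: \<N>_def)
    show "det N \<noteq> 0" if "N \<in> \<N>" for N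
      using sub[OF that] by (simp add: A_def)
    show "\<exists>N' \<in> \<N>. \<exists>\<gamma> \<in> GLZ. N = \<gamma> ** N'"
      if "N \<in> int_mats" "det N \<noteq> 0" "\<bar>det N\<bar> \<le> J" for N
      using that by (intro rep) (simp add: A_def)
  qed
qed

lemma abs_det_le:
  fixes W :: "real^'k^'k::finite"
  assumes "\<And>i j. \<bar>W $ i $ j\<bar> \<le> B"
  shows "\<bar>det W\<bar> \<le> real (card {p. p permutes (UNIV :: 'k set)}) * B ^ CARD('k)"
proof -
  have "\<bar>det W\<bar> \<le> (\<Sum>p | p permutes (UNIV :: 'k set). \<bar>of_int (sign p) * (\<Prod>i\<in>UNIV. W $ i $ p i)\<bar>)"
    unfolding det_def by (rule sum_abs)
  also have "\<dots> \<le> (\<Sum>p | p permutes (UNIV :: 'k set). B ^ CARD('k))"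
  proof (rule sum_mono)
    fix p :: "'k \<Rightarrow> 'k"
    have "\<bar>\<Prod>i\<in>UNIV. W $ i $ p i\<bar> = (\<Prod>i\<in>UNIV. \<bar>W $ i $ p i\<bar>)"
      by (rule abs_prod)
    also have "\<dots> \<le> (\<Prod>i\<in>(UNIV :: 'k set). B)"
      using assms by (intro prod_mono) auto
    finally show "\<bar>of_int (sign p) * (\<Prod>i\<in>UNIV. W $ i $ p i)\<bar> \<le> B ^ CARD('k)"
      by (simp add: abs_mult sign_def)
  qed
  finally show ?thesis by simp
qed

text \<open>In the row of a coordinate of maximal modulus of a kernel vector, the off-diagonal terms
  cannot cancel the diagonal one.\<close>

lemma det_nonzero_of_dominant:
  fixes W :: "real^'k^'k::finite"
  assumes "\<epsilon> > 0" and diag: "\<And>i. \<bar>W $ i $ i\<bar> > real CARD('k) * \<epsilon>"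
    and off: "\<And>i j. i \<noteq> j \<Longrightarrow> \<bar>W $ i $ j\<bar> \<le> \<epsilon>"
  shows "det W \<noteq> 0"
proof
  assume "det W = 0"
  then obtain x where x: "x \<noteq> 0" "W *v x = 0"
    by (metis invertible_det_nz matrix_left_invertible_ker invertible_left_inverse)
  obtain j where j: "\<And>i. \<bar>x $ i\<bar> \<le> \<bar>x $ j\<bar>"
  proof -
    have "finite (range (\<lambda>i. \<bar>x $ i\<bar>))" "range (\<lambda>i. \<bar>x $ i\<bar>) \<noteq> {}" by auto
    then have "Max (range (\<lambda>i. \<bar>x $ i\<bar>)) \<in> range (\<lambda>i. \<bar>x $ i\<bar>)" by (rule Max_in)
    then obtain j where "\<bar>x $ j\<bar> = Max (range (\<lambda>i. \<bar>x $ i\<bar>))" by force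
    then show thesis using that[of j] by simp
  qed
  have xj: "\<bar>x $ j\<bar> > 0"
  proof (rule ccontr)
    assume "\<not> \<bar>x $ j\<bar> > 0"
    then have "x $ i = 0" for i using j[of i] by simp
    then show False using x(1) by (simp add: vec_eq_iff)
  qed
  have "0 = (\<Sum>i\<in>UNIV. W $ j $ i * x $ i)"
    using arg_cong[OF x(2), of "\<lambda>v. v $ j"] by (simp add: matrix_vector_mult_def)
  also have "\<dots> = W $ j $ j * x $ j + (\<Sum>i\<in>UNIV - {j}. W $ j $ i * x $ i)"
    by (simp add: sum.remove)
  finally have "\<bar>W $ j $ j\<bar> * \<bar>x $ j\<bar> = \<bar>\<Sum>i\<in>UNIV - {j}. W $ j $ i * x $ i\<bar>"
    unfolding abs_mult[symmetric] by linarith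
  also have "\<dots> \<le> (\<Sum>i\<in>UNIV - {j}. \<bar>W $ j $ i * x $ i\<bar>)"
    by (rule sum_abs)
  also have "\<dots> \<le> (\<Sum>i\<in>UNIV - {j}. \<epsilon> * \<bar>x $ j\<bar>)"
    using off j assms(1) by (intro sum_mono) (auto simp: abs_mult intro!: mult_mono)
  also have "\<dots> \<le> (\<Sum>i\<in>(UNIV :: 'k set). \<epsilon> * \<bar>x $ j\<bar>)"
    using assms(1) by (intro sum_mono2) auto
  also have "\<dots> = real CARD('k) * \<epsilon> * \<bar>x $ j\<bar>" by simp
  finally show False
    using diag[of j] xj by simp
qed

text \<open>Minkowski's theorem for a box elongated along each coordinate axis in turn yields lattice
  vectors forming a diagonally dominant matrix, hence a sublattice of bounded index.\<close>

lemma exists_bounded_basis: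
  fixes \<eta> b :: real
  assumes "\<eta> > 0"
  obtains R where "\<And>M :: real^'k^'k::finite. det M \<noteq> 0 \<Longrightarrow> \<bar>det M\<bar> \<le> b \<Longrightarrow>
    (\<And>z. z \<in> int_vecs - {0} \<Longrightarrow> \<eta> \<le> norm (M *v z)) \<Longrightarrow> \<exists>\<gamma> \<in> GLZ. norm (M ** \<gamma>) \<le> R"
proof -
  define d where "d = real CARD('k)"
  have d1: "d \<ge> 1" by (simp add: d_def Suc_leI)
  \<comment> \<open>A lattice vector whose other coordinates are at most \<epsilon> has norm at
    least \<eta>, so its long coordinate is at least \<eta> - d \<epsilon> = (d + 1) \<epsilon>,
    beyond the threshold d \<epsilon> of diagonal dominance.\<close>
  define \<epsilon> where "\<epsilon> = \<eta> / (2 * d + 1)"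
  have \<epsilon>: "\<epsilon> > 0" using assms d1 by (simp add: \<epsilon>_def)
  have \<epsilon>\<eta>: "\<eta> = (2 * d + 1) * \<epsilon>" using d1 by (simp add: \<epsilon>_def)
  \<comment> \<open>The box with one side \<open>R1\<close> and all others \<epsilon> has volume
    \<open>\<bar>b\<bar> + 1\<close>, strictly above \<open>\<bar>det M\<bar>\<close>.\<close>
  define R1 where "R1 = (\<bar>b\<bar> + 1) / \<epsilon> ^ (CARD('k) - 1)"
  have R1: "R1 > 0" using \<epsilon> by (simp add: R1_def)
  define B where "B = max \<epsilon> R1"
  \<comment> \<open>\<open>P\<close> bounds \<open>\<bar>det (M ** N)\<bar>\<close>; together with
    the lower bound \<open>\<epsilon> ^ CARD('k)\<close> for \<open>\<bar>det M\<bar>\<close> it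
    bounds the index \<open>\<bar>det N\<bar>\<close>.\<close>
  define P where "P = real (card {p. p permutes (UNIV :: 'k set)}) * B ^ CARD('k)"
  obtain \<N> :: "(real^'k^'k) set" where \<N>: "finite \<N>" "\<And>N. N \<in> \<N> \<Longrightarrow> det N \<noteq> 0"
    "\<And>N. N \<in> int_mats \<Longrightarrow> det N \<noteq> 0 \<Longrightarrow> \<bar>det N\<bar> \<le> P / \<epsilon> ^ CARD('k) \<Longrightarrow>
      \<exists>N' \<in> \<N>. \<exists>\<gamma> \<in> GLZ. N = \<gamma> ** N'"
    using finitely_many_classes by metis
  define c where "c = (\<Sum>N\<in>\<N>. norm (matrix_inv N))"
  define R2 where "R2 = d * (d * B)"
  have "\<exists>\<gamma> \<in> GLZ. norm (M ** \<gamma>) \<le> R2 * c"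
    if M: "det M \<noteq> 0" "\<bar>det M\<bar> \<le> b" "\<And>z. z \<in> int_vecs - {0} \<Longrightarrow> \<eta> \<le> norm (M *v z)"
    for M :: "real^'k^'k"
  proof -
    have norm_le: "norm x \<le> (\<Sum>i\<in>UNIV. \<bar>x $ i\<bar>)" for x :: "real^'k"
      by (rule norm_le_l1_cart)
    \<comment> \<open>Were the covolume smaller, Minkowski's theorem would give a nonzero lattice
      vector shorter than \<eta>.\<close>
    have det_low: "\<epsilon> ^ CARD('k) \<le> \<bar>det M\<bar>"
    proof (rule ccontr)
      assume "\<not> ?thesis"
      then have "\<exists>z \<in> int_vecs - {0}. \<forall>i. \<bar>(M *v z) $ i\<bar> < \<epsilon>"
        using \<epsilon> M(1) by (intro minkowski_box) auto
      then obtain z where z: "z \<in> int_vecs - {0}" "\<And>i. \<bar>(M *v z) $ i\<bar> < \<epsilon>" by blast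
      have "\<eta> \<le> (\<Sum>i\<in>UNIV. \<bar>(M *v z) $ i\<bar>)"
        using M(3)[OF z(1)] norm_le[of "M *v z"] by linarith
      also have "\<dots> \<le> (\<Sum>i\<in>(UNIV :: 'k set). \<epsilon>)"
        using z(2) by (intro sum_mono less_imp_le)
      finally have "\<eta> \<le> d * \<epsilon>" by (simp add: d_def)
      then show False using \<epsilon> d1 unfolding \<epsilon>\<eta> by (simp add: algebra_simps) (smt (verit) mult_pos_pos)
    qed
    have "\<exists>z \<in> int_vecs. (\<forall>j. j \<noteq> i \<longrightarrow> \<bar>(M *v z) $ j\<bar> \<le> \<epsilon>) \<and> \<bar>(M *v z) $ i\<bar> \<le> R1 \<and>
        \<bar>(M *v z) $ i\<bar> > d * \<epsilon>" for i
    proof -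
      have "(\<Prod>j\<in>UNIV. if j = i then R1 else \<epsilon>) = R1 * (\<Prod>j\<in>UNIV - {i}. \<epsilon>)"
        by (subst prod.remove[of _ i]) (auto intro!: prod.cong)
      also have "\<dots> = \<bar>b\<bar> + 1"
        using \<epsilon> by (simp add: R1_def card_Diff_singleton)
      finally have "\<exists>z \<in> int_vecs - {0}. \<forall>j. \<bar>(M *v z) $ j\<bar> < (if j = i then R1 else \<epsilon>)"
        using \<epsilon> R1 M by (intro minkowski_box) auto
      then obtain z where z: "z \<in> int_vecs - {0}" "\<And>j. \<bar>(M *v z) $ j\<bar> < (if j = i then R1 else \<epsilon>)"
        by blast
      have "\<eta> \<le> (\<Sum>j\<in>UNIV. \<bar>(M *v z) $ j\<bar>)"
        using M(3)[OF z(1)] norm_le[of "M *v z"] by linarith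
      also have "\<dots> = \<bar>(M *v z) $ i\<bar> + (\<Sum>j\<in>UNIV - {i}. \<bar>(M *v z) $ j\<bar>)"
        by (simp add: sum.remove)
      also have "(\<Sum>j\<in>UNIV - {i}. \<bar>(M *v z) $ j\<bar>) \<le> (\<Sum>j\<in>UNIV - {i}. \<epsilon>)"
      proof (rule sum_mono)
        fix j assume "j \<in> UNIV - {i}"
        then show "\<bar>(M *v z) $ j\<bar> \<le> \<epsilon>" using z(2)[of j] by auto
      qed
      also have "(\<Sum>j\<in>UNIV - {i}. \<epsilon>) \<le> (\<Sum>j\<in>(UNIV::'k set). \<epsilon>)"
        using \<epsilon> by (intro sum_mono2) auto
      also have "\<dots> = d * \<epsilon>" by (simp add: d_def)
      finally have "(2 * d + 1) * \<epsilon> \<le> \<bar>(M *v z) $ i\<bar> + d * \<epsilon>"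
        unfolding \<epsilon>\<eta> by simp
      then have "d * \<epsilon> < \<bar>(M *v z) $ i\<bar>"
        using \<epsilon> by (simp add: algebra_simps)
      moreover have "\<bar>(M *v z) $ j\<bar> \<le> \<epsilon>" if "j \<noteq> i" for j
        using z(2)[of j] that by simp
      ultimately show ?thesis using z(1) z(2)[of i] by (intro bexI[of _ z]) auto
    qed
    then obtain z where z: "\<And>i. z i \<in> int_vecs" "\<And>i j. j \<noteq> i \<Longrightarrow> \<bar>(M *v z i) $ j\<bar> \<le> \<epsilon>"
      "\<And>i. \<bar>(M *v z i) $ i\<bar> \<le> R1" "\<And>i. \<bar>(M *v z i) $ i\<bar> > d * \<epsilon>"
      by metis
    define N :: "real^'k^'k" where "N = (\<chi> a i. z i $ a)"
    have N: "N \<in> int_mats" using z(1) by (auto simp: N_def int_mats_def int_vecs_def)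
    have W: "(M ** N) $ a $ i = (M *v z i) $ a" for a i
      by (simp add: N_def matrix_matrix_mult_def matrix_vector_mult_def)
    have WB: "\<bar>(M ** N) $ a $ i\<bar> \<le> B" for a i
      using z(2,3)[of i] z(2)[of a i] unfolding W B_def by (cases "a = i") (auto simp: max_def)
    have dW: "det (M ** N) \<noteq> 0"
      by (rule det_nonzero_of_dominant[OF \<epsilon>]) (use z in \<open>auto simp: W d_def\<close>)
    then have dN: "det N \<noteq> 0" by (simp add: det_mul)
    have "\<epsilon> ^ CARD('k) * \<bar>det N\<bar> \<le> \<bar>det M\<bar> * \<bar>det N\<bar>"
      using det_low by (rule mult_right_mono) simp
    also have "\<dots> = \<bar>det (M ** N)\<bar>" by (simp add: det_mul abs_mult)
    also have "\<dots> \<le> P" unfolding P_def by (rule abs_det_le[OF WB])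
    finally have "\<bar>det N\<bar> \<le> P / \<epsilon> ^ CARD('k)"
      using \<epsilon> by (simp add: field_simps)
    then obtain N' \<gamma> where N': "N' \<in> \<N>" "\<gamma> \<in> GLZ" "N = \<gamma> ** N'"
      using \<N>(3)[OF N dN] by blast
    have inv: "N' ** matrix_inv N' = mat 1"
      using \<N>(2)[OF N'(1)] by (rule matrix_inv_mult)
    \<comment> \<open>As N = \<gamma> N', the new basis is the bounded matrix M N times one of
      finitely many inverses.\<close>
    have "M ** \<gamma> = (M ** N) ** matrix_inv N'"
      by (simp add: N'(3) matrix_mul_assoc[symmetric] inv)
    then have "norm (M ** \<gamma>) \<le> norm (M ** N) * norm (matrix_inv N')"
      using norm_matrix_matrix_mult_le by metis
    also have "\<dots> \<le> R2 * c"
    proof (rule mult_mono)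
      have "norm (M ** N) \<le> (\<Sum>a\<in>UNIV. norm ((M ** N) $ a))"
        unfolding norm_vec_def[of "M ** N"] by (rule L2_set_le_sum) simp
      also have "\<dots> \<le> (\<Sum>a\<in>(UNIV::'k set). \<Sum>i\<in>UNIV. \<bar>(M ** N) $ a $ i\<bar>)"
        by (intro sum_mono norm_le)
      also have "\<dots> \<le> (\<Sum>a\<in>(UNIV::'k set). \<Sum>i\<in>(UNIV::'k set). B)"
        by (intro sum_mono WB)
      also have "\<dots> = R2" by (simp add: R2_def d_def)
      finally show "norm (M ** N) \<le> R2" .
      show "norm (matrix_inv N') \<le> c"
        unfolding c_def using N'(1) \<N>(1) by (intro member_le_sum) auto
      show "0 \<le> R2" using \<epsilon> by (simp add: R2_def d_def B_def max_def)
    qed simp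
    finally show ?thesis using N'(2) by blast
  qed
  then show thesis by (rule that)
qed

section \<open>Measure of matrices with a small value at an integral vector\<close>

definition entry_cube :: "real \<Rightarrow> (real^'a::finite^'b::finite) set" where
  "entry_cube R = {X. \<forall>i j. \<bar>X $ i $ j\<bar> \<le> R}"

lemma entry_cube_eq_cbox: "entry_cube R = cbox (\<chi> i j. - R) (\<chi> i j. R)"
proof -
  have abs: "\<bar>y\<bar> \<le> R \<longleftrightarrow> - R \<le> y \<and> y \<le> R" for y :: real by auto
  show ?thesis
    unfolding entry_cube_def abs by (auto simp: mem_box Basis_vec_def inner_axis)
qed

lemma entry_cube_props:
  "entry_cube R \<in> sets borel" "bounded (entry_cube R)" "compact (entry_cube R)"
  by (simp_all add: entry_cube_eq_cbox)

lemma slab_borel: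
  fixes w :: "real^'a::finite" and I :: "'b::finite set"
  shows "{X::real^'a^'b. X \<in> entry_cube R \<and> (\<forall>i\<in>I. \<bar>X $ i \<bullet> w - p i\<bar> < l)} \<in> sets borel"
proof -
  have "open (\<Inter>i\<in>I. {X::real^'a^'b. \<bar>X $ i \<bullet> w - p i\<bar> < l})"
    by (intro open_INT finite ballI open_Collect_less continuous_intros)
  then have "entry_cube R \<inter> (\<Inter>i\<in>I. {X::real^'a^'b. \<bar>X $ i \<bullet> w - p i\<bar> < l}) \<in> sets borel"
    using entry_cube_props(1) by (intro sets.Int) auto
  moreover have "entry_cube R \<inter> (\<Inter>i\<in>I. {X::real^'a^'b. \<bar>X $ i \<bullet> w - p i\<bar> < l}) =
      {X. X \<in> entry_cube R \<and> (\<forall>i\<in>I. \<bar>X $ i \<bullet> w - p i\<bar> < l)}"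
    by auto
  ultimately show ?thesis by simp
qed

text \<open>Moving entry j of each row in \<open>I\<close> by multiples of
  \<open>2 * l / w $ j\<close> shifts the linear forms by multiples of \<open>2 * l\<close>, so the
  slab has disjoint translates, and about x = |w_j| R / (2 l) of them per row stay inside the cube
  of twice the size. When x < 1, the trivial bound by the whole cube is enough.\<close>

lemma slab_measure:
  fixes w :: "real^'a::finite" and I :: "'b::finite set"
  assumes R: "R > 0" and l: "l > 0" and w: "w $ j \<noteq> 0"
  shows "measure lborel {X::real^'a^'b. X \<in> entry_cube R \<and> (\<forall>i\<in>I. \<bar>X $ i \<bullet> w - p i\<bar> < l)}
    \<le> measure lborel (entry_cube (2 * R) :: (real^'a^'b) set) * (4 * l / (\<bar>w $ j\<bar> * R)) ^ card I"
    (is "measure lborel ?E \<le> ?\<mu> * _")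
proof -
  have E: "?E \<in> sets borel" "bounded ?E"
    using slab_borel[of R I w p l] bounded_subset[OF entry_cube_props(2)[of R], of ?E] by auto
  have fin: "entry_cube (2 * R) \<in> fmeasurable (lborel :: (real^'a^'b) measure)"
    using emeasure_bounded_finite[OF entry_cube_props(2)] entry_cube_props(1) by (intro fmeasurableI) auto
  define x where "x = \<bar>w $ j\<bar> * R / (2 * l)"
  have x: "x > 0" using R l w by (simp add: x_def)
  have ratio: "4 * l / (\<bar>w $ j\<bar> * R) = 2 / x"
    by (simp add: x_def)
  show ?thesis
  proof (cases "x < 1")
    case True
    have "\<bar>X $ i $ a\<bar> \<le> 2 * R" if "X \<in> ?E" for X i a
    proof -
      have "\<bar>X $ i $ a\<bar> \<le> R" using that by (simp add: entry_cube_def)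
      then show ?thesis using R by linarith
    qed
    then have "?E \<subseteq> entry_cube (2 * R)"
      unfolding entry_cube_def[of "2 * R"] by blast
    then have "measure lborel ?E \<le> ?\<mu>"
      using fin E by (intro measure_mono_fmeasurable) simp_all
    moreover have "1 \<le> (2 / x) ^ card I"
      using True x by (intro one_le_power) simp
    then have "?\<mu> * 1 \<le> ?\<mu> * (2 / x) ^ card I"
      by (intro mult_left_mono) auto
    ultimately show ?thesis unfolding ratio by linarith
  next
    case False
    define N where "N = nat \<lfloor>x\<rfloor>"
    have "\<lfloor>x\<rfloor> \<ge> 1" using False by linarith
    then have "real N = of_int \<lfloor>x\<rfloor>" "real N \<ge> 1"
      by (simp_all add: N_def)
    \<comment> \<open>Rounding x down to \<open>N\<close> costs at most a factor 2, which turns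
      \<open>2 * l\<close> into \<open>4 * l\<close> in the bound.\<close>
    then have N1: "real N \<le> x" "real N \<ge> 1" "x \<le> 2 * real N"
      by linarith+
    define F where "F = PiE I (\<lambda>_. {..<N})"
    define v :: "('b \<Rightarrow> nat) \<Rightarrow> real^'a^'b" where
      "v = (\<lambda>f. \<chi> i. if i \<in> I then axis j (2 * l / w $ j * real (f i)) else 0)"
    have vw: "v f $ i \<bullet> w = 2 * l * real (f i)" if "i \<in> I" for f i
      using that w by (simp add: v_def inner_axis' )
    have "real (card F) * measure lborel ?E \<le> ?\<mu>"
    proof (rule packing_bound[OF _ E entry_cube_props(1,2)])
      show "finite F" by (simp add: F_def finite_PiE)
      show "(+) (v f) ` ?E \<subseteq> entry_cube (2 * R)" if f: "f \<in> F" for f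
      proof (rule image_subsetI)
        fix X assume X: "X \<in> ?E"
        have "\<bar>v f $ i $ a\<bar> \<le> R" for i a
        proof (cases "i \<in> I \<and> a = j")
          case True
          have "f i < N" using f True by (auto simp: F_def PiE_def Pi_def)
          then have "real (f i) \<le> x" using N1(1) by linarith
          then have "2 * l * real (f i) \<le> \<bar>w $ j\<bar> * R"
            using l by (simp add: x_def field_simps)
          then show ?thesis
            using True w l by (simp add: v_def axis_def abs_mult divide_simps mult.commute)
        next
          case False
          then show ?thesis using R by (auto simp: v_def axis_def)
        qed
        moreover have "\<bar>X $ i $ a\<bar> \<le> R" for i a
          using X by (simp add: entry_cube_def)
        ultimately have "\<bar>v f $ i $ a + X $ i $ a\<bar> \<le> R + R" for i a
          by (intro order_trans[OF abs_triangle_ineq] add_mono)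
        then show "v f + X \<in> entry_cube (2 * R)"
          by (simp add: entry_cube_def)
      qed
      show "disjoint_family_on (\<lambda>f. (+) (v f) ` ?E) F"
        unfolding disjoint_family_on_def
      proof (intro ballI impI)
        fix f g assume fg: "f \<in> F" "g \<in> F" "f \<noteq> g"
        show "(+) (v f) ` ?E \<inter> (+) (v g) ` ?E = {}"
        proof (rule ccontr)
          assume "\<not> ?thesis"
          then obtain X Y where XY: "X \<in> ?E" "Y \<in> ?E" "v f + X = v g + Y" by auto
          obtain i where i: "i \<in> I" "f i \<noteq> g i"
            using fg PiE_ext[of f I "\<lambda>_. {..<N}" g] unfolding F_def by blast
          have "(v f + X) $ i \<bullet> w = (v g + Y) $ i \<bullet> w" using XY(3) by simp
          then have "2 * l * real (f i) + X $ i \<bullet> w = 2 * l * real (g i) + Y $ i \<bullet> w"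
            using vw[OF i(1)] by (simp add: inner_add_left)
          then have "2 * l * (real (f i) - real (g i)) = Y $ i \<bullet> w - X $ i \<bullet> w"
            by (simp add: algebra_simps)
          then have "\<bar>Y $ i \<bullet> w - X $ i \<bullet> w\<bar> = 2 * l * \<bar>real (f i) - real (g i)\<bar>"
            using l by (metis abs_mult abs_of_pos mult_pos_pos zero_less_numeral)
          moreover have "\<bar>Y $ i \<bullet> w - X $ i \<bullet> w\<bar> < 2 * l"
          proof -
            have "\<bar>X $ i \<bullet> w - p i\<bar> < l" "\<bar>Y $ i \<bullet> w - p i\<bar> < l"
              using XY(1,2) i(1) by auto
            then show ?thesis by linarith
          qed
          moreover have "\<bar>real (f i) - real (g i)\<bar> \<ge> 1"
            using i(2) by linarith
          then have "2 * l * 1 \<le> 2 * l * \<bar>real (f i) - real (g i)\<bar>"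
            using l by (intro mult_left_mono) auto
          ultimately show False by linarith
        qed
      qed
    qed
    moreover have "card F = N ^ card I" by (simp add: F_def card_PiE)
    ultimately have 1: "real N ^ card I * measure lborel ?E \<le> ?\<mu>" by simp
    have "1 \<le> (2 / x * real N) ^ card I"
      using N1 x by (intro one_le_power) (simp add: field_simps)
    from mult_right_mono[OF this, of "measure lborel ?E"]
    have "measure lborel ?E \<le> (2 / x * real N) ^ card I * measure lborel ?E"
      by simp
    also have "\<dots> = (2 / x) ^ card I * (real N ^ card I * measure lborel ?E)"
      unfolding power_mult_distrib by (simp only: mult.assoc)
    also have "\<dots> \<le> (2 / x) ^ card I * ?\<mu>"
      using 1 x by (intro mult_left_mono) auto
    finally show ?thesis unfolding ratio by (simp add: mult.commute)
  qed
qed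

text \<open>Integral vectors of maximum norm \<open>k\<close>, sorted by a coordinate attaining it:
  that coordinate is the divisor in \<open>slab_measure\<close>, and fixing it up to sign saves one
  power of \<open>k\<close> in the count.\<close>

definition sup_shell :: "'a \<Rightarrow> nat \<Rightarrow> (real^'a::finite) set" where
  "sup_shell j k = {w \<in> int_vecs. \<bar>w $ j\<bar> = real k \<and> (\<forall>i. \<bar>w $ i\<bar> \<le> real k)}"

lemma sup_shell_card:
  assumes k: "k \<ge> 1"
  shows "finite (sup_shell j k :: (real^'a::finite) set)"
    "card (sup_shell j k :: (real^'a::finite) set) \<le> 2 * (3 * k) ^ (CARD('a) - 1)"
proof -
  define F where "F = PiE (UNIV :: 'a set) (\<lambda>i. if i = j then {- int k, int k} else {- int k .. int k})"
  define h :: "('a \<Rightarrow> int) \<Rightarrow> real^'a" where "h = (\<lambda>f. \<chi> i. of_int (f i))"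
  have sub: "sup_shell j k \<subseteq> h ` F"
  proof
    fix w :: "real^'a" assume w: "w \<in> sup_shell j k"
    define f where "f = (\<lambda>i. \<lfloor>w $ i\<rfloor>)"
    have fw: "of_int (f i) = w $ i" for i
      using w by (auto simp: f_def sup_shell_def int_vecs_def)
    have "real_of_int \<bar>f i\<bar> \<le> real_of_int (int k)" for i
      using w fw[of i] by (simp add: sup_shell_def)
    then have "\<bar>f i\<bar> \<le> int k" for i
      unfolding of_int_le_iff .
    then have 1: "- int k \<le> f i \<and> f i \<le> int k" for i
      by (meson abs_le_D1 abs_le_D2 minus_le_iff)
    have "real_of_int \<bar>f j\<bar> = real_of_int (int k)"
      using w fw[of j] by (simp add: sup_shell_def)
    then have 2: "\<bar>f j\<bar> = int k"
      unfolding of_int_eq_iff .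
    have "f \<in> F"
      using 1 2 by (auto simp: F_def PiE_iff)
    moreover have "w = h f" by (simp add: h_def fw vec_eq_iff)
    ultimately show "w \<in> h ` F" by simp
  qed
  have finF: "finite F" by (auto simp: F_def intro!: finite_PiE)
  show "finite (sup_shell j k :: (real^'a) set)"
    using finite_subset[OF sub] finF by blast
  have "card (sup_shell j k :: (real^'a) set) \<le> card F"
    using card_mono[OF finite_imageI[OF finF] sub] card_image_le[OF finF, of h] by linarith
  also have "card F = (\<Prod>i\<in>UNIV. card (if i = j then {- int k, int k} else {- int k .. int k}))"
    by (simp add: F_def card_PiE)
  also have "\<dots> = card {- int k, int k} * (\<Prod>i\<in>UNIV - {j}. card {- int k .. int k})"
    by (subst prod.remove[of _ j]) (auto intro!: prod.cong)
  also have "\<dots> = card {- int k, int k} * (2 * k + 1) ^ (CARD('a) - 1)"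
    by (simp add: card_Diff_singleton nat_add_distrib nat_mult_distrib)
  also have "\<dots> \<le> 2 * (3 * k) ^ (CARD('a) - 1)"
    using k by (intro mult_mono power_mono) (auto intro: card_insert_le_m1)
  finally show "card (sup_shell j k :: (real^'a) set) \<le> 2 * (3 * k) ^ (CARD('a) - 1)" .
qed

lemma in_sup_shell:
  assumes "w \<in> int_vecs - {0}"
  obtains j k where "w \<in> sup_shell j k" "k \<ge> 1"
proof -
  obtain j where j: "\<And>i. \<bar>w $ i\<bar> \<le> \<bar>w $ j\<bar>"
  proof -
    have "finite (range (\<lambda>i. \<bar>w $ i\<bar>))" "range (\<lambda>i. \<bar>w $ i\<bar>) \<noteq> {}" by auto
    then have "Max (range (\<lambda>i. \<bar>w $ i\<bar>)) \<in> range (\<lambda>i. \<bar>w $ i\<bar>)" by (rule Max_in)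
    then obtain j where "\<bar>w $ j\<bar> = Max (range (\<lambda>i. \<bar>w $ i\<bar>))" by force
    then show thesis using that[of j] by simp
  qed
  have "\<bar>w $ j\<bar> \<noteq> 0"
  proof
    assume "\<bar>w $ j\<bar> = 0"
    then have "w $ i = 0" for i using j[of i] by simp
    then show False using assms by (auto simp: vec_eq_iff)
  qed
  moreover have "w $ j \<in> \<int>" using assms by (simp add: int_vecs_def)
  then obtain n where n: "w $ j = of_int n" by (auto elim: Ints_cases)
  ultimately have "w \<in> sup_shell j (nat \<bar>n\<bar>)" "nat \<bar>n\<bar> \<ge> 1"
    using assms j by (auto simp: sup_shell_def)
  then show thesis by (rule that)
qed

text \<open>With a = \<open>CARD('a)\<close>, there are about k^(a-1) vectors w and k^e shifts p for
  each k, and each slab has measure about (l/k)^(card I). By \<open>dims\<close> the product is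
  about l^(card I) k^(n-1), and at most X values of k occur. The shifts allow two uses: a
  homogeneous one for square matrices with e = 0, and an inhomogeneous one for the block
  \<open>A\<close>.\<close>

lemma union_slab_measure:
  fixes I :: "'b::finite set" and P :: "nat \<Rightarrow> ('b \<Rightarrow> real) set"
  assumes R: "R > 0" and l: "l > 0" and X: "X \<ge> 0" and Y: "Y \<ge> 0"
    and P: "\<And>k. finite (P k)" "\<And>k. k \<ge> 1 \<Longrightarrow> real (card (P k)) \<le> (Y * real k) ^ e"
    and dims: "CARD('a) + e = card I + n" "n \<ge> 1"
  defines "C \<equiv> real CARD('a) * (2 * 3 ^ (CARD('a) - 1) * Y ^ e *
    (measure lborel (entry_cube (2 * R) :: (real^'a::finite^'b) set) * (4 / R) ^ card I))"
  obtains B :: "(real^'a^'b) set" where "B \<in> sets borel" "bounded B" "measure lborel B \<le> C * l ^ card I * X ^ n"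
    "\<And>A j k w p. A \<in> entry_cube R \<Longrightarrow> w \<in> sup_shell j k \<Longrightarrow> k \<ge> 1 \<Longrightarrow> real k \<le> X \<Longrightarrow> p \<in> P k \<Longrightarrow>
       (\<And>i. i \<in> I \<Longrightarrow> \<bar>A $ i \<bullet> w - p i\<bar> < l) \<Longrightarrow> A \<in> B"
proof -
  define \<mu> where "\<mu> = measure lborel (entry_cube (2 * R) :: (real^'a^'b) set)"
  have \<mu>0: "\<mu> \<ge> 0" by (simp add: \<mu>_def)
  define E where "E = (\<lambda>w p. {A::real^'a^'b. A \<in> entry_cube R \<and> (\<forall>i\<in>I. \<bar>A $ i \<bullet> w - p i\<bar> < l)})"
  define K where "K = {k::nat. k \<ge> 1 \<and> real k \<le> X}"
  have K_sub: "K \<subseteq> {1..nat \<lfloor>X\<rfloor>}" by (auto simp: K_def le_nat_floor)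
  then have finK: "finite K" by (rule finite_subset) simp
  have "card K \<le> nat \<lfloor>X\<rfloor>" using card_mono[OF _ K_sub] by simp
  then have cardK: "real (card K) \<le> X" using X by linarith
  define B1 where "B1 = (\<lambda>j k. \<Union>w\<in>sup_shell j k. \<Union>p\<in>P k. E w p)"
  define B where "B = (\<Union>j\<in>UNIV. \<Union>k\<in>K. B1 j k)"
  have Eb: "E w p \<in> sets borel" for w p
    unfolding E_def by (rule slab_borel)
  have B1b: "B1 j k \<in> sets borel" if "k \<in> K" for j k
    unfolding B1_def using that P(1) sup_shell_card(1) Eb by (intro sets.finite_UN) (auto simp: K_def)
  have Bb: "B \<in> sets borel"
    unfolding B_def using B1b finK by (intro sets.finite_UN) auto
  have B1m: "measure lborel (B1 j k) \<le> 2 * 3 ^ (CARD('a) - 1) * Y ^ e * (\<mu> * (4 / R) ^ card I) * l ^ card I * X ^ (n - 1)"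
    if k: "k \<in> K" for j k
  proof -
    have k1: "k \<ge> 1" "real k \<le> X" using k by (auto simp: K_def)
    have "measure lborel (B1 j k) \<le> (\<Sum>w\<in>sup_shell j k. measure lborel (\<Union>p\<in>P k. E w p))"
      unfolding B1_def using sup_shell_card(1)[OF k1(1)] Eb P(1)
      by (intro measure_UNION_le) (auto intro!: sets.finite_UN)
    also have "\<dots> \<le> (\<Sum>w\<in>sup_shell j k. \<Sum>p\<in>P k. measure lborel (E w p))"
      using Eb P(1) by (intro sum_mono measure_UNION_le) auto
    also have "\<dots> \<le> (\<Sum>w\<in>sup_shell j k. \<Sum>p\<in>P k. \<mu> * (4 * l / (real k * R)) ^ card I)"
    proof (intro sum_mono)
      fix w p assume w: "w \<in> sup_shell j k"
      have "\<bar>w $ j\<bar> = real k" using w by (simp add: sup_shell_def)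
      moreover have "w $ j \<noteq> 0" using calculation k1 by auto
      ultimately show "measure lborel (E w p) \<le> \<mu> * (4 * l / (real k * R)) ^ card I"
        using slab_measure[OF R l, of w j I p] by (simp add: E_def \<mu>_def)
    qed
    also have "\<dots> = real (card (sup_shell j k :: (real^'a) set)) * real (card (P k)) * (\<mu> * (4 * l / (real k * R)) ^ card I)"
      by simp
    also have "\<dots> \<le> (2 * (3 * real k) ^ (CARD('a) - 1)) * (Y * real k) ^ e * (\<mu> * (4 * l / (real k * R)) ^ card I)"
    proof (intro mult_right_mono mult_mono)
      have "real (card (sup_shell j k :: (real^'a) set)) \<le> real (2 * (3 * k) ^ (CARD('a) - 1))"
        using sup_shell_card(2)[OF k1(1)] of_nat_le_iff by blast
      then show "real (card (sup_shell j k :: (real^'a) set)) \<le> 2 * (3 * real k) ^ (CARD('a) - 1)" by simp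
      show "real (card (P k)) \<le> (Y * real k) ^ e" by (rule P(2)[OF k1(1)])
      show "0 \<le> \<mu> * (4 * l / (real k * R)) ^ card I" using \<mu>0 l R by simp
    qed simp_all
    also have "\<dots> = 2 * 3 ^ (CARD('a) - 1) * Y ^ e * (\<mu> * (4 / R) ^ card I) * l ^ card I *
        (real k ^ (CARD('a) - 1 + e) / real k ^ card I)"
    proof -
      have "(4 * l / (real k * R)) ^ card I = (4 / R) ^ card I * l ^ card I / real k ^ card I"
        by (simp add: power_mult_distrib power_divide)
      then show ?thesis
        unfolding power_add by (simp add: power_mult_distrib)
    qed
    also have "CARD('a) - 1 + e = card I + (n - 1)"
      using dims zero_less_card_finite[where 'a = 'a] by linarith
    also have "real k ^ (card I + (n - 1)) / real k ^ card I = real k ^ (n - 1)"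
      using k1(1) by (simp add: power_add)
    also have "2 * 3 ^ (CARD('a) - 1) * Y ^ e * (\<mu> * (4 / R) ^ card I) * l ^ card I * real k ^ (n - 1)
      \<le> 2 * 3 ^ (CARD('a) - 1) * Y ^ e * (\<mu> * (4 / R) ^ card I) * l ^ card I * X ^ (n - 1)"
      using k1(2) Y \<mu>0 R l by (intro mult_left_mono power_mono) auto
    finally show ?thesis .
  qed
  let ?q = "2 * 3 ^ (CARD('a) - 1) * Y ^ e * (\<mu> * (4 / R) ^ card I) * l ^ card I * X ^ (n - 1)"
  have q0: "?q \<ge> 0" using Y \<mu>0 R l X by simp
  have "measure lborel B \<le> (\<Sum>j\<in>(UNIV::'a set). measure lborel (\<Union>k\<in>K. B1 j k))"
    unfolding B_def using B1b finK by (intro measure_UNION_le) (auto intro!: sets.finite_UN)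
  also have "\<dots> \<le> (\<Sum>j\<in>(UNIV::'a set). \<Sum>k\<in>K. measure lborel (B1 j k))"
    using B1b finK by (intro sum_mono measure_UNION_le) auto
  also have "\<dots> \<le> (\<Sum>j\<in>(UNIV::'a set). \<Sum>k\<in>K. ?q)"
    by (intro sum_mono B1m)
  also have "\<dots> = real CARD('a) * (real (card K) * ?q)" by simp
  also have "\<dots> \<le> real CARD('a) * (X * ?q)"
    using cardK q0 by (intro mult_left_mono mult_right_mono) auto
  also have "\<dots> = C * l ^ card I * X ^ n"
    using dims(2) by (cases n) (simp_all add: C_def \<mu>_def mult_ac)
  finally have meas: "measure lborel B \<le> C * l ^ card I * X ^ n" .
  show thesis
  proof (rule that[OF Bb _ meas])
    show "bounded B"
      by (rule bounded_subset[OF entry_cube_props(2)[of R]]) (auto simp: B_def B1_def E_def)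
    fix A :: "real^'a^'b" and j k w p
    assume *: "A \<in> entry_cube R" "w \<in> sup_shell j k" "k \<ge> 1" "real k \<le> X" "p \<in> P k"
      "\<And>i. i \<in> I \<Longrightarrow> \<bar>A $ i \<bullet> w - p i\<bar> < l"
    then have "A \<in> E w p" "k \<in> K"
      by (simp_all add: E_def K_def)
    then show "A \<in> B"
      using *(2,5) unfolding B_def B1_def by blast
  qed
qed

section \<open>The diagonal flow is nonwandering\<close>

definition flow :: "real \<Rightarrow> real^('m::finite + 'n::finite)^('m + 'n)" where
  "flow t = block_diag (t powr (real CARD('n) / real CARD('m))) (1 / t)"

lemma block_diag_eq_diag_mat:
  "block_diag a b = diag_mat (\<lambda>i::'m::finite + 'n::finite. case i of Inl _ \<Rightarrow> a | Inr _ \<Rightarrow> b)"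
  by (simp add: block_diag_def diag_mat_def)

lemma diag_mat_vec: "(diag_mat f *v x) $ i = f i * x $ i"
  by (simp add: diag_mat_def matrix_vector_mult_def if_distrib[of "\<lambda>y. y * _"] cong: if_cong)

lemma flow_vec:
  fixes x :: "real^('m::finite + 'n::finite)"
  shows "(flow t *v x) $ Inl i = t powr (real CARD('n) / real CARD('m)) * x $ Inl i"
    "(flow t *v x) $ Inr j = x $ Inr j / t"
  by (simp_all add: flow_def block_diag_eq_diag_mat diag_mat_vec)

lemma flow_mult: "s > 0 \<Longrightarrow> t > 0 \<Longrightarrow> flow s ** flow t = flow (s * t)"
  unfolding flow_def block_diag_eq_diag_mat diag_mat_mult_diag_mat
  by (intro arg_cong[of _ _ diag_mat] ext) (auto simp: powr_mult split: sum.split)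

lemma flow_1: "flow 1 = mat 1"
  unfolding flow_def block_diag_eq_diag_mat diag_mat_1[symmetric]
  by (intro arg_cong[of _ _ diag_mat] ext) (auto split: sum.split)

lemma flow_inverse: "t > 0 \<Longrightarrow> flow t ** flow (1 / t) = mat 1" "t > 0 \<Longrightarrow> flow (1 / t) ** flow t = mat 1"
  by (simp_all add: flow_mult flow_1)

lemma powr_exponent_power:
  assumes "t > 0"
  shows "(t powr (real CARD('n::finite) / real CARD('m::finite))) ^ CARD('m) = t ^ CARD('n)"
  using assms by (simp add: powr_realpow[symmetric] powr_powr)

lemma det_flow: "t > 0 \<Longrightarrow> det (flow t :: real^('m::finite + 'n::finite)^('m + 'n)) = 1"
proof -
  assume t: "t > 0"
  have "det (flow t :: real^('m + 'n)^('m + 'n)) =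
      (\<Prod>i\<in>(UNIV :: 'm set) <+> (UNIV :: 'n set). case i of
        Inl _ \<Rightarrow> t powr (real CARD('n) / real CARD('m)) | Inr _ \<Rightarrow> 1 / t)"
    unfolding flow_def block_diag_eq_diag_mat det_diag_mat by simp
  also have "\<dots> = (t powr (real CARD('n) / real CARD('m))) ^ CARD('m) * (1 / t) ^ CARD('n)"
    by (subst prod.Plus) simp_all
  also have "\<dots> = 1"
    using t by (simp add: powr_exponent_power power_divide)
  finally show ?thesis .
qed

text \<open>The bottom coordinates of X z are below \<eta> s and the top ones below \<eta> /
  s^(n/m). The lower bound \<open>c\<close> passes from X z to z, so z has size at most about \<eta>
  s / c. The exponents in the flow make the powers of s cancel, so the bound is uniform in
  \<open>s\<close>.\<close>

lemma bad_matrices_measure: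
  fixes c R :: real
  assumes c: "c > 0" and R: "R > 0"
  obtains C where "C \<ge> 0" "\<And>s \<eta>. s \<ge> 1 \<Longrightarrow> \<eta> > 0 \<Longrightarrow>
    \<exists>B \<in> sets borel. bounded B \<and> measure lborel B \<le> C * \<eta> ^ (CARD('m::finite) + CARD('n::finite)) \<and>
      (\<forall>X::real^('m + 'n)^('m + 'n). X \<in> entry_cube R \<longrightarrow> (\<forall>x. c * norm x \<le> norm (X *v x)) \<longrightarrow>
        (\<exists>z \<in> int_vecs - {0}. norm (flow s *v (X *v z)) < \<eta>) \<longrightarrow> X \<in> B)"
proof -
  define d where "d = real (CARD('m) + CARD('n))"
  have d: "d \<ge> 1"
    using zero_less_card_finite[where 'a = 'm] unfolding d_def by linarith
  define I where "I = range (Inl :: 'm \<Rightarrow> 'm + 'n)"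
  have cardI: "card I = CARD('m)"
    by (simp add: I_def card_image)
  define C0 where "C0 = real CARD('m + 'n) * (2 * 3 ^ (CARD('m + 'n) - 1) * 1 ^ 0 *
    (measure lborel (entry_cube (2 * R) :: (real^('m + 'n)^('m + 'n)) set) * (4 / R) ^ card I))"
  have C0: "C0 \<ge> 0" using R by (simp add: C0_def)
  define C where "C = C0 * (d / c) ^ CARD('n)"
  show thesis
  proof (rule that[of C])
    show "C \<ge> 0" using C0 c d by (simp add: C_def)
    fix s \<eta> :: real assume s: "s \<ge> 1" and \<eta>: "\<eta> > 0"
    define a where "a = s powr (real CARD('n) / real CARD('m))"
    have a1: "a \<ge> 1" using s by (simp add: a_def ge_one_powr_ge_zero)
    define l where "l = \<eta> / a"
    define X where "X = d * \<eta> * s / c"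
    have l: "l > 0" using \<eta> a1 by (simp add: l_def)
    have X: "X \<ge> 0" using \<eta> s c d by (simp add: X_def)
    obtain B :: "(real^('m + 'n)^('m + 'n)) set" where B: "B \<in> sets borel" "bounded B"
      "measure lborel B \<le> C0 * l ^ card I * X ^ CARD('n)"
      "\<And>A j k w p. A \<in> entry_cube R \<Longrightarrow> w \<in> sup_shell j k \<Longrightarrow> k \<ge> 1 \<Longrightarrow> real k \<le> X \<Longrightarrow> p \<in> {\<lambda>_. 0 :: real} \<Longrightarrow>
       (\<And>i. i \<in> I \<Longrightarrow> \<bar>A $ i \<bullet> w - p i\<bar> < l) \<Longrightarrow> A \<in> B"
      unfolding C0_def
    proof (rule union_slab_measure[OF R l X, where Y = 1 and e = 0 and P = "\<lambda>_. {\<lambda>_. 0}" and I = I and n = "CARD('n)"])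
      show "CARD('m + 'n) + 0 = card I + CARD('n)" by (simp add: cardI)
    qed (use zero_less_card_finite[where 'a = 'n] in \<open>auto simp: Suc_le_eq\<close>)
    have "l ^ card I * X ^ CARD('n) = (\<eta> ^ CARD('m) / a ^ CARD('m)) * ((d / c) ^ CARD('n) * \<eta> ^ CARD('n) * s ^ CARD('n))"
      by (simp add: l_def X_def cardI power_mult_distrib power_divide)
    also have "a ^ CARD('m) = s ^ CARD('n)"
      unfolding a_def using s by (intro powr_exponent_power) simp
    also have "(\<eta> ^ CARD('m) / s ^ CARD('n)) * ((d / c) ^ CARD('n) * \<eta> ^ CARD('n) * s ^ CARD('n)) =
        (d / c) ^ CARD('n) * \<eta> ^ (CARD('m) + CARD('n))"
      using s by (simp add: power_add)
    finally have "C0 * l ^ card I * X ^ CARD('n) = C * \<eta> ^ (CARD('m) + CARD('n))"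
      by (simp add: C_def mult.assoc)
    moreover have "A \<in> B" if A: "A \<in> entry_cube R" "\<And>x. c * norm x \<le> norm (A *v x)"
      and z: "z \<in> int_vecs - {0}" "norm (flow s *v (A *v z)) < \<eta>" for A :: "real^('m + 'n)^('m + 'n)" and z
    proof -
      define y where "y = A *v z"
      have comp: "\<bar>(flow s *v y) $ i\<bar> < \<eta>" for i
        using component_le_norm_cart[of "flow s *v y" i] z(2) unfolding y_def by linarith
      have top: "\<bar>y $ Inl i\<bar> < l" for i
        using comp[of "Inl i"] a1 unfolding flow_vec a_def[symmetric]
        by (simp add: l_def abs_mult field_simps)
      have bot: "\<bar>y $ Inr i\<bar> < \<eta> * s" for i
        using comp[of "Inr i"] s unfolding flow_vec by (simp add: field_simps)
      have "l \<le> \<eta>" using a1 \<eta> by (simp add: l_def field_simps)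
      moreover have "\<eta> * 1 \<le> \<eta> * s" using s \<eta> by (intro mult_left_mono) auto
      ultimately have le: "l \<le> \<eta> * s" by linarith
      have "\<bar>y $ i\<bar> \<le> \<eta> * s" for i
      proof (cases i)
        case (Inl a)
        then show ?thesis using top[of a] le by simp
      next
        case (Inr a)
        then show ?thesis using bot[of a] by simp
      qed
      then have "(\<Sum>i\<in>UNIV. \<bar>y $ i\<bar>) \<le> (\<Sum>i\<in>(UNIV :: ('m + 'n) set). \<eta> * s)"
        by (intro sum_mono)
      then have ny: "norm y \<le> d * (\<eta> * s)"
        using norm_le_l1_cart[of y] by (simp add: d_def)
      obtain j k where jk: "z \<in> sup_shell j k" "k \<ge> 1"
        using in_sup_shell[OF z(1)] by blast
      have "c * real k = c * \<bar>z $ j\<bar>" using jk by (simp add: sup_shell_def)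
      also have "\<dots> \<le> c * norm z" using c by (intro mult_left_mono component_le_norm_cart) auto
      also have "\<dots> \<le> d * (\<eta> * s)" using A(2)[of z] ny by (simp add: y_def)
      finally have "real k \<le> X" using c by (simp add: X_def field_simps)
      moreover have "\<bar>A $ i \<bullet> z - 0\<bar> < l" if "i \<in> I" for i
        using that top by (auto simp: I_def y_def matrix_vector_mul_component)
      ultimately show ?thesis
        using B(4)[OF A(1) jk, of "\<lambda>_. 0"] by simp
    qed
    ultimately show "\<exists>B \<in> sets borel. bounded B \<and> measure lborel B \<le> C * \<eta> ^ (CARD('m) + CARD('n)) \<and>
      (\<forall>X::real^('m + 'n)^('m + 'n). X \<in> entry_cube R \<longrightarrow> (\<forall>x. c * norm x \<le> norm (X *v x)) \<longrightarrow>
        (\<exists>z \<in> int_vecs - {0}. norm (flow s *v (X *v z)) < \<eta>) \<longrightarrow> X \<in> B)"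
      using B(1-3) by (intro bexI[of _ B]) auto
  qed
qed

lemma countable_GLZ: "countable (GLZ :: (real^'k^'k::finite) set)"
proof -
  define h :: "('k \<times> 'k \<Rightarrow> int) \<Rightarrow> real^'k^'k" where "h = (\<lambda>f. \<chi> i j. of_int (f (i, j)))"
  have "N \<in> h ` (PiE UNIV (\<lambda>_. UNIV))" if N: "N \<in> int_mats" for N
  proof (rule image_eqI)
    have "N $ i $ j = of_int \<lfloor>N $ i $ j\<rfloor>" for i j
      using N by (auto simp: int_mats_def elim!: Ints_cases)
    then show "N = h (\<lambda>(i, j). \<lfloor>N $ i $ j\<rfloor>)"
      unfolding h_def vec_eq_iff by auto
  qed (simp add: PiE_UNIV_domain)
  then have sub: "GLZ \<subseteq> h ` (PiE UNIV (\<lambda>_. UNIV))"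
    by (auto simp: GLZ_def)
  have "countable (PiE (UNIV :: ('k \<times> 'k) set) (\<lambda>_. UNIV :: int set))"
    by (rule countable_PiE) auto
  from countable_subset[OF sub countable_image[OF this]] show ?thesis .
qed

lemma matrix_bounded_below:
  fixes h :: "real^'k^'k::finite"
  assumes "det h \<noteq> 0"
  obtains c where "c > 0" "\<And>x. c * norm x \<le> norm (h *v x)"
proof -
  define B where "B = matrix_inv h"
  have B: "B ** h = mat 1" unfolding B_def by (rule matrix_inv_mult[OF assms])
  have "B \<noteq> 0"
  proof
    assume "B = 0"
    then have "(mat 1 :: real^'k^'k) = 0" using B by simp
    then have "mat 1 $ k $ k = (0 :: real^'k^'k) $ k $ k" for k :: 'k by simp
    then show False by (simp add: mat_def)
  qed
  then have nB: "norm B > 0" by simp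
  show thesis
  proof (rule that[of "1 / norm B"])
    fix x
    have "norm x = norm (B *v (h *v x))" by (simp add: matrix_vector_mul_assoc B)
    also have "\<dots> \<le> norm B * norm (h *v x)" by (rule norm_matrix_vector_mult_le)
    finally show "1 / norm B * norm x \<le> norm (h *v x)"
      using nB by (simp add: field_simps)
  qed (use nB in simp)
qed

text \<open>The columns of \<gamma> - 1 are integral, so a nonzero one has norm at least 1, and X
  maps it to a vector of norm at least c. It follows that distinct \<open>GLZ\<close> translates of
  a small ball of invertible matrices are disjoint.\<close>

lemma GLZ_near_identity:
  fixes X :: "real^'k^'k::finite"
  assumes c: "\<And>x. c * norm x \<le> norm (X *v x)" and small: "norm (X ** \<gamma> - X) < c" and \<gamma>: "\<gamma> \<in> GLZ"
  shows "\<gamma> = mat 1"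
proof -
  have c0: "c > 0" using small norm_ge_zero[of "X ** \<gamma> - X"] by linarith
  have col: "\<gamma> *v axis j 1 = axis j 1" for j
  proof (rule ccontr)
    define v where "v = \<gamma> *v axis j 1 - axis j 1"
    assume "\<gamma> *v axis j 1 \<noteq> axis j 1"
    then have "v \<noteq> 0" by (simp add: v_def)
    then obtain i where i: "v $ i \<noteq> 0" by (auto simp: vec_eq_iff)
    have "axis j 1 \<in> (int_vecs :: (real^'k) set)" by (auto simp: int_vecs_def axis_def)
    moreover have "\<gamma> *v axis j 1 \<in> int_vecs"
      using \<gamma> calculation by (auto simp: GLZ_def intro: int_mats_vec)
    ultimately have "v $ i \<in> \<int>" by (simp add: v_def int_vecs_def)
    then have "1 \<le> \<bar>v $ i\<bar>" using i by (intro Ints_nonzero_abs_ge1)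
    then have nv: "1 \<le> norm v" using component_le_norm_cart[of v i] by linarith
    have "X *v v = (X ** \<gamma> - X) *v axis j 1"
      by (simp add: v_def matrix_vector_mult_diff_distrib matrix_vector_mult_diff_rdistrib matrix_vector_mul_assoc)
    then have "norm (X *v v) \<le> norm (X ** \<gamma> - X) * norm (axis j 1 :: real^'k)"
      using norm_matrix_vector_mult_le by metis
    then have "norm (X *v v) < c" using small by simp
    moreover have "c * 1 \<le> c * norm v" using nv c0 by (intro mult_left_mono) auto
    ultimately show False using c[of v] by linarith
  qed
  show ?thesis
  proof (rule matrix_eq[THEN iffD2], rule allI)
    fix x :: "real^'k"
    have "\<gamma> $ i $ j = mat 1 $ i $ j" for i j
      using arg_cong[OF col[of j], of "\<lambda>v. v $ i"]
      unfolding matrix_vector_mult_basis by (simp add: column_def axis_def mat_def)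
    then show "\<gamma> *v x = mat 1 *v x" by (simp add: vec_eq_iff matrix_vector_mult_def)
  qed
qed

text \<open>Otherwise the translates of a small ball under iterates of the flow and under \<^const>\<open>GLZ\<close>
  would be pairwise disjoint, while each iterate places a fixed amount of volume in one compact set.\<close>

theorem flow_nonwandering:
  fixes h :: "real^('m::finite + 'n::finite)^('m + 'n)"
  assumes h: "det h \<noteq> 0" "h \<in> U" "open U"
  shows "\<exists>t \<ge> T. \<exists>X \<in> U. \<exists>\<gamma> \<in> GLZ. flow t ** X ** \<gamma> \<in> U"
proof (rule ccontr)
  assume no: "\<not> ?thesis"
  \<comment> \<open>With a base above 1, every positive power of \<open>T'\<close> is at least
    \<open>T\<close>, hence a return time excluded by \<open>no\<close>.\<close>
  define T' where "T' = max T 2"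
  have T': "T' \<ge> 2" "T' \<ge> T" by (auto simp: T'_def)
  obtain c0 where c0: "c0 > 0" "\<And>x. c0 * norm x \<le> norm (h *v x)"
    using matrix_bounded_below[OF h(1)] by blast
  obtain \<rho> where \<rho>: "\<rho> > 0" "ball h \<rho> \<subseteq> U" using h openE by blast
  \<comment> \<open>\<open>c0 / 8\<close> preserves the lower bound \<open>c = c0 / 2\<close>
    throughout the ball and keeps its diameter below \<open>c\<close>, as
    \<open>GLZ_near_identity\<close> requires.\<close>
  define \<delta> where "\<delta> = min \<rho> (c0 / 8)"
  have \<delta>: "\<delta> > 0" "\<delta> \<le> \<rho>" "\<delta> \<le> c0 / 8" using \<rho> c0 by (auto simp: \<delta>_def)
  define V where "V = ball h \<delta>"
  have VU: "V \<subseteq> U" using \<rho>(2) \<delta>(2) by (auto simp: V_def)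
  define c where "c = c0 / 2"
  have c: "c > 0" using c0 by (simp add: c_def)
  have low: "c * norm x \<le> norm (X *v x)" if X: "X \<in> V" for X x
  proof -
    have "norm ((h - X) *v x) \<le> norm (h - X) * norm x" by (rule norm_matrix_vector_mult_le)
    also have "\<dots> \<le> c * norm x"
      using X \<delta> c0 by (intro mult_right_mono) (auto simp: V_def dist_norm c_def)
    finally have "norm (h *v x - X *v x) \<le> c * norm x" by (simp add: matrix_vector_mult_diff_rdistrib)
    then show ?thesis
      using c0(2)[of x] norm_triangle_sub[of "h *v x" "X *v x"] by (simp add: c_def field_simps)
  qed
  define R where "R = norm h + \<delta>"
  have R: "R > 0" using \<delta> by (simp add: R_def add_nonneg_pos)
  have cube: "V \<subseteq> entry_cube R"
  proof
    fix X assume "X \<in> V"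
    then have "norm X \<le> R"
      using norm_triangle_sub[of X h] by (simp add: V_def R_def dist_norm norm_minus_commute)
    then have "\<bar>X $ i $ j\<bar> \<le> R" for i j
      using component_le_norm_cart[of "X $ i" j] Finite_Cartesian_Product.norm_nth_le[of X i] by linarith
    then show "X \<in> entry_cube R" by (simp add: entry_cube_def)
  qed
  define b where "b = real (card {p. p permutes (UNIV :: ('m + 'n) set)}) * R ^ CARD('m + 'n)"
  have detb: "\<bar>det X\<bar> \<le> b" if "X \<in> V" for X
    unfolding b_def using cube that by (intro abs_det_le) (auto simp: entry_cube_def)
  have detnz: "det X \<noteq> 0" if X: "X \<in> V" for X
  proof -
    have "inj ((*v) X)"
    proof (rule injI)
      fix x y assume "X *v x = X *v y"
      then have "X *v (x - y) = 0" by (simp add: matrix_vector_mult_diff_distrib)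
      then have "c * norm (x - y) \<le> 0" using low[OF X, of "x - y"] by simp
      then show "x = y" using c by (simp add: mult_le_0_iff)
    qed
    then show ?thesis using det_nz_iff_inj[of "(*v) X"] by simp
  qed
  define \<mu> where "\<mu> = measure lborel V"
  have \<mu>: "\<mu> > 0" using content_ball_pos[OF \<delta>(1)] by (simp add: \<mu>_def V_def)
  obtain C where C: "C \<ge> 0" "\<And>s \<eta>. s \<ge> 1 \<Longrightarrow> \<eta> > 0 \<Longrightarrow>
    \<exists>B \<in> sets borel. bounded B \<and> measure lborel B \<le> C * \<eta> ^ (CARD('m) + CARD('n)) \<and>
      (\<forall>X::real^('m + 'n)^('m + 'n). X \<in> entry_cube R \<longrightarrow> (\<forall>x. c * norm x \<le> norm (X *v x)) \<longrightarrow>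
        (\<exists>z \<in> int_vecs - {0}. norm (flow s *v (X *v z)) < \<eta>) \<longrightarrow> X \<in> B)"
    using bad_matrices_measure[OF c R] by blast
  \<comment> \<open>At each of the times used, matrices whose image has a lattice vector shorter
    than \<eta> then occupy at most a third of the volume of \<open>V\<close>.\<close>
  define \<eta> where "\<eta> = min 1 (\<mu> / (3 * (C + 1)))"
  have \<eta>: "\<eta> > 0" "\<eta> \<le> 1" "\<eta> \<le> \<mu> / (3 * (C + 1))" using \<mu> C(1) by (auto simp: \<eta>_def)
  have C\<eta>: "C * \<eta> ^ (CARD('m) + CARD('n)) \<le> \<mu> / 3"
  proof -
    have "1 \<le> CARD('m) + CARD('n)"
      using zero_less_card_finite[where 'a = 'm] by linarith
    then have "\<eta> ^ (CARD('m) + CARD('n)) \<le> \<eta> ^ 1"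
      using \<eta> by (intro power_decreasing) simp_all
    then have "C * \<eta> ^ (CARD('m) + CARD('n)) \<le> (C + 1) * \<eta>"
      using C(1) \<eta> by (intro mult_mono) auto
    also have "\<dots> \<le> (C + 1) * (\<mu> / (3 * (C + 1)))"
      using \<eta> C(1) by (intro mult_left_mono) auto
    also have "\<dots> = \<mu> / 3" using C(1) by (simp add: field_simps)
    finally show ?thesis .
  qed
  obtain R' where R': "\<And>M :: real^('m + 'n)^('m + 'n). det M \<noteq> 0 \<Longrightarrow> \<bar>det M\<bar> \<le> b \<Longrightarrow>
    (\<And>z. z \<in> int_vecs - {0} \<Longrightarrow> \<eta> \<le> norm (M *v z)) \<Longrightarrow> \<exists>\<gamma> \<in> GLZ. norm (M ** \<gamma>) \<le> R'"
    using exists_bounded_basis[OF \<eta>(1)] by blast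
  define K :: "(real^('m + 'n)^('m + 'n)) set" where "K = cball 0 R'"
  define f :: "nat \<times> (real^('m + 'n)^('m + 'n)) \<Rightarrow> real^('m + 'n)^('m + 'n) \<Rightarrow> real^('m + 'n)^('m + 'n)"
    where "f = (\<lambda>(k, \<gamma>) X. flow (T' ^ k) ** X ** \<gamma>)"
  \<comment> \<open>\<open>A (k, \<gamma>)\<close> is the part of \<open>V\<close> that lands in
    \<open>K\<close> at time \<open>T' ^ k\<close> when \<gamma> changes the basis; \<open>W\<close>
    is its image, of the same measure.\<close>
  define A where "A = (\<lambda>i. {X \<in> V. f i X \<in> K})"
  define W where "W = (\<lambda>i. f i ` A i)"
  have Tk: "T' ^ k \<ge> 1" "T' ^ k > 0" for k using T' by (auto simp: one_le_power)
  have det_f: "\<bar>det (flow (T' ^ k) :: real^('m + 'n)^('m + 'n))\<bar> = 1" for k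
    by (simp add: det_flow Tk(2))
  have lin_f: "linear (f i)" for i
    using linear_compose[OF linear_matrix_mult(1) linear_matrix_mult(2), of "snd i" "flow (T' ^ fst i)"]
    by (simp add: f_def case_prod_beta o_def)
  have A_borel: "A i \<in> sets borel" and A_bounded: "bounded (A i)" for i
  proof -
    have "A i = V \<inter> f i -` K" by (auto simp: A_def)
    moreover have "f i -` K \<in> sets borel"
      using measurable_sets[OF borel_measurable_linear[OF lin_f[of i]], of K] by (simp add: K_def)
    ultimately show "A i \<in> sets borel" by (simp add: V_def)
    show "bounded (A i)"
      by (rule bounded_subset[of V]) (auto simp: A_def V_def)
  qed
  have W: "W (k, \<gamma>) \<in> sets borel" "measure lborel (W (k, \<gamma>)) = measure lborel (A (k, \<gamma>))" if "\<gamma> \<in> GLZ" for k \<gamma>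
    using measure_matrix_matrix_image[OF det_f GLZ_abs_det[OF that] A_borel A_bounded]
    by (simp_all add: W_def f_def)
  have WK: "W i \<subseteq> K" for i by (auto simp: W_def A_def)
  \<comment> \<open>Cancelling the earlier time and \<gamma>' leaves flow X \<beta> = X' with both
    points in \<open>V\<close>. At equal times \<open>GLZ_near_identity\<close> forces \<beta> = 1;
    at different times this is a return.\<close>
  have disj_step: False
    if *: "k' \<le> k" "(k, \<gamma>) \<noteq> (k', \<gamma>')" "\<gamma> \<in> GLZ" "\<gamma>' \<in> GLZ" "X \<in> V" "X' \<in> V" "f (k, \<gamma>) X = f (k', \<gamma>') X'"
    for k k' \<gamma> \<gamma>' X X'
  proof -
    obtain \<gamma>i where \<gamma>i: "\<gamma>i \<in> GLZ" "\<gamma>' ** \<gamma>i = mat 1" "\<gamma>i ** \<gamma>' = mat 1"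
      using GLZ_inverse[OF *(4)] by blast
    define \<beta> where "\<beta> = \<gamma> ** \<gamma>i"
    have \<beta>: "\<beta> \<in> GLZ" unfolding \<beta>_def by (rule GLZ_mult[OF *(3) \<gamma>i(1)])
    have eq: "flow (T' ^ (k - k')) ** X ** \<beta> = X'"
    proof -
      have "flow (1 / T' ^ k') ** f (k, \<gamma>) X ** \<gamma>i = flow (1 / T' ^ k') ** f (k', \<gamma>') X' ** \<gamma>i"
        using *(7) by simp
      moreover have "flow (1 / T' ^ k') ** f (k', \<gamma>') X' ** \<gamma>i =
          (flow (1 / T' ^ k') ** flow (T' ^ k')) ** X' ** (\<gamma>' ** \<gamma>i)"
        by (simp add: f_def matrix_mul_assoc)
      then have "flow (1 / T' ^ k') ** f (k', \<gamma>') X' ** \<gamma>i = X'"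
        using \<gamma>i by (simp add: flow_inverse(2) Tk(2))
      moreover have "flow (1 / T' ^ k') ** f (k, \<gamma>) X ** \<gamma>i =
          (flow (1 / T' ^ k') ** flow (T' ^ k)) ** X ** (\<gamma> ** \<gamma>i)"
        by (simp add: f_def matrix_mul_assoc)
      moreover have "flow (1 / T' ^ k') ** flow (T' ^ k) = (flow (T' ^ (k - k')) :: real^('m + 'n)^('m + 'n))"
        using Tk(2)[of k] Tk(2)[of k'] *(1) T'(1)
        by (subst flow_mult) (auto simp: power_diff)
      ultimately show ?thesis by (simp add: \<beta>_def)
    qed
    show False
    proof (cases "k = k'")
      case True
      then have "X ** \<beta> = X'" using eq by (simp add: flow_1)
      moreover have "norm (X' - X) < c"
      proof -
        have "norm (X' - X) \<le> norm (X' - h) + norm (h - X)"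
          by (metis dist_norm dist_triangle)
        also have "\<dots> < 2 * \<delta>" using *(5,6) by (simp add: V_def dist_norm norm_minus_commute)
        also have "\<dots> \<le> c" using \<delta> c0 by (simp add: c_def)
        finally show ?thesis .
      qed
      ultimately have "\<beta> = mat 1"
        using GLZ_near_identity[OF low[OF *(5)] _ \<beta>] by simp
      then have "\<gamma> ** (\<gamma>i ** \<gamma>') = \<gamma>'" unfolding \<beta>_def by (simp add: matrix_mul_assoc)
      then show False using True *(2) \<gamma>i by simp
    next
      case False
      then have "T' ^ 1 \<le> T' ^ (k - k')" using *(1) T' by (intro power_increasing) auto
      then have "T' ^ (k - k') \<ge> T" using T' by simp
      moreover have "flow (T' ^ (k - k')) ** X ** \<beta> \<in> U" using eq *(6) VU by auto
      ultimately show False using no \<beta> *(5) VU by blast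
    qed
  qed
  have disj: "W (k, \<gamma>) \<inter> W (k', \<gamma>') = {}"
    if "(k, \<gamma>) \<noteq> (k', \<gamma>')" "\<gamma> \<in> GLZ" "\<gamma>' \<in> GLZ" for k k' \<gamma> \<gamma>'
  proof (rule ccontr)
    assume "W (k, \<gamma>) \<inter> W (k', \<gamma>') \<noteq> {}"
    then obtain X X' where XX: "X \<in> V" "X' \<in> V" "f (k, \<gamma>) X = f (k', \<gamma>') X'"
      by (auto simp: W_def A_def)
    show False
    proof (cases "k' \<le> k")
      case True
      then show False using disj_step[OF True that XX] by simp
    next
      case False
      then have "k \<le> k'" by simp
      then show False using disj_step[OF _ that(1)[symmetric] that(3,2) XX(2,1) XX(3)[symmetric]] by simp
    qed
  qed
  \<comment> \<open>Outside the bad set a reduced basis of the image lies in \<open>K\<close>, so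
    the sets \<open>A (k, \<gamma>)\<close> cover at least two thirds of the volume of
    \<open>V\<close>. Restricting to finitely many \<gamma> loses at most one more third.\<close>
  have "\<exists>F. finite F \<and> F \<subseteq> GLZ \<and> \<mu> / 3 \<le> (\<Sum>\<gamma>\<in>F. measure lborel (A (k, \<gamma>)))" for k
  proof -
    obtain B :: "(real^('m + 'n)^('m + 'n)) set" where B: "B \<in> sets borel" "bounded B"
      "measure lborel B \<le> C * \<eta> ^ (CARD('m) + CARD('n))"
      "\<forall>X. X \<in> entry_cube R \<longrightarrow> (\<forall>x. c * norm x \<le> norm (X *v x)) \<longrightarrow>
        (\<exists>z \<in> int_vecs - {0}. norm (flow (T' ^ k) *v (X *v z)) < \<eta>) \<longrightarrow> X \<in> B"
      using C(2)[OF Tk(1)[of k] \<eta>(1)] by (elim bexE conjE)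
    have cover: "V - B \<subseteq> (\<Union>\<gamma>\<in>GLZ. A (k, \<gamma>))"
    proof
      fix X assume X: "X \<in> V - B"
      define M where "M = flow (T' ^ k) ** X"
      have "det M \<noteq> 0" "\<bar>det M\<bar> \<le> b"
        using detnz[of X] detb[of X] X by (auto simp: M_def det_mul det_flow Tk(2))
      moreover have "\<eta> \<le> norm (M *v z)" if z: "z \<in> int_vecs - {0}" for z
      proof (rule ccontr)
        assume "\<not> \<eta> \<le> norm (M *v z)"
        then have "norm (flow (T' ^ k) *v (X *v z)) < \<eta>"
          by (simp add: M_def matrix_vector_mul_assoc)
        moreover have "X \<in> entry_cube R" "\<forall>x. c * norm x \<le> norm (X *v x)" "X \<notin> B"
          using X cube low by auto
        ultimately show False using B(4) z by blast
      qed
      ultimately obtain \<gamma> where "\<gamma> \<in> GLZ" "norm (M ** \<gamma>) \<le> R'" using R' by blast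
      then show "X \<in> (\<Union>\<gamma>\<in>GLZ. A (k, \<gamma>))"
        using X by (auto simp: A_def f_def K_def M_def)
    qed
    have lm: "S \<in> lmeasurable" if "S \<in> sets borel" "bounded S" for S :: "(real^('m + 'n)^('m + 'n)) set"
      using that by (intro bounded_set_imp_lmeasurable) auto
    have VB: "V - B \<in> lmeasurable" "V \<in> lmeasurable" "B \<in> lmeasurable"
      using B by (auto intro!: lm simp: V_def intro: bounded_diff bounded_subset[OF bounded_ball[of h \<delta>]])
    have AV: "\<Union>D \<subseteq> V" if "D \<subseteq> (\<lambda>\<gamma>. A (k, \<gamma>)) ` GLZ" for D
      using that by (auto simp: A_def)
    have UA_borel: "\<Union>D \<in> sets borel" if "D \<subseteq> (\<lambda>\<gamma>. A (k, \<gamma>)) ` GLZ" for D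
      using that A_borel countable_subset[OF that countable_image[OF countable_GLZ]]
      by (intro sets.countable_Union) auto
    have bV: "bounded S" if "S \<subseteq> V" for S
      using bounded_subset[OF bounded_ball] that by (simp add: V_def)
    obtain D where D: "D \<subseteq> (\<lambda>\<gamma>. A (k, \<gamma>)) ` GLZ" "finite D"
      "measure lebesgue (\<Union>((\<lambda>\<gamma>. A (k, \<gamma>)) ` GLZ)) - \<mu> / 3 < measure lebesgue (\<Union>D)"
    proof (rule measure_countable_Union_approachable[of "(\<lambda>\<gamma>. A (k, \<gamma>)) ` GLZ" "\<mu> / 3" "measure lebesgue V"])
      show "countable ((\<lambda>\<gamma>. A (k, \<gamma>)) ` GLZ)" by (intro countable_image countable_GLZ)
      show "S \<in> lmeasurable" if "S \<in> (\<lambda>\<gamma>. A (k, \<gamma>)) ` GLZ" for S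
        using that A_borel A_bounded lm by auto
      show "measure lebesgue (\<Union>D') \<le> measure lebesgue V"
        if D': "D' \<subseteq> (\<lambda>\<gamma>. A (k, \<gamma>)) ` GLZ" "finite D'" for D'
        using AV[OF D'(1)] lm[OF UA_borel[OF D'(1)] bV[OF AV[OF D'(1)]]] VB
        by (intro measure_mono_fmeasurable) auto
    qed (use \<mu> in auto)
    have "\<mu> - \<mu> / 3 \<le> measure lebesgue V - measure lebesgue B"
      using B(1,3) C\<eta> by (simp add: \<mu>_def measure_completion V_def)
    also have "\<dots> \<le> measure lebesgue (V - B)"
      using VB measure_Un_le[of "V - B" lebesgue B] measure_mono_fmeasurable[of V "(V - B) \<union> B" lebesgue]
      by (force dest: fmeasurableD)
    also have "\<dots> \<le> measure lebesgue (\<Union>((\<lambda>\<gamma>. A (k, \<gamma>)) ` GLZ))"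
      using cover VB lm[OF UA_borel bV[OF AV]] by (intro measure_mono_fmeasurable) auto
    finally have "\<mu> / 3 \<le> measure lebesgue (\<Union>D)" using D(3) by linarith
    moreover obtain F where F: "F \<subseteq> GLZ" "finite F" "D = (\<lambda>\<gamma>. A (k, \<gamma>)) ` F"
      using finite_subset_image[OF D(2,1)] by blast
    moreover have "measure lebesgue (\<Union>D) \<le> (\<Sum>\<gamma>\<in>F. measure lborel (A (k, \<gamma>)))"
    proof -
      have "measure lebesgue (\<Union>D) = measure lborel (\<Union>\<gamma>\<in>F. A (k, \<gamma>))"
        using UA_borel[OF D(1)] F(3) by (simp add: measure_completion)
      also have "\<dots> \<le> (\<Sum>\<gamma>\<in>F. measure lborel (A (k, \<gamma>)))"
        using F A_borel by (intro measure_UNION_le) auto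
      finally show ?thesis .
    qed
    ultimately show ?thesis by force
  qed
  then obtain F where F: "\<And>k. finite (F k)" "\<And>k. F k \<subseteq> GLZ"
    "\<And>k. \<mu> / 3 \<le> (\<Sum>\<gamma>\<in>F k. measure lborel (A (k, \<gamma>)))"
    by metis
  have FG: "\<gamma> \<in> GLZ" if "\<gamma> \<in> F k" for k \<gamma>
    using F(2) that by blast
  have Kf: "K \<in> fmeasurable lborel"
    unfolding K_def using emeasure_bounded_finite[OF bounded_cball] by (intro fmeasurableI) auto
  \<comment> \<open>Each of the \<open>N\<close> times contributes disjoint pieces of total volume
    at least \<open>\<mu> / 3\<close> to the same ball.\<close>
  have bound: "real N * (\<mu> / 3) \<le> measure lborel K" for N :: nat
  proof -
    have "real N * (\<mu> / 3) = (\<Sum>k<N. \<mu> / 3)" by simp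
    also have "\<dots> \<le> (\<Sum>k<N. \<Sum>\<gamma>\<in>F k. measure lborel (A (k, \<gamma>)))"
      by (intro sum_mono F)
    also have "\<dots> = (\<Sum>k<N. \<Sum>\<gamma>\<in>F k. measure lborel (W (k, \<gamma>)))"
      using FG W(2) by (intro sum.cong) simp_all
    also have "\<dots> = (\<Sum>i\<in>Sigma {..<N} F. measure lborel (W i))"
      using F(1) by (subst sum.Sigma) auto
    also have "\<dots> = measure lborel (\<Union>i\<in>Sigma {..<N} F. W i)"
    proof (rule measure_finite_Union[symmetric])
      show "finite (Sigma {..<N} F)" using F(1) by auto
      show "W ` Sigma {..<N} F \<subseteq> sets lborel" using FG W(1) by auto
      show "disjoint_family_on W (Sigma {..<N} F)"
        unfolding disjoint_family_on_def using disj FG by auto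
      show "emeasure lborel (W i) \<noteq> \<infinity>" if "i \<in> Sigma {..<N} F" for i
        using emeasure_bounded_finite[OF bounded_subset[OF bounded_cball WK[of i, unfolded K_def]]] by simp
    qed
    also have "\<dots> \<le> measure lborel K"
    proof (rule measure_mono_fmeasurable[OF _ _ Kf])
      show "(\<Union>i\<in>Sigma {..<N} F. W i) \<subseteq> K" using WK by auto
      show "(\<Union>i\<in>Sigma {..<N} F. W i) \<in> sets lborel"
        using F(1) FG W(1) by (intro sets.finite_UN) auto
    qed
    finally show ?thesis .
  qed
  obtain N :: nat where "measure lborel K / (\<mu> / 3) < real N" using reals_Archimedean2 by blast
  then show False using bound[of N] \<mu> by (simp add: field_simps)
qed

section \<open>Topological transitivity of the flow\<close>

text \<open>Conjugation by \<open>flow t\<close> multiplies the upper right block by this factor;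
  the \<open>itself\<close> arguments fix the dimensions.\<close>

definition flow_ratio :: "'m::finite itself \<Rightarrow> 'n::finite itself \<Rightarrow> real \<Rightarrow> real" where
  "flow_ratio _ _ t = t powr (real CARD('n) / real CARD('m)) * t"

lemma flow_ratio_ge: "t \<ge> 1 \<Longrightarrow> flow_ratio TYPE('m::finite) TYPE('n::finite) t \<ge> t"
proof -
  assume t: "t \<ge> 1"
  then have "1 * t \<le> t powr (real CARD('n) / real CARD('m)) * t"
    by (intro mult_right_mono) (auto simp: ge_one_powr_ge_zero)
  then show ?thesis by (simp add: flow_ratio_def)
qed

text \<open>Time t expands the upper right block and time 1/t the lower left one. For large t a tiny
  row operation before the flow thus becomes a prescribed one after it.\<close>

lemma flow_row_op:
  fixes X :: "real^('m::finite + 'n::finite)^('m + 'n)"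
  assumes t: "t > 0"
  shows "flow t ** row_op (Inl a) (Inr b) (s / flow_ratio TYPE('m) TYPE('n) t) X =
      row_op (Inl a) (Inr b) s (flow t ** X)"
    "flow (1 / t) ** row_op (Inr b) (Inl a) (s / flow_ratio TYPE('m) TYPE('n) t) X =
      row_op (Inr b) (Inl a) s (flow (1 / t) ** X)"
  using t unfolding flow_def block_diag_eq_diag_mat
  by (subst diag_mat_row_op; simp add: flow_ratio_def powr_divide)+

lemma row_op_eq_add: "row_op i j s X = X + axis i (s *\<^sub>R X $ j)"
  by (auto simp: row_op_def axis_def vec_eq_iff)

lemma row_op_diff: "row_op i j s X - row_op i j s Y = row_op i j s (X - Y)"
  by (auto simp: row_op_def vec_eq_iff algebra_simps)

lemma dist_row_op_self: "dist (row_op i j s X) X \<le> \<bar>s\<bar> * norm (X :: real^'l^'k::finite)"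
proof -
  have "norm (axis i v) = norm v" for v :: "real^'l"
    unfolding norm_vec_def[of "axis i v"] L2_set_def
    by (simp add: axis_def if_distrib[of norm] if_distrib[of "\<lambda>x. x\<^sup>2"] cong: if_cong)
  then have "dist (row_op i j s X) X = \<bar>s\<bar> * norm (X $ j)"
    by (simp add: row_op_eq_add dist_norm)
  also have "\<dots> \<le> \<bar>s\<bar> * norm X"
    by (intro mult_left_mono Finite_Cartesian_Product.norm_nth_le) auto
  finally show ?thesis .
qed

lemma dist_row_op: "dist (row_op i j s X) (row_op i j s Y) \<le> (1 + \<bar>s\<bar>) * dist X (Y :: real^'l^'k::finite)"
proof -
  have "norm (row_op i j s (X - Y)) \<le> norm (X - Y) + \<bar>s\<bar> * norm (X - Y)"
    using dist_row_op_self[of i j s "X - Y"] norm_triangle_sub[of "row_op i j s (X - Y)" "X - Y"]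
    by (simp add: dist_norm)
  then show ?thesis by (simp add: dist_norm row_op_diff algebra_simps)
qed

lemma continuous_on_row_op: "continuous_on S (row_op i j s :: real^'l^'k::finite \<Rightarrow> _)"
proof -
  have "row_op i j s = (\<lambda>X :: real^'l^'k. \<chi> a. if a = i then X $ i + s *\<^sub>R X $ j else X $ a)"
    by (auto simp: row_op_def)
  moreover have "continuous_on S (\<lambda>X :: real^'l^'k. if a = i then X $ i + s *\<^sub>R X $ j else X $ a)" for a
    by (cases "a = i") (auto intro!: continuous_intros)
  ultimately show ?thesis by (simp add: continuous_on_vec_lambda)
qed

text \<open>A topological version of the Mautner phenomenon: a row operation which the flow contracts
  can be absorbed into a nonwandering X_eq of the orbit.\<close>

lemma row_op_in_closure:
  fixes V :: "(real^('m::finite + 'n::finite)^('m + 'n)) set"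
  assumes V: "open V" "\<And>X. X \<in> V \<Longrightarrow> det X \<noteq> 0"
    and inv: "\<And>X t \<gamma>. X \<in> V \<Longrightarrow> t > 0 \<Longrightarrow> \<gamma> \<in> GLZ \<Longrightarrow> flow t ** X ** \<gamma> \<in> V"
    and y: "y \<in> V"
  shows "row_op (Inl a) (Inr b) s y \<in> closure V" "row_op (Inr b) (Inl a) s y \<in> closure V"
proof -
  obtain \<rho> where \<rho>: "\<rho> > 0" "ball y \<rho> \<subseteq> V" using V(1) y openE by blast
  \<comment> \<open>X and its return Z are both close to y, and the return is so late that a row
    operation with parameter s divided by the expansion rate moves neither of them out of
    \<open>V\<close>.\<close>
  have *: "\<exists>t > 0. \<exists>X Z. \<exists>\<gamma> \<in> GLZ. Z = flow t ** X ** \<gamma> \<and> dist X y < e / (1 + \<bar>s\<bar>) \<and> dist Z y < e / (1 + \<bar>s\<bar>) \<and>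
      (\<forall>i j. row_op i j (s / flow_ratio TYPE('m) TYPE('n) t) X \<in> V \<and>
             row_op i j (s / flow_ratio TYPE('m) TYPE('n) t) Z \<in> V)" if e: "e > 0" for e
  proof -
    define \<delta> where "\<delta> = min (\<rho> / 2) (e / (1 + \<bar>s\<bar>))"
    have \<delta>: "\<delta> > 0" "\<delta> \<le> \<rho> / 2" "\<delta> \<le> e / (1 + \<bar>s\<bar>)"
      using \<rho>(1) e min.cobounded1 min.cobounded2 unfolding \<delta>_def by (simp, fast+)
    \<comment> \<open>Since the expansion rate r is at least \<open>T\<close>, a row operation with
      parameter s / r moves every point of \<open>ball y \<delta>\<close> by less than \<rho> /
      2.\<close>
    define T where "T = 1 + 2 * \<bar>s\<bar> * (norm y + \<delta>) / \<rho>"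
    have T: "T \<ge> 1" using \<rho> \<delta> by (simp add: T_def)
    obtain t X \<gamma> where t: "t \<ge> T" "X \<in> ball y \<delta>" "\<gamma> \<in> GLZ" "flow t ** X ** \<gamma> \<in> ball y \<delta>"
      using flow_nonwandering[of y "ball y \<delta>" T] V(2)[OF y] \<delta>(1) by auto
    define r where "r = flow_ratio TYPE('m) TYPE('n) t"
    have r: "r \<ge> T" "r > 0" using flow_ratio_ge[of t, where 'm = 'm and 'n = 'n] t(1) T by (auto simp: r_def)
    have "row_op i j (s / r) X' \<in> V" if X': "X' \<in> ball y \<delta>" for i j X'
    proof -
      have "norm X' \<le> norm y + \<delta>"
        using X' norm_triangle_sub[of X' y] by (simp add: dist_norm norm_minus_commute)
      then have "\<bar>s\<bar> * norm X' \<le> \<bar>s\<bar> * (norm y + \<delta>)"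
        by (intro mult_left_mono) auto
      also have "\<dots> = (T - 1) * (\<rho> / 2)" using \<rho> by (simp add: T_def field_simps)
      also have "\<dots> < r * (\<rho> / 2)" using r(1) \<rho> by (intro mult_strict_right_mono) auto
      finally have "\<bar>s / r\<bar> * norm X' < \<rho> / 2"
        using r(2) by (simp add: field_simps)
      then have "dist (row_op i j (s / r) X') X' < \<rho> / 2"
        using dist_row_op_self[of i j "s / r" X'] by linarith
      moreover have "dist X' y < \<rho> / 2" using X' \<delta>(2) by (simp add: dist_commute)
      ultimately have "dist (row_op i j (s / r) X') y < \<rho>"
        using dist_triangle[of "row_op i j (s / r) X'" y X'] by linarith
      then show ?thesis using \<rho>(2) by (auto simp: dist_commute)
    qed
    then show ?thesis
      using t T \<delta>(3) unfolding r_def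
      by (intro exI[of _ t] conjI exI[of _ X] exI[of _ "flow t ** X ** \<gamma>"] bexI[of _ \<gamma>])
        (auto simp: dist_commute)
  qed
  show "row_op (Inl a) (Inr b) s y \<in> closure V"
    unfolding closure_approachable
  proof (intro allI impI)
    fix e :: real assume e: "e > 0"
    obtain t X \<gamma> where t: "t > 0" "\<gamma> \<in> GLZ" "dist (flow t ** X ** \<gamma>) y < e / (1 + \<bar>s\<bar>)"
      "row_op (Inl a) (Inr b) (s / flow_ratio TYPE('m) TYPE('n) t) X \<in> V"
      using *[OF e] by blast
    \<comment> \<open>The perturbed X flows to a point of \<open>V\<close> by invariance, and on the
      way the perturbation has grown to the full row operation at a point close to y.\<close>
    have "row_op (Inl a) (Inr b) s (flow t ** X ** \<gamma>) \<in> V"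
      using inv[OF t(4,1,2)] unfolding flow_row_op(1)[OF t(1)] by (simp add: row_op_matrix_mult)
    moreover have "dist (row_op (Inl a) (Inr b) s (flow t ** X ** \<gamma>)) (row_op (Inl a) (Inr b) s y) < e"
      using dist_row_op[of "Inl a" "Inr b" s "flow t ** X ** \<gamma>" y] t(3)
      by (simp add: pos_less_divide_eq mult.commute)
    ultimately show "\<exists>x \<in> V. dist x (row_op (Inl a) (Inr b) s y) < e" by blast
  qed
  show "row_op (Inr b) (Inl a) s y \<in> closure V"
    unfolding closure_approachable
  proof (intro allI impI)
    fix e :: real assume e: "e > 0"
    obtain t X Z \<gamma> where t: "t > 0" "\<gamma> \<in> GLZ" "Z = flow t ** X ** \<gamma>" "dist X y < e / (1 + \<bar>s\<bar>)"
      "row_op (Inr b) (Inl a) (s / flow_ratio TYPE('m) TYPE('n) t) Z \<in> V"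
      using *[OF e] by blast
    obtain \<gamma>' where \<gamma>': "\<gamma>' \<in> GLZ" "\<gamma> ** \<gamma>' = mat 1" using GLZ_inverse[OF t(2)] by blast
    \<comment> \<open>For the other block the roles are exchanged: Z is perturbed, and the
      perturbation grows under the inverse flow, which takes Z back to X.\<close>
    have "flow (1 / t) ** Z ** \<gamma>' = (flow (1 / t) ** flow t) ** X ** (\<gamma> ** \<gamma>')"
      by (simp add: t(3) matrix_mul_assoc)
    then have XZ: "flow (1 / t) ** Z ** \<gamma>' = X"
      by (simp add: flow_inverse(2) t(1) \<gamma>')
    have "1 / t > 0" using t(1) by simp
    from inv[OF t(5) this \<gamma>'(1)] have "row_op (Inr b) (Inl a) s X \<in> V"
      unfolding flow_row_op(2)[OF t(1)] XZ[symmetric] by (simp add: row_op_matrix_mult)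
    moreover have "dist (row_op (Inr b) (Inl a) s X) (row_op (Inr b) (Inl a) s y) < e"
      using dist_row_op[of "Inr b" "Inl a" s X y] t(4)
      by (simp add: pos_less_divide_eq mult.commute)
    ultimately show "\<exists>x \<in> V. dist x (row_op (Inr b) (Inl a) s y) < e" by blast
  qed
qed

lemma continuous_on_det: "continuous_on S (det :: real^'k^'k::finite \<Rightarrow> real)"
  unfolding det_def by (intro continuous_intros)

lemma continuous_on_matrix_mult:
  fixes A B :: "real^'k^'k::finite"
  shows "continuous_on S (\<lambda>X. A ** X ** B)"
proof -
  have "linear (\<lambda>X. A ** X ** B)"
    using linear_compose[OF linear_matrix_mult(1) linear_matrix_mult(2), of B A] by (simp add: o_def)
  then have "bounded_linear (\<lambda>X. A ** X ** B)"
    using linear_conv_bounded_linear by blast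
  then show ?thesis
    by (rule linear_continuous_on)
qed

lemma single_diag_minus1_GLZ: "single_diag k0 (- 1) \<in> GLZ"
proof -
  have "single_diag k0 (- 1) ** single_diag k0 (- 1) = mat 1"
    unfolding single_diag_def diag_mat_mult_diag_mat diag_mat_1[symmetric]
    by (intro arg_cong[of _ _ diag_mat]) auto
  moreover have "single_diag k0 (- 1) \<in> int_mats"
    by (auto simp: single_diag_def diag_mat_def int_mats_def)
  ultimately show ?thesis by (auto simp: GLZ_def)
qed

lemma flow_orbit_dense:
  fixes h M :: "real^('m::finite + 'n::finite)^('m + 'n)"
  assumes h: "det h \<noteq> 0" "h \<in> U" "open U" and M: "\<bar>det M\<bar> = \<bar>det h\<bar>" and W: "open W" "M \<in> W"
  shows "\<exists>t > 0. \<exists>X \<in> U. \<exists>\<gamma> \<in> GLZ. flow t ** X ** \<gamma> \<in> W"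
proof -
  \<comment> \<open>Singular matrices are removed because \<open>flow_nonwandering\<close>, on which
    \<open>row_op_in_closure\<close> rests, starts from an invertible point.\<close>
  define U' where "U' = U \<inter> {X. det X \<noteq> 0}"
  have "{X :: real^('m + 'n)^('m + 'n). det X \<noteq> 0} = det -` (- {0})" by auto
  then have U': "open U'" "h \<in> U'"
    using h continuous_on_det[of UNIV] by (auto simp: U'_def intro!: open_Int open_vimage)
  define V where "V = (\<Union>t\<in>{0<..}. \<Union>\<gamma>\<in>GLZ. (\<lambda>X. flow t ** X ** \<gamma>) ` U')"
  have im: "(\<lambda>X. flow t ** X ** \<gamma>) ` U' = (\<lambda>X. flow (1 / t) ** X ** \<gamma>') -` U'"
    if t: "t > 0" and \<gamma>: "\<gamma> ** \<gamma>' = mat 1" "\<gamma>' ** \<gamma> = mat 1" for t and \<gamma> \<gamma>' :: "real^('m + 'n)^('m + 'n)"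
  proof -
    have 1: "flow (1 / t) ** (flow t ** X ** \<gamma>) ** \<gamma>' = X" for X :: "real^('m + 'n)^('m + 'n)"
    proof -
      have "flow (1 / t) ** (flow t ** X ** \<gamma>) ** \<gamma>' = (flow (1 / t) ** flow t) ** X ** (\<gamma> ** \<gamma>')"
        by (simp add: matrix_mul_assoc)
      then show ?thesis by (simp add: flow_inverse(2) t \<gamma>)
    qed
    have 2: "flow t ** (flow (1 / t) ** X ** \<gamma>') ** \<gamma> = X" for X :: "real^('m + 'n)^('m + 'n)"
    proof -
      have "flow t ** (flow (1 / t) ** X ** \<gamma>') ** \<gamma> = (flow t ** flow (1 / t)) ** X ** (\<gamma>' ** \<gamma>)"
        by (simp add: matrix_mul_assoc)
      then show ?thesis by (simp add: flow_inverse(1) t \<gamma>)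
    qed
    show ?thesis
    proof (intro equalityI subsetI)
      fix Y assume "Y \<in> (\<lambda>X. flow (1 / t) ** X ** \<gamma>') -` U'"
      then show "Y \<in> (\<lambda>X. flow t ** X ** \<gamma>) ` U'"
        using 2[of Y] by (intro image_eqI[of _ _ "flow (1 / t) ** Y ** \<gamma>'"]) auto
    qed (use 1 in auto)
  qed
  have openV: "open V"
    unfolding V_def
  proof (intro open_UN ballI)
    fix t :: real and \<gamma> :: "real^('m + 'n)^('m + 'n)" assume t: "t \<in> {0<..}" and \<gamma>: "\<gamma> \<in> GLZ"
    obtain \<gamma>' where "\<gamma> ** \<gamma>' = mat 1" "\<gamma>' ** \<gamma> = mat 1" using GLZ_inverse[OF \<gamma>] by blast
    then show "open ((\<lambda>X. flow t ** X ** \<gamma>) ` U')"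
      using t U'(1) continuous_on_matrix_mult by (subst im) (auto intro!: open_vimage)
  qed
  have V_inv: "flow t ** X ** \<gamma> \<in> V" if X: "X \<in> V" and t: "t > 0" and \<gamma>: "\<gamma> \<in> GLZ" for X t \<gamma>
  proof -
    obtain s \<beta> Y where Y: "s > 0" "\<beta> \<in> GLZ" "Y \<in> U'" "X = flow s ** Y ** \<beta>"
      using X by (auto simp: V_def)
    have "flow t ** X ** \<gamma> = (flow t ** flow s) ** Y ** (\<beta> ** \<gamma>)"
      by (simp add: Y(4) matrix_mul_assoc)
    also have "\<dots> = flow (t * s) ** Y ** (\<beta> ** \<gamma>)"
      using t Y(1) by (simp add: flow_mult)
    finally show ?thesis
      using Y t GLZ_mult[OF Y(2) \<gamma>] unfolding V_def by (auto intro!: bexI[of _ "t * s"] bexI[of _ "\<beta> ** \<gamma>"])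
  qed
  have V_det: "det X \<noteq> 0" if X: "X \<in> V" for X
  proof -
    obtain s \<beta> Y where Y: "s > 0" "\<beta> \<in> GLZ" "Y \<in> U'" "X = flow s ** Y ** \<beta>"
      using X by (auto simp: V_def)
    then show ?thesis
      using GLZ_abs_det[OF Y(2)] by (auto simp: det_mul det_flow U'_def)
  qed
  have hV: "h \<in> V"
    unfolding V_def using U'(2) GLZ_1 by (auto intro!: bexI[of _ 1] bexI[of _ "mat 1"] image_eqI[of _ _ h] simp: flow_1)
  have cross: "row_op (Inl a) (Inr b) s y \<in> closure V" "row_op (Inr b) (Inl a) s y \<in> closure V"
    if "y \<in> closure V" for a b s y
  proof -
    have "row_op (Inl a) (Inr b) s ` closure V \<subseteq> closure V" "row_op (Inr b) (Inl a) s ` closure V \<subseteq> closure V"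
      by (rule image_closure_subset; use row_op_in_closure[OF openV V_det V_inv] continuous_on_row_op in force)+
    then show "row_op (Inl a) (Inr b) s y \<in> closure V" "row_op (Inr b) (Inl a) s y \<in> closure V"
      using that by blast+
  qed
  \<comment> \<open>A commutator relation: a row operation within one block is a commutator of two
    that cross the blocks, through an index \<open>k\<close> of the other block.\<close>
  have comm: "row_op i j s X = row_op i k s (row_op k j 1 (row_op i k (- s) (row_op k j (- 1) X)))"
    if "i \<noteq> j" "i \<noteq> k" "j \<noteq> k" for i j k s and X :: "real^('m + 'n)^('m + 'n)"
    using that by (auto simp: row_op_def vec_eq_iff algebra_simps)
  have all: "row_op i j s y \<in> closure V" if y: "y \<in> closure V" and ij: "i \<noteq> j" for i j s y
  proof (cases i; cases j)
    fix a b assume "i = Inl a" "j = Inr b"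
    then show ?thesis using cross y by blast
  next
    fix a b assume "i = Inr b" "j = Inl a"
    then show ?thesis using cross y by blast
  next
    fix a b assume ab: "i = Inl a" "j = Inl b"
    fix c :: 'n
    have "row_op i j s y = row_op i (Inr c) s (row_op (Inr c) j 1 (row_op i (Inr c) (- s) (row_op (Inr c) j (- 1) y)))"
      by (rule comm) (use ab ij in auto)
    then show ?thesis unfolding ab using cross y by metis
  next
    fix a b assume ab: "i = Inr a" "j = Inr b"
    fix c :: 'm
    have "row_op i j s y = row_op i (Inl c) s (row_op (Inl c) j 1 (row_op i (Inl c) (- s) (row_op (Inl c) j (- 1) y)))"
      by (rule comm) (use ab ij in auto)
    then show ?thesis unfolding ab using cross y by metis
  qed
  have prods: "E ** y \<in> closure V" if "E \<in> row_op_products" "y \<in> closure V" for E y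
    using that
  proof induction
    case (step X i j s)
    then show ?case using all by (simp add: row_op_matrix_mult[symmetric])
  qed simp
  have eq_det: "N \<in> closure V" if N: "det N = det h" for N
  proof -
    fix k0 :: "'m + 'n"
    define X where "X = N ** matrix_inv h"
    have Xh: "X ** h = N"
      by (simp add: X_def matrix_mul_assoc[symmetric] matrix_inv_mult[OF h(1)])
    then have "det X = 1" using N h(1) by (metis det_mul mult_cancel_right1)
    moreover have "single_diag k0 1 = mat 1"
      unfolding single_diag_def diag_mat_1[symmetric] by (intro arg_cong[of _ _ diag_mat]) auto
    ultimately have "X \<in> row_op_products"
      using matrix_eq_row_op_products[of X k0] by auto
    from prods[OF this, of h] show ?thesis
      using hV closure_subset Xh by auto
  qed
  have "M \<in> closure V"
  proof (cases "det M = det h")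
    case False
    then have neg: "det M = - det h" using M by (simp add: abs_if split: if_splits)
    fix k0 :: "'m + 'n"
    \<comment> \<open>\<open>J\<close> is an orientation-reversing change of basis: it flips the
      sign of the determinant and preserves the lattice.\<close>
    define J where "J = (single_diag k0 (- 1) :: real^('m + 'n)^('m + 'n))"
    have J: "J \<in> GLZ" "J ** J = mat 1" "det J = - 1"
      unfolding J_def using single_diag_minus1_GLZ
      by (auto simp: single_diag_def diag_mat_mult_diag_mat det_diag_mat diag_mat_1[symmetric] intro!: arg_cong[of _ _ diag_mat])
    have "M ** J \<in> closure V" by (rule eq_det) (simp add: det_mul neg J)
    moreover have "(\<lambda>X. flow 1 ** X ** J) ` closure V \<subseteq> closure V"
    proof (rule image_closure_subset)
      show "(\<lambda>X. flow 1 ** X ** J) ` V \<subseteq> closure V"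
        using V_inv[OF _ _ J(1), of _ 1] closure_subset by fastforce
    qed (auto intro: continuous_on_matrix_mult)
    ultimately have "flow 1 ** (M ** J) ** J \<in> closure V" by blast
    then show ?thesis by (simp add: flow_1 matrix_mul_assoc[symmetric] J)
  qed (rule eq_det)
  then obtain Y where "Y \<in> V" "Y \<in> W"
    using W closure_iff_nhds_not_empty[of M V] by blast
  then show ?thesis unfolding V_def U'_def by auto
qed

text \<open>\<open>flow_orbit_dense\<close> provides a time t that may lie below 1. A return of z to
  a neighbourhood of itself after time s at least 1/t prolongs the orbit to total time s t at least
  1. Forward time matters because only there do block lower triangular factors stay small.\<close>

theorem flow_transitive:
  fixes h M :: "real^('m::finite + 'n::finite)^('m + 'n)"
  assumes h: "det h \<noteq> 0" "h \<in> U" "open U" and M: "\<bar>det M\<bar> = \<bar>det h\<bar>" and W: "open W" "M \<in> W"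
  shows "\<exists>t \<ge> 1. \<exists>X \<in> U. \<exists>\<gamma> \<in> GLZ. flow t ** X ** \<gamma> \<in> W"
proof -
  define W' where "W' = W \<inter> {X. det X \<noteq> 0}"
  have "{X :: real^('m + 'n)^('m + 'n). det X \<noteq> 0} = det -` (- {0})" by auto
  then have W': "open W'" "M \<in> W'"
    using W M h continuous_on_det[of UNIV] by (auto simp: W'_def intro!: open_Int open_vimage)
  obtain t X \<gamma> where t: "t > 0" "X \<in> U" "\<gamma> \<in> GLZ" "flow t ** X ** \<gamma> \<in> W'"
    using flow_orbit_dense[OF h M W'] by blast
  define z where "z = flow t ** X ** \<gamma>"
  obtain \<gamma>' where \<gamma>': "\<gamma> ** \<gamma>' = mat 1" "\<gamma>' ** \<gamma> = mat 1" using GLZ_inverse[OF t(3)] by blast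
  define Z where "Z = W' \<inter> (\<lambda>Y. flow (1 / t) ** Y ** \<gamma>') -` U"
  have X_eq: "flow (1 / t) ** z ** \<gamma>' = X"
  proof -
    have "flow (1 / t) ** z ** \<gamma>' = (flow (1 / t) ** flow t) ** X ** (\<gamma> ** \<gamma>')"
      by (simp add: z_def matrix_mul_assoc)
    then show ?thesis by (simp add: flow_inverse(2) t(1) \<gamma>')
  qed
  have "open Z" "z \<in> Z"
    using W'(1) h(3) t X_eq continuous_on_matrix_mult by (auto simp: Z_def z_def[symmetric] intro!: open_Int open_vimage)
  moreover have "det z \<noteq> 0" using t(4) by (simp add: z_def W'_def)
  ultimately obtain s Y \<beta> where s: "s \<ge> 1 / t" "Y \<in> Z" "\<beta> \<in> GLZ" "flow s ** Y ** \<beta> \<in> Z"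
    using flow_nonwandering[of z Z "1 / t"] by blast
  define Y' where "Y' = flow (1 / t) ** Y ** \<gamma>'"
  have Y': "Y' \<in> U" using s(2) by (simp add: Z_def Y'_def)
  have "flow t ** Y' ** \<gamma> = (flow t ** flow (1 / t)) ** Y ** (\<gamma>' ** \<gamma>)"
    by (simp add: Y'_def matrix_mul_assoc)
  then have "Y = flow t ** Y' ** \<gamma>" by (simp add: flow_inverse(1) t(1) \<gamma>')
  then have "flow s ** Y ** \<beta> = (flow s ** flow t) ** Y' ** (\<gamma> ** \<beta>)"
    by (simp add: matrix_mul_assoc)
  moreover have "s > 0" using s(1) t(1) by (meson less_le_trans zero_less_divide_1_iff)
  ultimately have "flow (s * t) ** Y' ** (\<gamma> ** \<beta>) \<in> W"
    using s(4) t(1) by (simp add: flow_mult Z_def W'_def)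
  moreover have "s * t \<ge> 1" using s(1) t(1) by (simp add: field_simps)
  ultimately show ?thesis using Y' GLZ_mult[OF t(3) s(3)] by blast
qed

section \<open>Lattices avoiding a norm ball\<close>

text \<open>For invertible \<open>M\<close> this is admissibility of the lattice spanned by the
  columns for \<open>nu_ball \<nu> r\<close>; it is independent of the basis, see
  \<open>lat_ge_GLZ\<close>.\<close>

definition lat_ge :: "(real^'k \<Rightarrow> real) \<Rightarrow> real \<Rightarrow> (real^'k^'k::finite) set" where
  "lat_ge \<nu> r = {M. \<forall>z \<in> int_vecs - {0}. r \<le> \<nu> (M *v z)}"

lemma is_norm_bounds:
  fixes \<nu> :: "real^'k::finite \<Rightarrow> real"
  assumes \<nu>: "is_norm \<nu>"
  obtains c C where "c > 0" "C > 0" "\<And>x. c * norm x \<le> \<nu> x" "\<And>x. \<nu> x \<le> C * norm x"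
proof -
  have nn: "\<nu> x \<ge> 0" and zero: "\<nu> x = 0 \<longleftrightarrow> x = 0" and scale: "\<nu> (a *\<^sub>R x) = \<bar>a\<bar> * \<nu> x"
    and tri: "\<nu> (x + y) \<le> \<nu> x + \<nu> y" for x y a
    using \<nu> by (auto simp: is_norm_def)
  have tri_sum: "\<nu> (\<Sum>i\<in>F. g i) \<le> (\<Sum>i\<in>F. \<nu> (g i))" if "finite F" for F and g :: "'k \<Rightarrow> real^'k"
    using that
  proof induction
    case (insert i F)
    then show ?case using tri[of "g i" "\<Sum>i\<in>F. g i"] by simp
  qed (use zero[of 0] in simp)
  define C where "C = 1 + (\<Sum>i\<in>UNIV. \<nu> (axis i 1))"
  have C: "C > 0" using nn by (simp add: C_def add_pos_nonneg sum_nonneg)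
  have upper: "\<nu> x \<le> C * norm x" for x
  proof -
    have "x = (\<Sum>i\<in>UNIV. (x $ i) *\<^sub>R axis i 1)"
      using basis_expansion[of x] by (simp add: scalar_mult_eq_scaleR)
    then have "\<nu> x \<le> (\<Sum>i\<in>UNIV. \<nu> ((x $ i) *\<^sub>R axis i 1))"
      using tri_sum[of UNIV "\<lambda>i. (x $ i) *\<^sub>R axis i 1"] by simp
    also have "\<dots> \<le> (\<Sum>i\<in>UNIV. norm x * \<nu> (axis i 1))"
      unfolding scale by (intro sum_mono mult_right_mono component_le_norm_cart nn)
    also have "\<dots> = norm x * (\<Sum>i\<in>UNIV. \<nu> (axis i 1))" by (rule sum_distrib_left[symmetric])
    also have "\<dots> \<le> norm x * C" by (intro mult_left_mono) (auto simp: C_def)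
    finally show ?thesis by (simp add: mult.commute)
  qed
  have lip: "\<bar>\<nu> x - \<nu> y\<bar> \<le> C * dist x y" for x y
  proof -
    have "\<nu> x \<le> \<nu> y + \<nu> (x - y)" "\<nu> y \<le> \<nu> x + \<nu> (y - x)"
      using tri[of y "x - y"] tri[of x "y - x"] by simp_all
    moreover have "\<nu> (x - y) \<le> C * dist x y" "\<nu> (y - x) \<le> C * dist x y"
      using upper[of "x - y"] upper[of "y - x"] by (simp_all add: dist_norm norm_minus_commute)
    ultimately show ?thesis by linarith
  qed
  have cont: "continuous_on S \<nu>" for S
  proof (rule continuous_onI)
    fix x :: "real^'k" and e :: real assume e: "e > 0"
    have "dist (\<nu> x') (\<nu> x) \<le> e" if x': "dist x' x < e / C" for x'
    proof -
      have "C * dist x' x \<le> e" using x' C by (simp add: field_simps)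
      then show ?thesis using lip[of x' x] by (simp add: dist_real_def)
    qed
    then show "\<exists>d>0. \<forall>x'\<in>S. dist x' x < d \<longrightarrow> dist (\<nu> x') (\<nu> x) \<le> e"
      using e C by (intro exI[of _ "e / C"]) simp
  qed
  have "compact (sphere (0 :: real^'k) 1)" "sphere (0 :: real^'k) 1 \<noteq> {}" by auto
  then obtain x0 where x0: "x0 \<in> sphere 0 1" "\<And>x. x \<in> sphere 0 1 \<Longrightarrow> \<nu> x0 \<le> \<nu> x"
    using continuous_attains_inf[OF _ _ cont] by metis
  have c: "\<nu> x0 > 0" using nn[of x0] zero[of x0] x0(1) by (auto simp: less_le)
  have lower: "\<nu> x0 * norm x \<le> \<nu> x" for x
  proof (cases "x = 0")
    case False
    have "\<nu> x0 \<le> \<nu> ((1 / norm x) *\<^sub>R x)" using False by (intro x0(2)) simp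
    then show ?thesis using False by (simp add: scale field_simps)
  qed (simp add: nn)
  show thesis using that[OF c C lower upper] .
qed

lemma is_norm_matrix_bound:
  fixes \<nu> :: "real^'k::finite \<Rightarrow> real"
  assumes \<nu>: "is_norm \<nu>"
  obtains \<kappa> where "\<kappa> > 0" "\<And>X x. \<nu> (X *v x) \<le> \<kappa> * norm X * \<nu> x"
proof -
  obtain c C where c: "c > 0" "C > 0" "\<And>x. c * norm x \<le> \<nu> x" "\<And>x. \<nu> x \<le> C * norm x"
    using is_norm_bounds[OF \<nu>] by blast
  show thesis
  proof (rule that[of "C / c"])
    fix X :: "real^'k^'k" and x
    have "\<nu> (X *v x) \<le> C * (norm X * norm x)"
      using c(4)[of "X *v x"] norm_matrix_vector_mult_le[of X x] c(2)
      by (meson less_imp_le mult_left_mono order_trans)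
    also have "\<dots> = (C / c * norm X) * (c * norm x)" using c by simp
    also have "\<dots> \<le> (C / c * norm X) * \<nu> x" using c by (intro mult_left_mono) auto
    finally show "\<nu> (X *v x) \<le> C / c * norm X * \<nu> x" .
  qed (use c in auto)
qed

text \<open>\<open>P\<close> increases \<nu> at most by the factor 1 + \<kappa> |P - 1|, which is
  bounded by r1 / r, precisely the loss from \<open>r1\<close> to \<open>r\<close>.\<close>

lemma lat_ge_near_identity:
  fixes \<nu> :: "real^'k::finite \<Rightarrow> real"
  assumes \<nu>: "is_norm \<nu>" and \<kappa>: "\<And>X x. \<nu> (X *v x) \<le> \<kappa> * norm X * \<nu> x"
    and M: "P ** M \<in> lat_ge \<nu> r1" and r: "r > 0" "\<kappa> * norm (P - mat 1) \<le> r1 / r - 1" "r1 > 0"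
  shows "M \<in> lat_ge \<nu> r"
  unfolding lat_ge_def
proof (intro CollectI ballI)
  fix z :: "real^'k" assume z: "z \<in> int_vecs - {0}"
  define y where "y = M *v z"
  have y0: "\<nu> y \<ge> 0" using \<nu> by (simp add: is_norm_def)
  have "r1 \<le> \<nu> (P *v y)"
    using M z by (auto simp: lat_ge_def y_def matrix_vector_mul_assoc)
  also have "P *v y = y + (P - mat 1) *v y" by (simp add: matrix_vector_mult_diff_rdistrib)
  also have "\<nu> \<dots> \<le> \<nu> y + \<nu> ((P - mat 1) *v y)" using \<nu> by (simp add: is_norm_def)
  also have "\<nu> ((P - mat 1) *v y) \<le> \<kappa> * norm (P - mat 1) * \<nu> y" by (rule \<kappa>)
  also have "\<kappa> * norm (P - mat 1) * \<nu> y \<le> (r1 / r - 1) * \<nu> y" by (rule mult_right_mono[OF r(2) y0])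
  finally have le: "r1 \<le> r1 / r * \<nu> y" by (simp add: algebra_simps)
  then have "r1 * r \<le> r1 * \<nu> y" using r by (simp add: field_simps)
  then show "r \<le> \<nu> (M *v z)" using r by (simp add: y_def)
qed

lemma lat_ge_GLZ: "\<gamma> \<in> GLZ \<Longrightarrow> M ** \<gamma> \<in> lat_ge \<nu> r \<longleftrightarrow> M \<in> lat_ge \<nu> r"
proof -
  assume \<gamma>: "\<gamma> \<in> GLZ"
  obtain \<gamma>' where \<gamma>': "\<gamma>' \<in> GLZ" "\<gamma> ** \<gamma>' = mat 1" using GLZ_inverse[OF \<gamma>] by blast
  show ?thesis
  proof
    assume M: "M ** \<gamma> \<in> lat_ge \<nu> r"
    show "M \<in> lat_ge \<nu> r"
      unfolding lat_ge_def
    proof (intro CollectI ballI)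
      fix z :: "real^'a" assume "z \<in> int_vecs - {0}"
      then have "r \<le> \<nu> ((M ** \<gamma>) *v (\<gamma>' *v z))"
        using M GLZ_vec[OF \<gamma>'(1)] by (auto simp: lat_ge_def)
      also have "(M ** \<gamma>) *v (\<gamma>' *v z) = M *v ((\<gamma> ** \<gamma>') *v z)"
        by (simp add: matrix_vector_mul_assoc matrix_mul_assoc)
      finally show "r \<le> \<nu> (M *v z)" by (simp add: \<gamma>')
    qed
  next
    assume M: "M \<in> lat_ge \<nu> r"
    show "M ** \<gamma> \<in> lat_ge \<nu> r"
      unfolding lat_ge_def
    proof (intro CollectI ballI)
      fix z :: "real^'a" assume "z \<in> int_vecs - {0}"
      then show "r \<le> \<nu> ((M ** \<gamma>) *v z)"
        using M GLZ_vec[OF \<gamma>] by (auto simp: lat_ge_def matrix_vector_mul_assoc[symmetric])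
    qed
  qed
qed

text \<open>Infinitely many vectors have to be controlled at once, so the perturbation is measured
  relative to each: (M - N) z = (M - N) M^(-1) (M z), which is at most q times M z in \<nu>. Here q
  = 1 - r / r1 is the relative loss from \<open>r1\<close> to \<open>r\<close>.\<close>

lemma lat_ge_open:
  fixes \<nu> :: "real^'k::finite \<Rightarrow> real"
  assumes \<nu>: "is_norm \<nu>" and M: "M \<in> lat_ge \<nu> r1" "det M \<noteq> 0" and r: "0 < r" "r < r1"
  obtains \<delta> where "\<delta> > 0" "ball M \<delta> \<subseteq> lat_ge \<nu> r"
proof -
  obtain \<kappa> where \<kappa>: "\<kappa> > 0" "\<And>X x. \<nu> (X *v x) \<le> \<kappa> * norm X * \<nu> x"
    using is_norm_matrix_bound[OF \<nu>] by blast
  define q where "q = 1 - r / r1"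
  have q: "q > 0" using r by (simp add: q_def)
  define B where "B = matrix_inv M"
  have B: "B ** M = mat 1" unfolding B_def by (rule matrix_inv_mult[OF M(2)])
  define \<delta> where "\<delta> = q / (\<kappa> * (norm B + 1))"
  have nB: "\<kappa> * (norm B + 1) > 0" using \<kappa>(1) by (simp add: add_nonneg_pos)
  have "\<delta> > 0" using q nB by (simp add: \<delta>_def)
  moreover have "ball M \<delta> \<subseteq> lat_ge \<nu> r"
  proof
    fix N assume N: "N \<in> ball M \<delta>"
    have nn: "\<nu> x \<ge> 0" for x using \<nu> by (simp add: is_norm_def)
    show "N \<in> lat_ge \<nu> r"
      unfolding lat_ge_def
    proof (intro CollectI ballI)
      fix z :: "real^'k" assume z: "z \<in> int_vecs - {0}"
      define y where "y = M *v z"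
      have y: "r1 \<le> \<nu> y" using M(1) z by (auto simp: lat_ge_def y_def)
      have Mz: "y = N *v z + ((M - N) ** B) *v y"
      proof -
        have "((M - N) ** B) *v y = (M - N) *v ((B ** M) *v z)"
          by (simp add: y_def matrix_vector_mul_assoc matrix_mul_assoc)
        then show ?thesis by (simp add: B y_def matrix_vector_mult_diff_rdistrib)
      qed
      have "\<nu> y \<le> \<nu> (N *v z) + \<nu> (((M - N) ** B) *v y)"
        by (subst Mz) (use \<nu> in \<open>simp add: is_norm_def\<close>)
      also have "\<nu> (((M - N) ** B) *v y) \<le> \<kappa> * norm ((M - N) ** B) * \<nu> y" by (rule \<kappa>)
      also have "\<dots> \<le> q * \<nu> y"
      proof (rule mult_right_mono[OF _ nn])
        have "norm ((M - N) ** B) \<le> norm (M - N) * norm B" by (rule norm_matrix_matrix_mult_le)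
        also have "\<dots> \<le> \<delta> * (norm B + 1)"
          using N \<open>\<delta> > 0\<close> by (intro mult_mono) (auto simp: dist_norm)
        finally have "\<kappa> * norm ((M - N) ** B) \<le> \<kappa> * (\<delta> * (norm B + 1))"
          using \<kappa>(1) by simp
        also have "\<dots> = \<delta> * (\<kappa> * (norm B + 1))" by (simp only: mult_ac)
        also have "\<dots> = q"
        proof -
          have "q / k * k = q" if "k > 0" for k :: real using that by simp
          from this[OF nB] show ?thesis unfolding \<delta>_def .
        qed
        finally show "\<kappa> * norm ((M - N) ** B) \<le> q" .
      qed
      finally have "(1 - q) * \<nu> y \<le> \<nu> (N *v z)" by (simp add: algebra_simps)
      moreover have "(1 - q) * r1 \<le> (1 - q) * \<nu> y"
        using y r by (intro mult_left_mono) (auto simp: q_def)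
      moreover have "(1 - q) * r1 = r" using r by (simp add: q_def)
      ultimately show "r \<le> \<nu> (N *v z)" by linarith
    qed
  qed
  ultimately show thesis by (rule that)
qed

section \<open>Unipotent matrices and their interaction with the flow\<close>

definition uni :: "real^'n^'m \<Rightarrow> real^('m::finite + 'n::finite)^('m + 'n)" where
  "uni B = (\<chi> i j. case i of
     Inl a \<Rightarrow> (case j of Inl c \<Rightarrow> if a = c then 1 else 0 | Inr b \<Rightarrow> B $ a $ b)
   | Inr b \<Rightarrow> (case j of Inl c \<Rightarrow> 0 | Inr b' \<Rightarrow> if b = b' then 1 else 0))"

lemma sum_over_sum_type:
  "(\<Sum>i\<in>(UNIV :: ('m::finite + 'n::finite) set). f i) = (\<Sum>a\<in>UNIV. f (Inl a)) + (\<Sum>b\<in>UNIV. f (Inr b))"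
  unfolding UNIV_Plus_UNIV[symmetric] by (subst sum.Plus) simp_all

lemma uni_vec:
  "(uni B *v x) $ Inl a = x $ Inl a + (\<Sum>b\<in>UNIV. B $ a $ b * x $ Inr b)"
  "(uni B *v x) $ Inr b = x $ Inr b"
  by (simp_all add: uni_def matrix_vector_mult_def sum_over_sum_type if_distrib[of "\<lambda>y. y * _"] cong: if_cong)

lemma vec_sum_eqI:
  fixes x y :: "real^('m::finite + 'n::finite)"
  assumes "\<And>a. x $ Inl a = y $ Inl a" "\<And>b. x $ Inr b = y $ Inr b"
  shows "x = y"
  unfolding vec_eq_iff
proof
  show "x $ i = y $ i" for i by (cases i) (simp_all add: assms)
qed

lemma uni_mult: "uni A ** uni B = uni (A + B)"
  unfolding matrix_eq
proof
  fix x
  show "(uni A ** uni B) *v x = uni (A + B) *v x"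
    unfolding matrix_vector_mul_assoc[symmetric]
    by (rule vec_sum_eqI) (simp_all add: uni_vec sum.distrib algebra_simps)
qed

lemma uni_0: "uni 0 = mat 1"
  unfolding matrix_eq
proof
  show "uni 0 *v x = mat 1 *v x" for x :: "real^('a + 'b)"
    by (rule vec_sum_eqI) (simp_all add: uni_vec)
qed

lemma flow_uni:
  fixes B :: "real^'n::finite^'m::finite"
  assumes t: "t > 0"
  shows "flow t ** uni B = uni (flow_ratio TYPE('m) TYPE('n) t *\<^sub>R B) ** flow t"
  unfolding matrix_eq
proof
  fix x :: "real^('m + 'n)"
  show "(flow t ** uni B) *v x = (uni (flow_ratio TYPE('m) TYPE('n) t *\<^sub>R B) ** flow t) *v x"
    unfolding matrix_vector_mul_assoc[symmetric]
    using t by (intro vec_sum_eqI)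
      (simp_all add: uni_vec flow_vec flow_ratio_def sum_distrib_left algebra_simps)
qed

text \<open>At the time t with expansion rate 2, the flow conjugates \<open>uni B\<close> to
  \<open>uni (B + B)\<close>, its square. Hence the determinant equals its own square, and it is not
  0.\<close>

lemma det_uni: "det (uni B :: real^('m::finite + 'n::finite)^('m + 'n)) = 1"
proof -
  define \<alpha> where "\<alpha> = real CARD('n) / real CARD('m)"
  have \<alpha>: "\<alpha> + 1 > 0" by (simp add: \<alpha>_def add_nonneg_pos)
  define t :: real where "t = 2 powr (1 / (\<alpha> + 1))"
  have t: "t > 0" by (simp add: t_def)
  have "flow_ratio TYPE('m) TYPE('n) t = t powr (\<alpha> + 1)"
    using t by (simp add: flow_ratio_def \<alpha>_def powr_add)
  also have "\<dots> = 2" using \<alpha> by (simp add: t_def powr_powr)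
  finally have "flow t ** uni B = uni (B + B) ** flow t"
    using flow_uni[OF t, of B] by (simp add: scaleR_2)
  then have "det (flow t ** uni B) = det (uni B ** uni B ** flow t)" by (simp add: uni_mult)
  then have "det (uni B) = det (uni B) * det (uni B)"
    by (simp add: det_mul det_flow[OF t])
  moreover have "det (uni B) * det (uni (- B)) = 1"
    unfolding det_mul[symmetric] uni_mult by (simp add: uni_0)
  ultimately show ?thesis by (metis mult_cancel_left1 mult_zero_left zero_neq_one)
qed

lemma norm_matrix_le_entries:
  fixes Z :: "real^'a::finite^'b::finite"
  assumes "\<And>i j. \<bar>Z $ i $ j\<bar> \<le> e"
  shows "norm Z \<le> real CARD('b) * real CARD('a) * e"
proof -
  have "norm Z \<le> (\<Sum>i\<in>UNIV. norm (Z $ i))"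
    unfolding norm_vec_def[of Z] by (rule L2_set_le_sum) simp
  also have "\<dots> \<le> (\<Sum>i\<in>(UNIV::'b set). \<Sum>j\<in>UNIV. \<bar>Z $ i $ j\<bar>)"
    by (intro sum_mono norm_le_l1_cart)
  also have "\<dots> \<le> (\<Sum>i\<in>(UNIV::'b set). \<Sum>j\<in>(UNIV::'a set). e)"
    by (intro sum_mono assms)
  finally show ?thesis by simp
qed

lemma entry_le_norm: "\<bar>Z $ i $ j\<bar> \<le> norm (Z :: real^'a::finite^'b::finite)"
  using component_le_norm_cart[of "Z $ i" j] Finite_Cartesian_Product.norm_nth_le[of Z i] by linarith

text \<open>Near the identity a matrix is a product of a block lower triangular one, which conjugation
  by the flow keeps small, and a unipotent upper one.\<close>

lemma near_identity_decomposition: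
  fixes \<epsilon> :: real
  assumes "\<epsilon> > 0"
  obtains \<delta> where "\<delta> > 0" "\<And>X :: real^('m::finite + 'n::finite)^('m + 'n). norm (X - mat 1) < \<delta> \<Longrightarrow>
    \<exists>B. \<forall>t \<ge> 1. norm (flow t ** X ** uni (- B) ** flow (1 / t) - mat 1) < \<epsilon>"
proof -
  define D where "D = real CARD('m + 'n) * real CARD('m + 'n)"
  have "real 1 \<le> real CARD('m + 'n)"
    using zero_less_card_finite[where 'a = "'m + 'n"] by linarith
  then have D1: "D \<ge> 1 * 1" unfolding D_def by (intro mult_mono) auto
  have Dm: "real CARD('m) * real CARD('m) \<le> D" "real CARD('m) * real CARD('n) \<le> D"
    unfolding D_def by (auto intro!: mult_mono)
  \<comment> \<open>\<open>D\<close> converts bounds on entries into bounds on norms. The first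
    bound on \<delta> makes the upper left block invertible and \<open>B\<close> of size at most 2 D
    x; the second brings the final estimate below \<epsilon>.\<close>
  define \<delta> where "\<delta> = min (1 / (2 * D)) (\<epsilon> / (2 * D * D * (1 + D + 3 * D)))"
  have \<delta>: "\<delta> > 0" "\<delta> * D \<le> 1 / 2" "\<delta> * (D * D * (1 + D + 3 * D)) < \<epsilon>"
  proof -
    show "\<delta> > 0" unfolding \<delta>_def using assms D1 by simp
    have "\<delta> \<le> 1 / (2 * D)" unfolding \<delta>_def by (rule min.cobounded1)
    then show "\<delta> * D \<le> 1 / 2" using D1 by (simp add: field_simps)
    have K: "D * D * (1 + D + 3 * D) > 0" using D1 by simp
    have "\<delta> \<le> \<epsilon> / (2 * D * D * (1 + D + 3 * D))" unfolding \<delta>_def by (rule min.cobounded2)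
    also have "\<dots> = (\<epsilon> / 2) / (D * D * (1 + D + 3 * D))" by (simp add: mult.assoc)
    finally have "\<delta> * (D * D * (1 + D + 3 * D)) \<le> \<epsilon> / 2" using K by (simp add: pos_le_divide_eq)
    then show "\<delta> * (D * D * (1 + D + 3 * D)) < \<epsilon>" using assms by linarith
  qed
  show thesis
  proof (rule that[OF \<delta>(1)])
    fix X :: "real^('m + 'n)^('m + 'n)" assume X: "norm (X - mat 1) < \<delta>"
    define x where "x = norm (X - mat 1)"
    have x: "0 \<le> x" "x < \<delta>" using X by (auto simp: x_def)
    define A1 :: "real^'m^'m" where "A1 = (\<chi> a c. X $ Inl a $ Inl c)"
    define A2 :: "real^'n^'m" where "A2 = (\<chi> a b. X $ Inl a $ Inr b)"
    have xD: "x * D \<le> 1 / 2"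
      using mult_right_mono[of x \<delta> D] x \<delta>(2) D1 by linarith
    have "norm (A1 - mat 1) \<le> real CARD('m) * real CARD('m) * x"
    proof (rule norm_matrix_le_entries)
      show "\<bar>(A1 - mat 1) $ a $ c\<bar> \<le> x" for a c
        using entry_le_norm[of "X - mat 1" "Inl a" "Inl c"] by (simp add: A1_def x_def mat_def)
    qed
    also have "\<dots> \<le> D * x" using Dm x by (intro mult_right_mono) auto
    finally have A1: "norm (A1 - mat 1) \<le> 1 / 2" using xD by (simp add: mult.commute)
    have "norm A2 \<le> real CARD('m) * real CARD('n) * x"
    proof (rule norm_matrix_le_entries)
      show "\<bar>A2 $ a $ b\<bar> \<le> x" for a b
        using entry_le_norm[of "X - mat 1" "Inl a" "Inr b"] by (simp add: A2_def x_def mat_def)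
    qed
    also have "\<dots> \<le> D * x" using Dm x by (intro mult_right_mono) auto
    finally have A2: "norm A2 \<le> D * x" .
    have "inj ((*v) A1)"
    proof (rule injI)
      fix u v assume "A1 *v u = A1 *v v"
      then have "A1 *v (u - v) = 0" by (simp add: matrix_vector_mult_diff_distrib)
      then have "u - v = - ((A1 - mat 1) *v (u - v))" by (simp add: matrix_vector_mult_diff_rdistrib)
      then have "norm (u - v) \<le> norm (A1 - mat 1) * norm (u - v)"
        using norm_matrix_vector_mult_le[of "A1 - mat 1" "u - v"] by (metis norm_minus_cancel)
      also have "\<dots> \<le> 1 / 2 * norm (u - v)" by (rule mult_right_mono[OF A1]) simp
      finally show "u = v" by simp
    qed
    then have detA1: "det A1 \<noteq> 0" using det_nz_iff_inj[of "(*v) A1"] by simp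
    \<comment> \<open>This choice annihilates the upper right block of
      \<open>X ** uni (- B)\<close>, the only block that forward conjugation enlarges.\<close>
    define B where "B = matrix_inv A1 ** A2"
    have AB: "A1 ** B = A2" by (simp add: B_def matrix_mul_assoc matrix_inv_mult[OF detA1])
    have "(A1 - mat 1) ** B = A1 ** B - B"
      by (simp add: vec_eq_iff matrix_matrix_mult_def left_diff_distrib sum_subtractf mat_def
          if_distrib[of "\<lambda>y. y * _"] cong: if_cong)
    then have "B = A2 - (A1 - mat 1) ** B"
      by (simp add: AB)
    then have "norm B \<le> norm A2 + norm ((A1 - mat 1) ** B)"
      by (metis norm_triangle_ineq4)
    also have "norm ((A1 - mat 1) ** B) \<le> norm (A1 - mat 1) * norm B" by (rule norm_matrix_matrix_mult_le)
    also have "\<dots> \<le> 1 / 2 * norm B" by (rule mult_right_mono[OF A1]) simp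
    finally have B: "norm B \<le> 2 * (D * x)" using A2 by simp
    define p where "p = X ** uni (- B)"
    have uB: "norm (uni (- B) - mat 1) \<le> D * (2 * (D * x))"
    proof -
      have "norm (uni (- B) - mat 1) \<le> real CARD('m + 'n) * real CARD('m + 'n) * norm B"
      proof (rule norm_matrix_le_entries)
        show "\<bar>(uni (- B) - mat 1) $ i $ j\<bar> \<le> norm B" for i j
          using entry_le_norm[of B] by (auto simp: uni_def mat_def split: sum.split)
      qed
      also have "\<dots> \<le> D * (2 * (D * x))" unfolding D_def[symmetric] using B D1 by (intro mult_left_mono) auto
      finally show "norm (uni (- B) - mat 1) \<le> D * (2 * (D * x))" .
    qed
    have n1: "norm (mat 1 :: real^('m + 'n)^('m + 'n)) \<le> D"
      using norm_matrix_le_entries[of "mat 1 :: real^('m + 'n)^('m + 'n)" 1] by (simp add: mat_def D_def)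
    have np: "norm (p - mat 1) \<le> x * D * (1 + D + 3 * D)"
    proof -
      have "p - mat 1 = (X - mat 1) ** uni (- B) + (uni (- B) - mat 1)"
        by (simp add: p_def linear_diff[OF linear_matrix_mult(2)])
      then have "norm (p - mat 1) \<le> norm ((X - mat 1) ** uni (- B)) + norm (uni (- B) - mat 1)"
        using norm_triangle_ineq by metis
      also have "norm ((X - mat 1) ** uni (- B)) \<le> x * norm (uni (- B))"
        unfolding x_def by (rule norm_matrix_matrix_mult_le)
      also have "norm (uni (- B)) \<le> D + D * (2 * (D * x))"
        using norm_triangle_sub[of "uni (- B)" "mat 1"] n1 uB by linarith
      also have "D * (2 * (D * x)) \<le> D * 1" using xD D1 by (intro mult_left_mono) (auto simp: mult.commute)
      finally have "norm (p - mat 1) \<le> x * (D + D * 1) + D * (2 * (D * x))"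
        using uB x by (simp add: mult_left_mono)
      also have "\<dots> = x * D * (2 + 2 * D)" by (simp add: algebra_simps)
      also have "\<dots> \<le> x * D * (1 + D + 3 * D)" using x D1 by (intro mult_left_mono) auto
      finally show ?thesis .
    qed
    have p0: "p $ Inl a $ Inr b = 0" for a b
    proof -
      have "p $ Inl a $ Inr b = A2 $ a $ b - (A1 ** B) $ a $ b"
        by (simp add: p_def matrix_matrix_mult_def sum_over_sum_type uni_def A1_def A2_def sum_negf
            if_distrib[of "\<lambda>y. _ * y"] cong: if_cong)
      then show ?thesis by (simp add: AB)
    qed
    have "norm (flow t ** X ** uni (- B) ** flow (1 / t) - mat 1) < \<epsilon>" if t: "t \<ge> 1" for t
    proof -
      define f where "f = (\<lambda>i::'m + 'n. case i of Inl _ \<Rightarrow> t powr (real CARD('n) / real CARD('m)) | Inr _ \<Rightarrow> 1 / t)"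
      define f' where "f' = (\<lambda>i::'m + 'n. case i of Inl _ \<Rightarrow> (1 / t) powr (real CARD('n) / real CARD('m)) | Inr _ \<Rightarrow> 1 / (1 / t))"
      have conj: "(flow t ** p ** flow (1 / t)) $ i $ j = f i * p $ i $ j * f' j" for i j
      proof -
        have "(flow t ** p ** flow (1 / t)) $ i $ j = ((diag_mat f ** p) ** diag_mat f') $ i $ j"
          unfolding flow_def block_diag_eq_diag_mat f_def f'_def ..
        also have "\<dots> = (diag_mat f ** p) $ i $ j * f' j"
          by (simp add: matrix_matrix_mult_def[of "diag_mat f ** p"] diag_mat_def[of f'] if_distrib[of "\<lambda>y. _ * y"] cong: if_cong)
        finally show ?thesis by (simp add: diag_mat_mult_component)
      qed
      define a where "a = t powr (real CARD('n) / real CARD('m))"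
      have a: "a \<ge> 1" using t by (simp add: a_def ge_one_powr_ge_zero)
      have inva: "(1 / t) powr (real CARD('n) / real CARD('m)) = 1 / a"
        using t by (simp add: a_def powr_divide)
      \<comment> \<open>Conjugation fixes the diagonal blocks and divides the lower left one by t a,
        which is at least 1. As the upper right block is 0, the estimate does not depend on
        t.\<close>
      have "\<bar>(flow t ** p ** flow (1 / t) - mat 1) $ i $ j\<bar> \<le> norm (p - mat 1)" for i j
      proof (cases i; cases j)
        fix u v assume ij: "i = Inl u" "j = Inl v"
        have "f i * p $ i $ j * f' j = p $ i $ j"
          using a by (simp add: ij f_def f'_def inva a_def[symmetric])
        then have "(flow t ** p ** flow (1 / t)) $ i $ j = p $ i $ j" unfolding conj .
        then show ?thesis using entry_le_norm[of "p - mat 1" i j] by simp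
      next
        fix u v assume ij: "i = Inr u" "j = Inr v"
        have "f i * p $ i $ j * f' j = p $ i $ j"
          using t by (simp add: ij f_def f'_def)
        then have "(flow t ** p ** flow (1 / t)) $ i $ j = p $ i $ j" unfolding conj .
        then show ?thesis using entry_le_norm[of "p - mat 1" i j] by simp
      next
        fix u v assume ij: "i = Inl u" "j = Inr v"
        then show ?thesis by (simp add: conj p0 mat_def)
      next
        fix u v assume ij: "i = Inr u" "j = Inl v"
        have "\<bar>f i * p $ i $ j * f' j\<bar> = \<bar>p $ i $ j\<bar> / (t * a)"
          using t a by (simp add: ij f_def f'_def inva abs_mult)
        also have "\<dots> \<le> \<bar>p $ i $ j\<bar> / 1"
        proof (rule divide_left_mono)
          show "1 \<le> t * a" using mult_mono[of 1 t 1 a] t a by simp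
        qed (use t a in auto)
        finally show ?thesis using entry_le_norm[of "p - mat 1" i j] by (simp add: conj ij mat_def)
      qed
      then have "norm (flow t ** p ** flow (1 / t) - mat 1) \<le> D * norm (p - mat 1)"
        unfolding D_def by (rule norm_matrix_le_entries)
      also have "\<dots> \<le> D * (x * D * (1 + D + 3 * D))" using np D1 by (intro mult_left_mono) auto
      also have "\<dots> = x * (D * D * (1 + D + 3 * D))" by (simp add: mult_ac)
      also have "\<dots> \<le> \<delta> * (D * D * (1 + D + 3 * D))" using x D1 by (intro mult_right_mono) auto
      also have "\<dots> < \<epsilon>" by (rule \<delta>(3))
      finally show ?thesis by (simp add: p_def matrix_mul_assoc)
    qed
    then show "\<exists>B. \<forall>t \<ge> 1. norm (flow t ** X ** uni (- B) ** flow (1 / t) - mat 1) < \<epsilon>" by blast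
  qed
qed

theorem horosphere_reaches_lat_ge:
  fixes \<nu> :: "real^('m::finite + 'n::finite) \<Rightarrow> real" and h M0 :: "real^('m + 'n)^('m + 'n)"
  assumes \<nu>: "is_norm \<nu>" and h: "\<bar>det h\<bar> = 1" and M0: "\<bar>det M0\<bar> = 1" "M0 \<in> lat_ge \<nu> \<rho>" and r: "0 < r" "r < \<rho>"
  shows "\<exists>t \<ge> 1. \<exists>B. flow t ** uni B ** h \<in> lat_ge \<nu> r"
proof -
  obtain \<kappa> where \<kappa>: "\<kappa> > 0" "\<And>X x. \<nu> (X *v x) \<le> \<kappa> * norm X * \<nu> x"
    using is_norm_matrix_bound[OF \<nu>] by blast
  \<comment> \<open>One half of the gap pays for reaching \<open>M0\<close> only approximately, the
    other for dropping \<open>P\<close>.\<close>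
  define r1 where "r1 = (r + \<rho>) / 2"
  have r1: "r < r1" "r1 < \<rho>" "0 < r1" using r by (auto simp: r1_def)
  have "det M0 \<noteq> 0" using M0(1) by auto
  then obtain \<delta>0 where \<delta>0: "\<delta>0 > 0" "ball M0 \<delta>0 \<subseteq> lat_ge \<nu> r1"
    using lat_ge_open[OF \<nu> M0(2) _ r1(3,2)] by blast
  define \<epsilon> where "\<epsilon> = (r1 / r - 1) / \<kappa>"
  have \<epsilon>: "\<epsilon> > 0" using r1 r \<kappa> by (simp add: \<epsilon>_def)
  obtain \<delta> where \<delta>: "\<delta> > 0" "\<And>X :: real^('m + 'n)^('m + 'n). norm (X - mat 1) < \<delta> \<Longrightarrow>
    \<exists>B. \<forall>t \<ge> 1. norm (flow t ** X ** uni (- B) ** flow (1 / t) - mat 1) < \<epsilon>"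
    using near_identity_decomposition[OF \<epsilon>] by blast
  have dh: "det h \<noteq> 0" using h by auto
  define hi where "hi = matrix_inv h"
  have hi: "h ** hi = mat 1" "hi ** h = mat 1" unfolding hi_def by (rule matrix_inv_mult[OF dh])+
  define U where "U = (\<lambda>Y. mat 1 ** Y ** hi) -` ball (mat 1) \<delta>"
  have "open U"
    unfolding U_def by (rule open_vimage[OF open_ball continuous_on_matrix_mult])
  moreover have "h \<in> U"
    unfolding U_def using \<delta>(1) by (simp add: hi)
  ultimately have U: "open U" "h \<in> U" .
  obtain t Y \<gamma> where t: "t \<ge> 1" "Y \<in> U" "\<gamma> \<in> GLZ" "flow t ** Y ** \<gamma> \<in> ball M0 \<delta>0"
    using flow_transitive[OF dh U(2,1), of M0 "ball M0 \<delta>0"] h M0 \<delta>0(1) by auto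
  define X where "X = Y ** hi"
  have Xh: "X ** h = Y" by (simp add: X_def matrix_mul_assoc[symmetric] hi)
  have "norm (X - mat 1) < \<delta>" using t(2) by (simp add: U_def X_def dist_norm norm_minus_commute)
  then obtain B where B: "norm (flow t ** X ** uni (- B) ** flow (1 / t) - mat 1) < \<epsilon>"
    using \<delta>(2) t(1) by blast
  define P where "P = flow t ** X ** uni (- B) ** flow (1 / t)"
  define G where "G = flow t ** uni B ** h ** \<gamma>"
  have t0: "t > 0" using t(1) by simp
  have "P ** G = flow t ** X ** (uni (- B) ** ((flow (1 / t) ** flow t) ** uni B)) ** h ** \<gamma>"
    by (simp add: P_def G_def matrix_mul_assoc)
  also have "\<dots> = flow t ** Y ** \<gamma>"
    by (simp add: flow_inverse(2) t0 uni_mult uni_0 Xh[symmetric] matrix_mul_assoc)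
  finally have "P ** G \<in> lat_ge \<nu> r1" using t(4) \<delta>0(2) by auto
  moreover have "\<kappa> * norm (P - mat 1) \<le> r1 / r - 1"
  proof -
    have "\<kappa> * norm (P - mat 1) \<le> \<kappa> * \<epsilon>" using B \<kappa>(1) by (intro mult_left_mono) (auto simp: P_def)
    then show ?thesis using \<kappa>(1) by (simp add: \<epsilon>_def)
  qed
  ultimately have "G \<in> lat_ge \<nu> r"
    using lat_ge_near_identity[OF \<nu> \<kappa>(2) _ r(1) _ r1(3)] by blast
  then have "flow t ** uni B ** h \<in> lat_ge \<nu> r"
    unfolding G_def using lat_ge_GLZ[OF t(3)] by blast
  then show ?thesis using t(1) by blast
qed

section \<open>Recurrence of almost every orbit\<close>

text \<open>The count of \<open>union_slab_measure\<close> with integral shifts: writing z = (p, q),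
  the condition on the top coordinates is |A q + p| < l. As \<eta> < 1, q cannot vanish; once q has
  size k, there are at most about k^m choices of p, so e = m balances the dimensions and again no
  power of s remains.\<close>

lemma bad_uni_measure:
  fixes R :: real
  assumes R: "R > 0"
  obtains C where "C \<ge> 0" "\<And>s \<eta>. s \<ge> 1 \<Longrightarrow> 0 < \<eta> \<Longrightarrow> \<eta> < 1 \<Longrightarrow>
    \<exists>B \<in> sets borel. bounded B \<and> measure lborel B \<le> C * \<eta> ^ (CARD('m::finite) + CARD('n::finite)) \<and>
      (\<forall>A::real^'n^'m. A \<in> entry_cube R \<longrightarrow>
        (\<exists>z \<in> int_vecs - {0}. norm (flow s *v (uni A *v z)) < \<eta>) \<longrightarrow> A \<in> B)"
proof -
  \<comment> \<open>For q in \<open>sup_shell j k\<close> the top coordinates of z are at most y k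
    in modulus, and \<open>Y * real k\<close> bounds the number of integers in that range.\<close>
  define y where "y = real CARD('n) * R + 1"
  have y1: "y \<ge> 1" using R by (simp add: y_def)
  define Y where "Y = 2 * y + 1"
  define P :: "nat \<Rightarrow> ('m \<Rightarrow> real) set" where
    "P = (\<lambda>k. (\<lambda>f i. - real_of_int (f i)) ` PiE UNIV (\<lambda>_. {- \<lfloor>y * real k\<rfloor> .. \<lfloor>y * real k\<rfloor>}))"
  have finP: "finite (P k)" for k
    unfolding P_def by (intro finite_imageI finite_PiE) auto
  have cardP: "real (card (P k)) \<le> (Y * real k) ^ CARD('m)" if k: "k \<ge> 1" for k
  proof -
    define N where "N = \<lfloor>y * real k\<rfloor>"
    have N0: "N \<ge> 0" using y1 by (simp add: N_def)
    have "card (P k) \<le> card (PiE (UNIV :: 'm set) (\<lambda>_. {- N .. N}))"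
      unfolding P_def N_def by (intro card_image_le finite_PiE) auto
    also have "\<dots> = nat (2 * N + 1) ^ CARD('m)"
      by (simp add: card_PiE)
    finally have "real (card (P k)) \<le> real (nat (2 * N + 1)) ^ CARD('m)"
      by (metis of_nat_le_iff of_nat_power)
    also have "\<dots> \<le> (Y * real k) ^ CARD('m)"
    proof (rule power_mono)
      have "real (nat (2 * N + 1)) = 2 * of_int N + 1" using N0 by simp
      also have "\<dots> \<le> 2 * (y * real k) + 1" unfolding N_def by simp
      also have "\<dots> \<le> Y * real k" using k by (simp add: Y_def algebra_simps)
      finally show "real (nat (2 * N + 1)) \<le> Y * real k" .
    qed simp
    finally show ?thesis .
  qed
  define C where "C = real CARD('n) * (2 * 3 ^ (CARD('n) - 1) * Y ^ CARD('m) *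
    (measure lborel (entry_cube (2 * R) :: (real^'n^'m) set) * (4 / R) ^ card (UNIV :: 'm set)))"
  show thesis
  proof (rule that[of C])
    show "C \<ge> 0" using R y1 by (simp add: C_def Y_def)
    fix s \<eta> :: real assume s: "s \<ge> 1" and \<eta>: "0 < \<eta>" "\<eta> < 1"
    define a where "a = s powr (real CARD('n) / real CARD('m))"
    have a1: "a \<ge> 1" using s by (simp add: a_def ge_one_powr_ge_zero)
    define l where "l = \<eta> / a"
    define X where "X = \<eta> * s"
    have l: "l > 0" using \<eta> a1 by (simp add: l_def)
    have l\<eta>: "l \<le> \<eta>" using a1 \<eta> by (simp add: l_def field_simps)
    have X: "X \<ge> 0" using \<eta> s by (simp add: X_def)
    have Y0: "Y \<ge> 0" using y1 by (simp add: Y_def)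
    have dims: "CARD('n) + CARD('m) = card (UNIV :: 'm set) + CARD('n)" "CARD('n) \<ge> 1"
      using zero_less_card_finite[where 'a = 'n] by linarith+
    obtain B :: "(real^'n^'m) set" where B: "B \<in> sets borel" "bounded B"
      "measure lborel B \<le> C * l ^ card (UNIV :: 'm set) * X ^ CARD('n)"
      "\<And>A j k w p. A \<in> entry_cube R \<Longrightarrow> w \<in> sup_shell j k \<Longrightarrow> k \<ge> 1 \<Longrightarrow> real k \<le> X \<Longrightarrow> p \<in> P k \<Longrightarrow>
       (\<And>i. i \<in> UNIV \<Longrightarrow> \<bar>A $ i \<bullet> w - p i\<bar> < l) \<Longrightarrow> A \<in> B"
      unfolding C_def
    proof (rule union_slab_measure[OF R l X Y0 finP, where e = "CARD('m)" and I = UNIV and n = "CARD('n)"])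
      show "real (card (P k)) \<le> (Y * real k) ^ CARD('m)" if "1 \<le> k" for k by (rule cardP[OF that])
    qed (use dims in auto)
    have "l ^ CARD('m) * X ^ CARD('n) = (\<eta> ^ CARD('m) / a ^ CARD('m)) * (\<eta> ^ CARD('n) * s ^ CARD('n))"
      by (simp add: l_def X_def power_mult_distrib power_divide)
    also have "a ^ CARD('m) = s ^ CARD('n)"
      unfolding a_def using s by (intro powr_exponent_power) simp
    also have "(\<eta> ^ CARD('m) / s ^ CARD('n)) * (\<eta> ^ CARD('n) * s ^ CARD('n)) = \<eta> ^ (CARD('m) + CARD('n))"
      using s by (simp add: power_add)
    finally have eq: "C * l ^ card (UNIV :: 'm set) * X ^ CARD('n) = C * \<eta> ^ (CARD('m) + CARD('n))"
      by (simp add: mult.assoc)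
    have Bm: "measure lborel B \<le> C * \<eta> ^ (CARD('m) + CARD('n))"
      using B(3) unfolding eq .
    have "A \<in> B" if A: "A \<in> entry_cube R"
      and z: "z \<in> int_vecs - {0}" "norm (flow s *v (uni A *v z)) < \<eta>" for A :: "real^'n^'m" and z
    proof -
      define q :: "real^'n" where "q = (\<chi> b. z $ Inr b)"
      have comp: "\<bar>(flow s *v (uni A *v z)) $ i\<bar> < \<eta>" for i
        using component_le_norm_cart[of "flow s *v (uni A *v z)" i] z(2) by linarith
      have Aq: "(\<Sum>b\<in>UNIV. A $ i $ b * z $ Inr b) = A $ i \<bullet> q" for i
        by (simp add: q_def inner_vec_def)
      have top: "\<bar>z $ Inl i + A $ i \<bullet> q\<bar> < l" for i
      proof -
        have "a * \<bar>z $ Inl i + A $ i \<bullet> q\<bar> < \<eta>"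
          using comp[of "Inl i"] a1 unfolding flow_vec uni_vec Aq a_def[symmetric] abs_mult by simp
        then show ?thesis using a1 by (simp add: l_def pos_less_divide_eq mult.commute)
      qed
      have bot: "\<bar>z $ Inr b\<bar> < X" for b
        using comp[of "Inr b"] s unfolding flow_vec uni_vec by (simp add: X_def field_simps)
      have zint: "z $ i \<in> \<int>" for i using z(1) by (simp add: int_vecs_def)
      have "q \<noteq> 0"
      proof
        assume q0: "q = 0"
        have "z $ Inl i = 0" for i
        proof (rule ccontr)
          assume "z $ Inl i \<noteq> 0"
          then have "1 \<le> \<bar>z $ Inl i\<bar>" using zint by (intro Ints_nonzero_abs_ge1)
          then show False using top[of i] q0 l\<eta> \<eta> by simp
        qed
        moreover have "z $ Inr b = 0" for b
          using arg_cong[OF q0, of "\<lambda>v. v $ b"] by (simp add: q_def)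
        ultimately have "z = 0" by (intro vec_sum_eqI) simp_all
        then show False using z(1) by simp
      qed
      moreover have "q \<in> int_vecs" using zint by (simp add: q_def int_vecs_def)
      ultimately obtain j k where jk: "q \<in> sup_shell j k" "k \<ge> 1"
        using in_sup_shell[of q] by blast
      have qk: "\<bar>q $ b\<bar> \<le> real k" for b using jk(1) by (simp add: sup_shell_def)
      have "real k = \<bar>q $ j\<bar>" using jk(1) by (simp add: sup_shell_def)
      then have kX: "real k \<le> X" using bot[of j] by (simp add: q_def)
      have zk: "\<bar>z $ Inl i\<bar> \<le> y * real k" for i
      proof -
        have "\<bar>A $ i \<bullet> q\<bar> \<le> (\<Sum>b\<in>UNIV. \<bar>A $ i $ b * q $ b\<bar>)"
          unfolding inner_vec_def by (simp add: sum_abs)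
        also have "\<dots> \<le> (\<Sum>b\<in>(UNIV :: 'n set). R * real k)"
          unfolding abs_mult using A qk R by (intro sum_mono mult_mono) (auto simp: entry_cube_def)
        also have "\<dots> = real CARD('n) * R * real k" by simp
        finally have "\<bar>z $ Inl i\<bar> \<le> real CARD('n) * R * real k + 1"
          using top[of i] l\<eta> \<eta> by linarith
        also have "\<dots> \<le> y * real k" using jk(2) by (simp add: y_def algebra_simps)
        finally show ?thesis .
      qed
      define f where "f = (\<lambda>i. \<lfloor>z $ Inl i\<rfloor>)"
      have fz: "real_of_int (f i) = z $ Inl i" for i
        using zint[of "Inl i"] by (auto simp: f_def elim: Ints_cases)
      have "f i \<in> {- \<lfloor>y * real k\<rfloor> .. \<lfloor>y * real k\<rfloor>}" for i
      proof -
        have "real_of_int \<bar>f i\<bar> \<le> y * real k" using zk[of i] fz[of i] by simp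
        then have "\<bar>f i\<bar> \<le> \<lfloor>y * real k\<rfloor>" by (simp add: le_floor_iff)
        then show ?thesis by auto
      qed
      then have "(\<lambda>i. - real_of_int (f i)) \<in> P k"
        unfolding P_def by (intro imageI) (simp add: PiE_UNIV_domain)
      moreover have "\<bar>A $ i \<bullet> q - (- real_of_int (f i))\<bar> < l" for i
        using top[of i] by (simp add: fz add.commute)
      ultimately show ?thesis
        using B(4)[OF A jk kX, of "\<lambda>i. - real_of_int (f i)"] by blast
    qed
    then show "\<exists>B \<in> sets borel. bounded B \<and> measure lborel B \<le> C * \<eta> ^ (CARD('m) + CARD('n)) \<and>
      (\<forall>A::real^'n^'m. A \<in> entry_cube R \<longrightarrow>
        (\<exists>z \<in> int_vecs - {0}. norm (flow s *v (uni A *v z)) < \<eta>) \<longrightarrow> A \<in> B)"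
      using B(1,2) Bm by (intro bexI[of _ B]) auto
  qed
qed

text \<open>By Mahler's criterion these are the \<open>A\<close> whose orbit at integer times leaves
  every compact set of lattices. Integer times make countable intersections available.\<close>

definition divergent_mats :: "(real^'n::finite^'m::finite) set" where
  "divergent_mats = {A. \<forall>\<eta>>0. \<exists>k0. \<forall>k\<ge>k0. \<exists>z \<in> int_vecs - {0}. norm (flow (real k) *v (uni A *v z)) < \<eta>}"

text \<open>For one fixed \<eta> a divergent matrix lies in all but finitely many of the bad sets.
  The lower limit of sets of measure at most e has measure at most e, so uniformity in time
  suffices, without summability.\<close>

lemma negligible_divergent_mats: "negligible (divergent_mats :: (real^'n::finite^'m::finite) set)"
proof -
  have cube: "negligible (divergent_mats \<inter> entry_cube R :: (real^'n^'m) set)" if R: "R > 0" for R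
    unfolding negligible_outer_le
  proof (intro allI impI)
    fix e :: real assume e: "e > 0"
    obtain C where C: "C \<ge> 0" "\<And>s \<eta>. s \<ge> 1 \<Longrightarrow> 0 < \<eta> \<Longrightarrow> \<eta> < 1 \<Longrightarrow>
      \<exists>B \<in> sets borel. bounded B \<and> measure lborel B \<le> C * \<eta> ^ (CARD('m) + CARD('n)) \<and>
        (\<forall>A::real^'n^'m. A \<in> entry_cube R \<longrightarrow>
          (\<exists>z \<in> int_vecs - {0}. norm (flow s *v (uni A *v z)) < \<eta>) \<longrightarrow> A \<in> B)"
      using bad_uni_measure[OF R] by blast
    define \<eta> where "\<eta> = min (1 / 2) (e / (C + 1))"
    have \<eta>: "\<eta> > 0" "\<eta> < 1" "\<eta> \<le> e / (C + 1)" using e C(1) by (auto simp: \<eta>_def)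
    have C\<eta>: "C * \<eta> ^ (CARD('m) + CARD('n)) \<le> e"
    proof -
      have "1 \<le> CARD('m) + CARD('n)"
        using zero_less_card_finite[where 'a = 'm] by linarith
      then have "\<eta> ^ (CARD('m) + CARD('n)) \<le> \<eta> ^ 1"
        using \<eta> by (intro power_decreasing) simp_all
      then have "C * \<eta> ^ (CARD('m) + CARD('n)) \<le> (C + 1) * \<eta>"
        using C(1) \<eta> by (intro mult_mono) auto
      also have "\<dots> \<le> (C + 1) * (e / (C + 1))"
        using \<eta> C(1) by (intro mult_left_mono) auto
      also have "\<dots> = e" using C(1) by (simp add: field_simps)
      finally show ?thesis .
    qed
    \<comment> \<open>\<open>Suc k\<close> keeps the time at least 1.\<close>
    have "\<exists>B :: (real^'n^'m) set. B \<in> sets borel \<and> bounded B \<and> measure lborel B \<le> e \<and>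
        (\<forall>A. A \<in> entry_cube R \<longrightarrow> (\<exists>z \<in> int_vecs - {0}. norm (flow (real (Suc k)) *v (uni A *v z)) < \<eta>) \<longrightarrow> A \<in> B)" for k
    proof -
      have "real (Suc k) \<ge> 1" by simp
      from C(2)[OF this \<eta>(1,2)] C\<eta> show ?thesis by (meson order_trans)
    qed
    then obtain B :: "nat \<Rightarrow> (real^'n^'m) set" where B: "\<And>k. B k \<in> sets borel" "\<And>k. bounded (B k)"
      "\<And>k. measure lborel (B k) \<le> e"
      "\<And>k A. A \<in> entry_cube R \<Longrightarrow> (\<exists>z \<in> int_vecs - {0}. norm (flow (real (Suc k)) *v (uni A *v z)) < \<eta>) \<Longrightarrow> A \<in> B k"
      by metis
    define D where "D = (\<lambda>k0. \<Inter>k\<in>{k0..}. B k)"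
    have D_borel: "D k \<in> sets borel" for k
      unfolding D_def using B(1) by (intro sets.countable_INT') auto
    have D_sub: "D k \<subseteq> B k" for k by (auto simp: D_def)
    have lm: "S \<in> lmeasurable" if "S \<in> sets borel" "bounded S" for S :: "(real^'n^'m) set"
      using that by (intro bounded_set_imp_lmeasurable) auto
    have D_lm: "D k \<in> lmeasurable" for k
      using lm[OF D_borel bounded_subset[OF B(2) D_sub]] .
    have D_e: "measure lebesgue (D k) \<le> e" for k
    proof -
      have "measure lebesgue (D k) \<le> measure lebesgue (B k)"
        using D_sub D_lm[of k] lm[OF B(1,2)] by (intro measure_mono_fmeasurable) auto
      also have "\<dots> \<le> e" using B(1,3)[of k] by (simp add: measure_completion)
      finally show ?thesis .
    qed
    have nest: "D k \<subseteq> D (Suc k)" for k by (auto simp: D_def)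
    have "(\<Union>k. D k) \<in> lmeasurable"
      by (rule measurable_nested_Union[where S = D, OF D_lm D_e nest])
    moreover have "measure lebesgue (\<Union>k. D k) \<le> e"
      using measure_nested_Union[where S = D, OF D_lm D_e nest] D_e by (intro LIMSEQ_le_const2) auto
    moreover have "divergent_mats \<inter> entry_cube R \<subseteq> (\<Union>k. D k)"
    proof
      fix A :: "real^'n^'m" assume A: "A \<in> divergent_mats \<inter> entry_cube R"
      then obtain k0 where k0: "\<And>k. k \<ge> k0 \<Longrightarrow> \<exists>z \<in> int_vecs - {0}. norm (flow (real k) *v (uni A *v z)) < \<eta>"
        using \<eta>(1) unfolding divergent_mats_def by blast
      have "A \<in> B k" if "k \<ge> k0" for k
        using A k0[of "Suc k"] that by (intro B(4)) auto
      then show "A \<in> (\<Union>k. D k)" by (auto simp: D_def)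
    qed
    ultimately show "\<exists>T. (divergent_mats \<inter> entry_cube R :: (real^'n^'m) set) \<subseteq> T \<and> T \<in> lmeasurable \<and> measure lebesgue T \<le> e"
      by blast
  qed
  have "divergent_mats = (\<Union>N. divergent_mats \<inter> entry_cube (real (Suc N)) :: (real^'n^'m) set)"
  proof -
    have "\<exists>N. A \<in> entry_cube (real (Suc N))" for A :: "real^'n^'m"
    proof -
      obtain N where "norm A \<le> real N" using real_arch_simple by blast
      then have "\<bar>A $ i $ j\<bar> \<le> real (Suc N)" for i j using entry_le_norm[of A i j] by simp
      then show ?thesis by (auto simp: entry_cube_def)
    qed
    then show ?thesis by blast
  qed
  also have "negligible \<dots>" by (intro negligible_countable_Union countable_image) (auto intro!: cube)
  finally show ?thesis .
qed

section \<open>Density points\<close>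

text \<open>Cover S up to a null set by disjoint balls inside an open W slightly larger than E. Each
  ball loses the proportion \<delta> of its volume to the thin set W - E, so together they have
  measure at most that of W - E divided by \<delta>.\<close>

lemma negligible_density_deficit:
  fixes S E :: "'a::euclidean_space set"
  assumes E: "E \<in> sets lebesgue" "S \<subseteq> E" and \<delta>: "\<delta> > 0"
    and deficit: "\<And>x e. x \<in> S \<Longrightarrow> e > 0 \<Longrightarrow>
      \<exists>d. 0 < d \<and> d < e \<and> \<delta> * measure lebesgue (ball x d) \<le> measure lebesgue (ball x d - E)"
  shows "negligible S"
  unfolding negligible_outer_le
proof (intro allI impI)
  fix e :: real assume e: "e > 0"
  have "0 < e * \<delta>" using e \<delta> by simp
  then obtain W where W: "open W" "E \<subseteq> W" "W - E \<in> lmeasurable" "emeasure lebesgue (W - E) < ennreal (e * \<delta>)"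
    using sets_lebesgue_outer_open[OF E(1)] by blast
  have WE: "measure lebesgue (W - E) \<le> e * \<delta>"
  proof -
    have "ennreal (measure lebesgue (W - E)) < ennreal (e * \<delta>)"
      using W(4) unfolding emeasure_eq_measure2[OF W(3)] .
    then show ?thesis
      unfolding ennreal_less_iff[OF measure_nonneg] by (rule less_imp_le)
  qed
  define K where "K = {(x, d). x \<in> S \<and> 0 < d \<and> ball x d \<subseteq> W \<and>
    \<delta> * measure lebesgue (ball x d) \<le> measure lebesgue (ball x d - E)}"
  obtain C where C: "countable C" "C \<subseteq> K"
     "pairwise (\<lambda>i j. disjnt (ball (fst i) (snd i)) (ball (fst j) (snd j))) C"
     "negligible (S - (\<Union>i \<in> C. ball (fst i) (snd i)))"
  proof (rule Vitali_covering_theorem_balls[of S K fst snd])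
    fix x :: 'a and d :: real assume x: "x \<in> S" and d: "0 < d"
    obtain \<rho> where \<rho>: "\<rho> > 0" "ball x \<rho> \<subseteq> W" using W x E(2) openE by blast
    obtain d' where d': "0 < d'" "d' < min d \<rho>" "\<delta> * measure lebesgue (ball x d') \<le> measure lebesgue (ball x d' - E)"
      using deficit[OF x, of "min d \<rho>"] d \<rho> by auto
    then have "(x, d') \<in> K" using x \<rho> by (auto simp: K_def)
    then show "\<exists>i. i \<in> K \<and> x \<in> ball (fst i) (snd i) \<and> snd i < d"
      using d' by (intro exI[of _ "(x, d')"]) auto
  qed blast
  define B where "B = (\<lambda>i::'a \<times> real. ball (fst i) (snd i))"
  have bound: "measure lebesgue (\<Union>i\<in>F. B i) \<le> e" if F: "F \<subseteq> C" "finite F" for F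
  proof -
    have Blm: "B i \<in> lmeasurable" "B i - E \<in> lmeasurable" for i
      using E(1) by (auto simp: B_def intro!: fmeasurable_Diff)
    have "\<delta> * measure lebesgue (\<Union>i\<in>F. B i) \<le> \<delta> * (\<Sum>i\<in>F. measure lebesgue (B i))"
      using F \<delta> Blm by (intro mult_left_mono measure_UNION_le) auto
    also have "\<dots> = (\<Sum>i\<in>F. \<delta> * measure lebesgue (B i))" by (rule sum_distrib_left)
    also have "\<dots> \<le> (\<Sum>i\<in>F. measure lebesgue (B i - E))"
      using F(1) C(2) by (intro sum_mono) (auto simp: B_def K_def)
    also have "\<dots> = measure lebesgue (\<Union>i\<in>F. B i - E)"
    proof (rule measure_finite_Union[symmetric])
      show "disjoint_family_on (\<lambda>i. B i - E) F"
        unfolding disjoint_family_on_def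
      proof (intro ballI impI)
        fix i j assume "i \<in> F" "j \<in> F" "i \<noteq> j"
        then have "disjnt (B i) (B j)" using C(3) F(1) by (auto simp: pairwise_def B_def)
        then show "(B i - E) \<inter> (B j - E) = {}" by (auto simp: disjnt_def)
      qed
      show "(\<lambda>i. B i - E) ` F \<subseteq> sets lebesgue" using Blm by (auto simp: fmeasurableD)
      show "emeasure lebesgue (B i - E) \<noteq> \<infinity>" for i
        unfolding infinity_ennreal_def by (rule fmeasurableD2[OF Blm(2)])
    qed (use F in simp)
    also have "\<dots> \<le> measure lebesgue (W - E)"
    proof (rule measure_mono_fmeasurable[OF _ _ W(3)])
      show "(\<Union>i\<in>F. B i - E) \<subseteq> W - E" using F(1) C(2) by (fastforce simp: B_def K_def)
      show "(\<Union>i\<in>F. B i - E) \<in> sets lebesgue" using Blm F(2) by (intro sets.finite_UN) (auto simp: fmeasurableD)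
    qed
    also have "\<dots> \<le> \<delta> * e" using WE by (simp add: mult.commute)
    finally show ?thesis using \<delta> by simp
  qed
  have lm: "(\<Union>i\<in>C. B i) \<in> lmeasurable" "measure lebesgue (\<Union>i\<in>C. B i) \<le> e"
    using fmeasurable_UN_bound[OF C(1) _ bound] measure_UN_bound[OF C(1) _ bound] by (auto simp: B_def)
  define T where "T = (\<Union>i\<in>C. B i) \<union> (S - (\<Union>i\<in>C. B i))"
  have neg: "negligible (S - (\<Union>i\<in>C. B i))" using C(4) by (simp add: B_def)
  have "T \<in> lmeasurable"
    unfolding T_def using lm(1) negligible_imp_measurable[OF neg] by (rule fmeasurable.Un)
  moreover have "measure lebesgue T = measure lebesgue (\<Union>i\<in>C. B i)"
    unfolding T_def by (rule measure_Un_null_set[OF fmeasurableD[OF lm(1)] neg[unfolded negligible_iff_null_sets]])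
  then have "measure lebesgue T \<le> e" using lm(2) by simp
  moreover have "S \<subseteq> T" by (auto simp: T_def)
  ultimately show "\<exists>T. S \<subseteq> T \<and> T \<in> lmeasurable \<and> measure lebesgue T \<le> e"
    by blast
qed

section \<open>Unipotent balls that lead into the target\<close>

lemma continuous_on_matrix_matrix_mult:
  fixes f g :: "'a::topological_space \<Rightarrow> real^'k::finite^'k"
  assumes "continuous_on S f" "continuous_on S g"
  shows "continuous_on S (\<lambda>x. f x ** g x)"
  unfolding matrix_matrix_mult_def using assms by (intro continuous_on_vec_lambda continuous_intros)

lemma continuous_on_uni:
  fixes f :: "'a::topological_space \<Rightarrow> real^'n::finite^'m::finite"
  assumes "continuous_on S f"
  shows "continuous_on S (\<lambda>x. uni (f x))"
  unfolding uni_def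
proof (intro continuous_on_vec_lambda)
  fix i j :: "'m + 'n"
  show "continuous_on S (\<lambda>x. case i of
     Inl a \<Rightarrow> (case j of Inl c \<Rightarrow> if a = c then 1 else 0 | Inr b \<Rightarrow> f x $ a $ b)
   | Inr b \<Rightarrow> (case j of Inl c \<Rightarrow> 0 | Inr b' \<Rightarrow> if b = b' then 1 else 0))"
    using assms by (cases i; cases j) (auto intro!: continuous_intros)
qed

text \<open>A nondivergent orbit returns to a compact set of lattices at times \<open>k\<close>; the fixed ball of
  unipotents that leads from a limit lattice to the target scales back to a proportion, independent
  of \<open>k\<close>, of a ball around \<open>A\<close>.\<close>

lemma deficit_at_nondivergent:
  fixes \<nu> :: "real^('m::finite + 'n::finite) \<Rightarrow> real" and M0 :: "real^('m + 'n)^('m + 'n)" and A :: "real^'n^'m"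
  assumes \<nu>: "is_norm \<nu>" and M0: "\<bar>det M0\<bar> = 1" "M0 \<in> lat_ge \<nu> \<rho>" and r: "0 < r" "r < \<rho>"
    and A: "A \<notin> divergent_mats"
    and E: "E = - (\<Union>t\<in>{T..}. interior {A. flow t ** uni A \<in> lat_ge \<nu> r})"
  shows "\<exists>\<delta>>0. \<forall>e>0. \<exists>d. 0 < d \<and> d < e \<and> \<delta> * measure lebesgue (ball A d) \<le> measure lebesgue (ball A d - E)"
proof -
  obtain \<eta> where \<eta>: "\<eta> > 0" "\<And>k0. \<exists>k\<ge>k0. \<forall>z \<in> int_vecs - {0}. \<eta> \<le> norm (flow (real k) *v (uni A *v z))"
    using A unfolding divergent_mats_def by (auto simp: not_less) 
  define I where "I = {k::nat. k \<ge> 1 \<and> (\<forall>z \<in> int_vecs - {0}. \<eta> \<le> norm (flow (real k) *v (uni A *v z)))}"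
  have "\<exists>k\<ge>k0. k \<in> I" for k0
    using \<eta>(2)[of "max 1 k0"] unfolding I_def by auto
  then have "infinite I" by (simp add: infinite_nat_iff_unbounded_le)
  then obtain s :: "nat \<Rightarrow> nat" where s: "strict_mono s" "\<And>i. s i \<in> I"
    using infinite_enumerate by blast
  obtain R where R: "\<And>M :: real^('m + 'n)^('m + 'n). det M \<noteq> 0 \<Longrightarrow> \<bar>det M\<bar> \<le> 1 \<Longrightarrow>
    (\<And>z. z \<in> int_vecs - {0} \<Longrightarrow> \<eta> \<le> norm (M *v z)) \<Longrightarrow> \<exists>\<gamma> \<in> GLZ. norm (M ** \<gamma>) \<le> R"
    using exists_bounded_basis[OF \<eta>(1)] by blast
  define M where "M = (\<lambda>i. flow (real (s i)) ** uni A)"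
  have si: "real (s i) \<ge> 1" "real (s i) > 0" for i using s(2)[of i] by (auto simp: I_def)
  have detM: "det (M i) = 1" for i
    using si[of i] by (simp add: M_def det_mul det_flow det_uni)
  have "\<exists>\<gamma> \<in> GLZ. norm (M i ** \<gamma>) \<le> R" for i
  proof (rule R)
    show "\<eta> \<le> norm (M i *v z)" if "z \<in> int_vecs - {0}" for z
      using s(2)[of i] that by (auto simp: I_def M_def matrix_vector_mul_assoc)
  qed (simp_all add: detM)
  then obtain \<gamma> where \<gamma>: "\<And>i. \<gamma> i \<in> GLZ" "\<And>i. norm (M i ** \<gamma> i) \<le> R" by metis
  define Y where "Y = (\<lambda>i. M i ** \<gamma> i)"
  have "\<forall>i. Y i \<in> cball 0 R" using \<gamma>(2) by (simp add: Y_def)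
  \<comment> \<open>Reduced bases at nondivergent times stay in a ball, so a subsequence converges
    to a basis \<open>h\<close> of a unimodular lattice, from which the target can be
    reached.\<close>
  then obtain h \<phi> where h: "strict_mono \<phi>" "(Y \<circ> \<phi>) \<longlonglongrightarrow> h"
    using compact_cball[of 0 R] unfolding compact_def by metis
  have lim: "(\<lambda>i. \<bar>det ((Y \<circ> \<phi>) i)\<bar>) \<longlonglongrightarrow> \<bar>det h\<bar>"
    using continuous_on_tendsto_compose[OF continuous_on_det[of UNIV] h(2)] by (intro tendsto_rabs) auto
  have one: "\<bar>det ((Y \<circ> \<phi>) i)\<bar> = 1" for i
    using GLZ_abs_det[OF \<gamma>(1)] by (simp add: Y_def det_mul detM)
  have det_h: "\<bar>det h\<bar> = 1"
    using lim unfolding one LIMSEQ_const_iff by simp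
  \<comment> \<open>The intermediate radius leaves room for replacing \<open>h\<close> by a nearby
    basis and \<open>B\<close> by a nearby block.\<close>
  define r' where "r' = (r + \<rho>) / 2"
  have r': "0 < r'" "r < r'" "r' < \<rho>" using r by (auto simp: r'_def)
  obtain t B where tB: "t \<ge> 1" "flow t ** uni B ** h \<in> lat_ge \<nu> r'"
    using horosphere_reaches_lat_ge[OF \<nu> det_h M0 r'(1,3)] by blast
  define G where "G = flow t ** uni B ** h"
  have "det G \<noteq> 0" using det_h tB(1) by (auto simp: G_def det_mul det_flow det_uni)
  then obtain \<epsilon> where \<epsilon>: "\<epsilon> > 0" "ball G \<epsilon> \<subseteq> lat_ge \<nu> r"
    using lat_ge_open[OF \<nu> _ _ r(1) r'(2), of G] tB(2) unfolding G_def by blast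
  define \<Phi> where "\<Phi> = (\<lambda>x :: (real^'n^'m) \<times> (real^('m + 'n)^('m + 'n)). flow t ** uni (fst x) ** snd x)"
  have "continuous_on UNIV \<Phi>"
    unfolding \<Phi>_def by (intro continuous_on_matrix_matrix_mult continuous_on_uni continuous_intros)
  then have "open (\<Phi> -` ball G \<epsilon>)" by (rule open_vimage[OF open_ball])
  moreover have "(B, h) \<in> \<Phi> -` ball G \<epsilon>" using \<epsilon>(1) by (simp add: \<Phi>_def G_def)
  ultimately obtain P H where PH: "open P" "open H" "(B, h) \<in> P \<times> H" "P \<times> H \<subseteq> \<Phi> -` ball G \<epsilon>"
    by (rule open_prod_elim)
  obtain \<delta> where \<delta>: "\<delta> > 0" "ball B \<delta> \<subseteq> P" using PH(1,3) openE by blast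
  \<comment> \<open>Rescaled by 1 / q and moved to A, the ball \<open>ball B \<delta>\<close> lies
    in \<open>ball A (D / q)\<close>. The ratio of the two volumes is \<open>c\<close> below,
    whatever q is.\<close>
  define D where "D = norm B + \<delta>"
  have D: "D > 0" using \<delta>(1) by (simp add: D_def add_nonneg_pos)
  define c where "c = (\<delta> / D) ^ DIM(real^'n^'m)"
  have "c > 0" using \<delta>(1) D by (simp add: c_def)
  moreover have "\<exists>d. 0 < d \<and> d < e \<and> c * measure lebesgue (ball A d) \<le> measure lebesgue (ball A d - E)"
    if e: "e > 0" for e
  proof -
    have "\<forall>\<^sub>F i in sequentially. (Y \<circ> \<phi>) i \<in> H"
      using topological_tendstoD[OF h(2) PH(2)] PH(3) by simp
    moreover have "\<forall>\<^sub>F i in sequentially. real i > max T (D / e)"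
      using filterlim_real_sequentially unfolding filterlim_at_top_dense by blast
    ultimately have "\<forall>\<^sub>F i in sequentially. (Y \<circ> \<phi>) i \<in> H \<and> real i > max T (D / e)"
      by (rule eventually_conj)
    then obtain i where i: "(Y \<circ> \<phi>) i \<in> H" "real i > max T (D / e)"
      using eventually_happens[of _ sequentially] by auto
    define k where "k = real (s (\<phi> i))"
    have "i \<le> s (\<phi> i)" using strict_mono_imp_increasing[OF s(1)] strict_mono_imp_increasing[OF h(1)]
      by (meson order_trans)
    then have k: "k > T" "k > D / e" "k \<ge> 1" using i(2) si(1)[of "\<phi> i"] by (auto simp: k_def)
    \<comment> \<open>Flowing for time \<open>k\<close> enlarges a displacement of \<open>A\<close>
      by this factor.\<close>
    define q where "q = flow_ratio TYPE('m) TYPE('n) k"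
    have q: "q \<ge> k" "q > 0" using flow_ratio_ge[OF k(3), where 'm = 'm and 'n = 'n] k(3) by (auto simp: q_def)
    define d where "d = D / q"
    have d: "d > 0" using D q by (simp add: d_def)
    have "D / e < q" using k(2) q(1) by linarith
    then have de: "d < e" using e q(2) by (simp add: d_def field_simps)
    define V where "V = ball (A + (1 / q) *\<^sub>R B) (\<delta> / q)"
    have V_good: "flow (t * k) ** uni A' \<in> lat_ge \<nu> r" if A': "A' \<in> V" for A'
    proof -
      define B' where "B' = q *\<^sub>R (A' - A)"
      have B'q: "A' = A + (1 / q) *\<^sub>R B'" using q by (simp add: B'_def)
      have "dist B' B = norm (q *\<^sub>R (A' - (A + (1 / q) *\<^sub>R B)))"
        using q by (simp add: B'_def dist_norm algebra_simps)
      also have "\<dots> = q * dist A' (A + (1 / q) *\<^sub>R B)" using q by (simp add: dist_norm)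
      also have "\<dots> < q * (\<delta> / q)" using A' q by (intro mult_strict_left_mono) (auto simp: V_def dist_commute)
      finally have "dist B' B < \<delta>" using q by simp
      then have "B' \<in> P" using \<delta>(2) by (auto simp: dist_commute)
      then have "(B', (Y \<circ> \<phi>) i) \<in> \<Phi> -` ball G \<epsilon>" using i(1) PH(4) by blast
      then have "flow t ** uni B' ** (Y \<circ> \<phi>) i \<in> lat_ge \<nu> r"
        using \<epsilon>(2) by (auto simp: \<Phi>_def)
      moreover have "flow t ** uni B' ** (Y \<circ> \<phi>) i = (flow t ** (uni B' ** flow k) ** uni A) ** \<gamma> (\<phi> i)"
        by (simp add: Y_def M_def k_def matrix_mul_assoc)
      moreover have "uni B' ** flow k = flow k ** uni ((1 / q) *\<^sub>R B')"
        using flow_uni[of k "(1 / q) *\<^sub>R B'"] k(3) q by (simp add: q_def[symmetric])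
      ultimately have "flow t ** (flow k ** uni ((1 / q) *\<^sub>R B')) ** uni A \<in> lat_ge \<nu> r"
        using lat_ge_GLZ[OF \<gamma>(1)] by metis
      moreover have "flow t ** (flow k ** uni ((1 / q) *\<^sub>R B')) ** uni A =
          (flow t ** flow k) ** (uni ((1 / q) *\<^sub>R B') ** uni A)"
        by (simp add: matrix_mul_assoc)
      moreover have "\<dots> = flow (t * k) ** uni A'"
        using tB(1) k(3) by (simp add: flow_mult uni_mult B'q add.commute)
      ultimately show ?thesis by simp
    qed
    have "T \<le> t * k"
    proof -
      have "1 * k \<le> t * k" using tB(1) k(3) by (intro mult_right_mono) auto
      then show ?thesis using k(1) by linarith
    qed
    moreover have "V \<subseteq> interior {A. flow (t * k) ** uni A \<in> lat_ge \<nu> r}"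
      using V_good by (intro interior_maximal) (auto simp: V_def)
    ultimately have VE: "V \<inter> E = {}" unfolding E by auto
    have Vd: "V \<subseteq> ball A d"
    proof
      fix A' assume "A' \<in> V"
      then have "dist (A + (1 / q) *\<^sub>R B) A' < \<delta> / q" by (simp add: V_def)
      moreover have "dist A (A + (1 / q) *\<^sub>R B) = norm B / q" using q by (simp add: dist_norm)
      moreover have "norm B / q + \<delta> / q = d" by (simp add: d_def D_def add_divide_distrib)
      ultimately show "A' \<in> ball A d"
        using dist_triangle[of A A' "A + (1 / q) *\<^sub>R B"] by simp
    qed
    have "closed E" unfolding E by (intro closed_Compl open_UN) auto
    then have lm: "ball A d - E \<in> lmeasurable" by (intro fmeasurable_Diff) auto
    have "c * measure lebesgue (ball A d) = (\<delta> / D) ^ DIM(real^'n^'m) * (d ^ DIM(real^'n^'m) * measure lborel (ball (0 :: real^'n^'m) 1))"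
      using d content_ball_conv_unit_ball[of d A] by (simp add: c_def measure_completion)
    also have "\<dots> = (\<delta> / q) ^ DIM(real^'n^'m) * measure lborel (ball (0 :: real^'n^'m) 1)"
    proof -
      have "\<delta> / D * d = \<delta> / q" using D by (simp add: d_def)
      then show ?thesis by (metis mult.assoc power_mult_distrib)
    qed
    also have "\<dots> = measure lebesgue V"
      using \<delta>(1) q(2) content_ball_conv_unit_ball[of "\<delta> / q" "A + (1 / q) *\<^sub>R B"]
      by (simp add: V_def measure_completion)
    also have "\<dots> \<le> measure lebesgue (ball A d - E)"
      using VE Vd lm by (intro measure_mono_fmeasurable) (auto simp: V_def)
    finally show ?thesis using d de by blast
  qed
  ultimately show ?thesis by blast
qed

theorem negligible_never_visiting:
  fixes \<nu> :: "real^('m::finite + 'n::finite) \<Rightarrow> real" and M0 :: "real^('m + 'n)^('m + 'n)"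
  assumes \<nu>: "is_norm \<nu>" and M0: "\<bar>det M0\<bar> = 1" "M0 \<in> lat_ge \<nu> \<rho>" and r: "0 < r" "r < \<rho>"
  shows "negligible {A :: real^'n^'m. \<forall>\<^sub>F t in at_top. flow t ** uni A \<notin> lat_ge \<nu> r}"
proof -
  \<comment> \<open>Taking interiors makes \<open>E T\<close> closed, hence measurable, although the
    union runs over uncountably many times.\<close>
  define E :: "nat \<Rightarrow> (real^'n^'m) set" where
    "E = (\<lambda>T. - (\<Union>t\<in>{real T..}. interior {A. flow t ** uni A \<in> lat_ge \<nu> r}))"
  \<comment> \<open>The proportion found by \<open>deficit_at_nondivergent\<close> depends on
    \<open>A\<close>; the values 1 / (j + 1) and integral \<open>T\<close> leave countably many
    sets, each with a uniform proportion.\<close>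
  define S where "S = (\<lambda>T j. {A \<in> E T. \<forall>e>0. \<exists>d. 0 < d \<and> d < e \<and>
    1 / real (Suc j) * measure lebesgue (ball A d) \<le> measure lebesgue (ball A d - E T)})"
  have negS: "negligible (S T j)" for T j
  proof (rule negligible_density_deficit)
    have "closed (E T)" unfolding E_def by (intro closed_Compl open_UN) auto
    then show "E T \<in> sets lebesgue" by auto
    show "S T j \<subseteq> E T" by (auto simp: S_def)
    show "1 / real (Suc j) > 0" by simp
  qed (auto simp: S_def)
  have "A \<in> divergent_mats \<union> (\<Union>T. \<Union>j. S T j)"
    if ev: "\<forall>\<^sub>F t in at_top. flow t ** uni A \<notin> lat_ge \<nu> r" for A :: "real^'n^'m"
  proof (cases "A \<in> divergent_mats")
    case False
    obtain T0 where T0: "\<And>t. t \<ge> T0 \<Longrightarrow> flow t ** uni A \<notin> lat_ge \<nu> r"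
      using ev unfolding eventually_at_top_linorder by blast
    obtain T :: nat where T: "T0 \<le> real T" using real_arch_simple by blast
    have AE: "A \<in> E T"
    proof -
      have "A \<notin> interior {A. flow t ** uni A \<in> lat_ge \<nu> r}" if "t \<ge> real T" for t
        using T0[of t] T that interior_subset by force
      then show ?thesis by (auto simp: E_def)
    qed
    obtain \<delta> where \<delta>: "\<delta> > 0" "\<And>e. e > 0 \<Longrightarrow>
        \<exists>d. 0 < d \<and> d < e \<and> \<delta> * measure lebesgue (ball A d) \<le> measure lebesgue (ball A d - E T)"
      using deficit_at_nondivergent[OF \<nu> M0 r False, of "E T" "real T"] by (auto simp: E_def)
    obtain j where j: "1 / real (Suc j) < \<delta>"
      using \<delta>(1) reals_Archimedean by (metis inverse_eq_divide)
    have "\<exists>d. 0 < d \<and> d < e \<and> 1 / real (Suc j) * measure lebesgue (ball A d) \<le> measure lebesgue (ball A d - E T)"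
      if "e > 0" for e
    proof -
      obtain d where d: "0 < d" "d < e" "\<delta> * measure lebesgue (ball A d) \<le> measure lebesgue (ball A d - E T)"
        using \<delta>(2)[OF \<open>e > 0\<close>] by blast
      have "1 / real (Suc j) * measure lebesgue (ball A d) \<le> \<delta> * measure lebesgue (ball A d)"
        using j by (intro mult_right_mono) auto
      then show ?thesis using d by (meson order_trans)
    qed
    then have "A \<in> S T j" using AE by (simp add: S_def)
    then show ?thesis by blast
  qed simp
  then have "{A :: real^'n^'m. \<forall>\<^sub>F t in at_top. flow t ** uni A \<notin> lat_ge \<nu> r} \<subseteq> divergent_mats \<union> (\<Union>T. \<Union>j. S T j)"
    by blast
  moreover have "negligible (divergent_mats \<union> (\<Union>T. \<Union>j. S T j))"
    by (intro negligible_Un negligible_divergent_mats negligible_countable_Union countable_image)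
      (auto intro!: negligible_countable_Union negS)
  ultimately show ?thesis by (rule negligible_subset[rotated])
qed

section \<open>Improvability of Dirichlet's theorem\<close>

lemma critical_covolume_props:
  fixes \<nu> :: "real^'k::finite \<Rightarrow> real"
  assumes \<nu>: "is_norm \<nu>"
  shows "critical_covolume \<nu> \<ge> 0"
    and "critical_covolume \<nu> < v \<Longrightarrow> \<exists>g. det g \<noteq> 0 \<and> \<bar>det g\<bar> < v \<and> g \<in> lat_ge \<nu> 1"
proof -
  define \<V> where "\<V> = {covolume L | L. is_lattice L \<and> L \<inter> nu_ball \<nu> 1 = {0}}"
  have crit: "critical_covolume \<nu> = Inf \<V>" by (simp add: critical_covolume_def \<V>_def)
  have nonneg: "0 \<le> x" if "x \<in> \<V>" for x
    using that covolume_eq by (fastforce simp: \<V>_def is_lattice_def)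
  obtain c C where c: "c > 0" "C > 0" "\<And>x. c * norm x \<le> \<nu> x" "\<And>x. \<nu> x \<le> C * norm x"
    using is_norm_bounds[OF \<nu>] by blast
  have ne: "\<V> \<noteq> {}"
  proof -
    \<comment> \<open>Scaling by 1 / c gives every nonzero integral vector \<nu> at least 1, so the
      infimum is taken over a nonempty set.\<close>
    define g where "g = (diag_mat (\<lambda>_. 1 / c) :: real^'k^'k)"
    have det_g: "det g \<noteq> 0" using c by (simp add: g_def det_diag_mat)
    have gz: "g *v z = (1 / c) *\<^sub>R z" for z
      by (simp add: vec_eq_iff g_def diag_mat_vec)
    define L where "L = (\<lambda>z. g *v z) ` int_vecs"
    have "lattice_basis g L" using det_g by (simp add: lattice_basis_def L_def invertible_det_nz)
    moreover have "L \<inter> nu_ball \<nu> 1 = {0}"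
    proof -
      have "g *v z \<notin> nu_ball \<nu> 1" if z: "z \<in> int_vecs" "z \<noteq> 0" for z
      proof -
        obtain i where i: "z $ i \<noteq> 0" using z(2) by (auto simp: vec_eq_iff)
        have "z $ i \<in> \<int>" using z(1) by (simp add: int_vecs_def)
        then have "1 \<le> \<bar>z $ i\<bar>" using i by (intro Ints_nonzero_abs_ge1)
        then have "1 \<le> norm z" using component_le_norm_cart[of z i] by linarith
        also have "\<dots> = c * norm (g *v z)" using c(1) by (simp add: gz)
        also have "\<dots> \<le> \<nu> (g *v z)" by (rule c(3))
        finally show ?thesis by (simp add: nu_ball_def)
      qed
      moreover have "0 \<in> L" by (auto simp: L_def int_vecs_def intro!: image_eqI[of _ _ 0])
      moreover have "\<nu> 0 = 0" using \<nu> by (simp add: is_norm_def)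
      then have "0 \<in> nu_ball \<nu> 1" by (simp add: nu_ball_def)
      ultimately show ?thesis by (auto simp: L_def) (metis matrix_vector_mult_0_right)
    qed
    ultimately show ?thesis unfolding \<V>_def is_lattice_def by blast
  qed
  show "critical_covolume \<nu> \<ge> 0"
    unfolding crit using ne nonneg by (intro cInf_greatest) auto
  assume v: "critical_covolume \<nu> < v"
  obtain x where x: "x \<in> \<V>" "x < v" using cInf_lessD[OF ne] v unfolding crit by blast
  then obtain L g where g: "lattice_basis g L" "L \<inter> nu_ball \<nu> 1 = {0}" "x = \<bar>det g\<bar>"
    using covolume_eq unfolding \<V>_def is_lattice_def by blast
  have det_g: "det g \<noteq> 0" using g(1) by (simp add: lattice_basis_def invertible_det_nz)
  have "g \<in> lat_ge \<nu> 1"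
    unfolding lat_ge_def
  proof (intro CollectI ballI)
    fix z :: "real^'k" assume z: "z \<in> int_vecs - {0}"
    have "g *v z \<noteq> 0"
      using injD[OF inj_matrix_mult(3)[OF det_g], of z 0] z by auto
    moreover have "g *v z \<in> L" using g(1) z by (auto simp: lattice_basis_def)
    ultimately have "g *v z \<notin> nu_ball \<nu> 1" using g(2) by blast
    then show "1 \<le> \<nu> (g *v z)" by (simp add: nu_ball_def)
  qed
  then show "\<exists>g. det g \<noteq> 0 \<and> \<bar>det g\<bar> < v \<and> g \<in> lat_ge \<nu> 1" using det_g g(3) x(2) by blast
qed

text \<open>Its balls are the \<nu>-balls stretched by \<open>c\<close> in the first m coordinates,
  so the constant in front of \<open>psi_exp\<close> becomes a change of norm.\<close>

definition stretched :: "(real^('m::finite + 'n::finite) \<Rightarrow> real) \<Rightarrow> real \<Rightarrow> real^('m + 'n) \<Rightarrow> real" where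
  "stretched \<nu> c x = \<nu> (block_diag (1 / c) 1 *v x)"

lemma block_diag_vec:
  "(block_diag a b *v x) $ Inl i = a * x $ Inl i" "(block_diag a b *v x) $ Inr j = b * x $ Inr j"
  by (simp_all add: block_diag_eq_diag_mat diag_mat_vec)

lemma is_norm_stretched:
  assumes \<nu>: "is_norm \<nu>" and c: "c > 0"
  shows "is_norm (stretched \<nu> c)"
proof -
  have "block_diag (1 / c) 1 *v x = 0 \<longleftrightarrow> x = 0" for x :: "real^('a + 'b)"
  proof
    assume eq: "block_diag (1 / c) 1 *v x = 0"
    have "x $ Inl i = 0" "x $ Inr j = 0" for i j
      using arg_cong[OF eq, of "\<lambda>v. v $ Inl i"] arg_cong[OF eq, of "\<lambda>v. v $ Inr j"] c
      by (simp_all add: block_diag_vec)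
    then show "x = 0" by (intro vec_sum_eqI) simp_all
  qed simp
  then show ?thesis
    using \<nu> by (simp add: is_norm_def stretched_def matrix_vector_right_distrib matrix_vector_mult_scaleR)
qed

text \<open>The map diag(c, 1) multiplies covolumes by c^m, and scaling a lattice by r multiplies
  them by r^d. By \<open>crit\<close>, a nearly critical lattice of \<nu>, stretched and then scaled
  to determinant 1, is therefore admissible for a radius above r.\<close>

lemma exists_good_stretched_lattice:
  fixes \<nu> :: "real^('m::finite + 'n::finite) \<Rightarrow> real"
  assumes \<nu>: "is_norm \<nu>" and c: "c > 0" and r: "r > 0"
    and crit: "critical_covolume \<nu> * (c ^ CARD('m) * r ^ CARD('m + 'n)) < 1"
  shows "\<exists>M0 \<rho>. \<bar>det M0\<bar> = 1 \<and> M0 \<in> lat_ge (stretched \<nu> c) \<rho> \<and> r < \<rho>"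
proof -
  define d where "d = CARD('m + 'n)"
  have d: "d > 0" unfolding d_def by (rule zero_less_card_finite)
  have "critical_covolume \<nu> < 1 / (c ^ CARD('m) * r ^ d)"
    using crit c r by (simp add: d_def field_simps)
  then obtain g where g: "det g \<noteq> 0" "\<bar>det g\<bar> < 1 / (c ^ CARD('m) * r ^ d)" "g \<in> lat_ge \<nu> 1"
    using critical_covolume_props(2)[OF \<nu>] by blast
  \<comment> \<open>The scaling that brings the stretched lattice to covolume 1; it is also the new
    radius \<rho>.\<close>
  define \<kappa> where "\<kappa> = root d (1 / (c ^ CARD('m) * \<bar>det g\<bar>))"
  have pos: "1 / (c ^ CARD('m) * \<bar>det g\<bar>) > 0" using c g(1) by simp
  have \<kappa>: "\<kappa> > 0" "\<kappa> ^ d = 1 / (c ^ CARD('m) * \<bar>det g\<bar>)"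
    using pos d by (simp_all add: \<kappa>_def real_root_gt_zero)
  have "r ^ d < \<kappa> ^ d"
    unfolding \<kappa>(2) using g c r by (simp add: field_simps)
  then have r\<kappa>: "r < \<kappa>" using \<kappa>(1) by (meson less_imp_le power_less_imp_less_base)
  define f where "f = (\<lambda>i::'m + 'n. \<kappa> * (case i of Inl _ \<Rightarrow> c | Inr _ \<Rightarrow> 1))"
  define M0 where "M0 = diag_mat f ** g"
  have "prod f UNIV = \<kappa> ^ d * c ^ CARD('m)"
  proof -
    have "(\<Prod>i\<in>(UNIV :: 'm set) <+> (UNIV :: 'n set). case i of Inl _ \<Rightarrow> c | Inr _ \<Rightarrow> 1) = c ^ CARD('m)"
      by (subst prod.Plus) simp_all
    then show ?thesis by (simp add: f_def prod.distrib d_def)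
  qed
  then have "\<bar>det M0\<bar> = 1"
    using \<kappa> c g(1) by (simp add: M0_def det_mul det_diag_mat abs_mult)
  moreover have "M0 \<in> lat_ge (stretched \<nu> c) \<kappa>"
    unfolding lat_ge_def
  proof (intro CollectI ballI)
    fix z :: "real^('m + 'n)" assume z: "z \<in> int_vecs - {0}"
    have "block_diag (1 / c) 1 *v (M0 *v z) = \<kappa> *\<^sub>R (g *v z)"
      unfolding M0_def matrix_vector_mul_assoc[symmetric, of "diag_mat f"]
      using c by (intro vec_sum_eqI) (simp_all add: block_diag_vec diag_mat_vec f_def)
    then have "stretched \<nu> c (M0 *v z) = \<kappa> * \<nu> (g *v z)"
      using \<nu> \<kappa>(1) by (simp add: stretched_def is_norm_def)
    moreover have "1 \<le> \<nu> (g *v z)" using g(3) z by (simp add: lat_ge_def)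
    ultimately show "\<kappa> \<le> stretched \<nu> c (M0 *v z)"
      using \<kappa>(1) by simp
  qed
  ultimately show ?thesis using r\<kappa> by blast
qed

text \<open>With z = (-p, q), membership at time t says that \<open>flow t ** uni A\<close> maps z
  into the ball of radius r for the norm stretched by c. Passing to c' multiplies by diag(c / c',
  1), which \<open>close\<close> keeps near the identity. The freedom in (c', r') serves to make
  both rational.\<close>

lemma D_set_subset_never_visiting:
  fixes \<nu> :: "real^('m::finite + 'n::finite) \<Rightarrow> real"
  assumes \<nu>: "is_norm \<nu>" and c: "c > 0" "c' > 0"
    and \<kappa>: "\<And>X x. \<nu> (X *v x) \<le> \<kappa> * norm X * \<nu> x" "\<kappa> > 0"
    and r: "critical_covolume \<nu> powr (- 1 / real CARD('m + 'n)) = r" "r > 0"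
    and close: "(1 + \<kappa> * (real CARD('m + 'n) * real CARD('m + 'n) * \<bar>c / c' - 1\<bar>)) * r \<le> r'"
  shows "D_set \<nu> (\<lambda>t. c * psi_exp (real CARD('n) / real CARD('m)) t) \<subseteq>
    {A :: real^'n^'m. \<forall>\<^sub>F t in at_top. flow t ** uni A \<notin> lat_ge (stretched \<nu> c') r'}"
proof
  fix A :: "real^'n^'m"
  assume "A \<in> D_set \<nu> (\<lambda>t. c * psi_exp (real CARD('n) / real CARD('m)) t)"
  then have "\<forall>\<^sub>F t in at_top. \<exists>q \<in> int_vecs - {0}. \<exists>p \<in> int_vecs.
     join_vec (A *v q - p) q \<in> (\<lambda>x. block_diag (c * psi_exp (real CARD('n) / real CARD('m)) t) t *v x) ` nu_ball \<nu> r"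
    unfolding D_set_def r mem_Collect_eq .
  moreover have "\<forall>\<^sub>F t::real in at_top. t > 0" by (rule eventually_gt_at_top)
  ultimately have "\<forall>\<^sub>F t in at_top. flow t ** uni A \<notin> lat_ge (stretched \<nu> c') r'"
  proof eventually_elim
    case (elim t)
    then obtain q p x where q: "q \<in> int_vecs - {0}" and p: "p \<in> int_vecs" and x: "\<nu> x < r"
      and eq: "join_vec (A *v q - p) q = block_diag (c * psi_exp (real CARD('n) / real CARD('m)) t) t *v x"
      by (auto simp: nu_ball_def)
    have t: "t > 0" by fact
    define z where "z = join_vec (- p) q"
    have z: "z \<in> int_vecs - {0}"
    proof -
      have "z $ i \<in> \<int>" for i
        using p q by (cases i) (auto simp: z_def join_vec_def int_vecs_def)
      moreover obtain b where "q $ b \<noteq> 0" using q by (auto simp: vec_eq_iff)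
      then have "z $ Inr b \<noteq> 0" by (simp add: z_def join_vec_def)
      ultimately show ?thesis by (auto simp: int_vecs_def)
    qed
    have uz: "uni A *v z = join_vec (A *v q - p) q"
      by (rule vec_sum_eqI; subst uni_vec; simp add: z_def join_vec_def matrix_vector_mult_def)
    define F where "F = (block_diag (c / c') 1 :: real^('m + 'n)^('m + 'n))"
    define \<alpha> where "\<alpha> = real CARD('n) / real CARD('m)"
    have inv: "t powr \<alpha> * t powr (- \<alpha>) = 1" using t by (simp add: powr_minus field_simps)
    have "block_diag (1 / c') 1 *v ((flow t ** uni A) *v z) = F *v x"
    proof (rule vec_sum_eqI)
      show "(block_diag (1 / c') 1 *v ((flow t ** uni A) *v z)) $ Inl i = (F *v x) $ Inl i" for i
      proof -
        have "(block_diag (1 / c') 1 *v ((flow t ** uni A) *v z)) $ Inl i =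
            1 / c' * (t powr \<alpha> * (c * t powr (- \<alpha>) * x $ Inl i))"
          by (simp add: block_diag_vec matrix_vector_mul_assoc[symmetric] flow_vec uz eq psi_exp_def \<alpha>_def)
        also have "\<dots> = c / c' * x $ Inl i * (t powr \<alpha> * t powr (- \<alpha>))" by simp
        finally show ?thesis by (simp add: inv F_def block_diag_vec)
      qed
      show "(block_diag (1 / c') 1 *v ((flow t ** uni A) *v z)) $ Inr j = (F *v x) $ Inr j" for j
        using t by (simp add: block_diag_vec matrix_vector_mul_assoc[symmetric] flow_vec uz eq F_def)
    qed
    then have F: "stretched \<nu> c' ((flow t ** uni A) *v z) = \<nu> (F *v x)" by (simp add: stretched_def)
    have "F *v x = x + (F - mat 1) *v x" by (simp add: matrix_vector_mult_diff_rdistrib)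
    then have "\<nu> (F *v x) \<le> \<nu> x + \<nu> ((F - mat 1) *v x)" using assms(1) by (simp add: is_norm_def)
    then have "stretched \<nu> c' ((flow t ** uni A) *v z) \<le> (1 + \<kappa> * norm (F - mat 1)) * \<nu> x"
      using \<kappa>(1)[of "F - mat 1" x] unfolding F by (simp add: distrib_right)
    also have "\<dots> < (1 + \<kappa> * norm (F - mat 1)) * r"
      using x \<kappa>(2) by (intro mult_strict_left_mono) (auto simp: add_pos_nonneg)
    also have "\<dots> \<le> (1 + \<kappa> * (real CARD('m + 'n) * real CARD('m + 'n) * \<bar>c / c' - 1\<bar>)) * r"
    proof (intro mult_right_mono add_left_mono mult_left_mono norm_matrix_le_entries)
      show "\<bar>(F - mat 1) $ i $ j\<bar> \<le> \<bar>c / c' - 1\<bar>" for i j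
        by (auto simp: F_def block_diag_def mat_def split: sum.split)
    qed (use r \<kappa>(2) in auto)
    also have "\<dots> \<le> r'" by (rule close)
    finally have "stretched \<nu> c' ((flow t ** uni A) *v z) < r'" .
    then show ?case using z by (auto simp: lat_ge_def not_le)
  qed
  then show "A \<in> {A. \<forall>\<^sub>F t in at_top. flow t ** uni A \<notin> lat_ge (stretched \<nu> c') r'}" by simp
qed

theorem theorem3p1:
  fixes \<nu> :: "real^('m::finite + 'n::finite) \<Rightarrow> real"
  assumes "is_norm \<nu>"
  shows "(D_hat \<nu> :: (real^'n^'m) set) \<in> null_sets lebesgue"
proof -
  define d where "d = real CARD('m + 'n)"
  define r where "r = critical_covolume \<nu> powr (- 1 / d)"
  have d: "d > 0" unfolding d_def using zero_less_card_finite[where 'a = "'m + 'n"] by linarith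
  define \<alpha> where "\<alpha> = real CARD('n) / real CARD('m)"
  have crit0: "critical_covolume \<nu> \<ge> 0" by (rule critical_covolume_props(1)[OF assms])
  show ?thesis
  proof (cases "critical_covolume \<nu> = 0")
    case True
    \<comment> \<open>\<open>0 powr _\<close> is 0 by convention, so the ball is empty.\<close>
    have "nu_ball \<nu> (critical_covolume \<nu> powr (- 1 / real CARD('m + 'n))) = {}"
      using assms True by (auto simp: nu_ball_def is_norm_def not_less)
    then have "(D_hat \<nu> :: (real^'n^'m) set) = {}"
      by (simp add: D_hat_def D_set_def)
    then show ?thesis by simp
  next
    case False
    then have crit: "critical_covolume \<nu> > 0" using crit0 by simp
    then have r: "r > 0" by (simp add: r_def)
    have rd: "critical_covolume \<nu> * r ^ CARD('m + 'n) = 1"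
    proof -
      have "r ^ CARD('m + 'n) = r powr d" unfolding d_def by (rule powr_realpow[OF r, symmetric])
      also have "\<dots> = critical_covolume \<nu> powr (- 1)" using d by (simp add: r_def powr_powr)
      also have "\<dots> = 1 / critical_covolume \<nu>" using crit by (simp add: powr_minus divide_inverse)
      finally show ?thesis using crit by simp
    qed
    obtain \<kappa> where \<kappa>: "\<kappa> > 0" "\<And>X x. \<nu> (X *v x) \<le> \<kappa> * norm X * \<nu> x"
      using is_norm_matrix_bound[OF assms] by blast
    define N where "N = (\<lambda>(c, s). {A :: real^'n^'m. \<forall>\<^sub>F t in at_top. flow t ** uni A \<notin> lat_ge (stretched \<nu> c) s})"
    \<comment> \<open>Rational parameters reduce the union over all real c to countably many null
      sets.\<close>
    define I where "I = {(c, s). c \<in> \<rat> \<and> s \<in> \<rat> \<and> 0 < c \<and> 0 < s \<and>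
      critical_covolume \<nu> * (c ^ CARD('m) * s ^ CARD('m + 'n)) < 1}"
    have "negligible (N i)" if i: "i \<in> I" for i
    proof -
      obtain c s where cs: "i = (c, s)" "0 < c" "0 < s" "critical_covolume \<nu> * (c ^ CARD('m) * s ^ CARD('m + 'n)) < 1"
        using i by (auto simp: I_def)
      obtain M0 \<rho> where "\<bar>det M0\<bar> = 1" "M0 \<in> lat_ge (stretched \<nu> c) \<rho>" "s < \<rho>"
        using exists_good_stretched_lattice[OF assms cs(2,3,4)] by blast
      then show ?thesis
        using negligible_never_visiting[OF is_norm_stretched[OF assms cs(2)]] cs(3) by (simp add: N_def cs(1))
    qed
    moreover have "countable I"
      by (rule countable_subset[of _ "\<rat> \<times> \<rat>"]) (auto simp: I_def intro: countable_rat)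
    ultimately have neg: "negligible (\<Union>i\<in>I. N i)"
      by (intro negligible_countable_Union countable_image) auto
    have "D_set \<nu> (\<lambda>t. c * psi_exp \<alpha> t) \<subseteq> (\<Union>i\<in>I. N i)" if c: "0 < c" "c < 1" for c
    proof -
      \<comment> \<open>By \<open>rd\<close> the product with the critical covolume is exactly c^m.
        The margin below 1 is spent first on a rational s > r, then on a rational c' > c so close to
        c that the gap between r and s absorbs the change from c to c'.\<close>
      have "c ^ CARD('m) < 1" using power_strict_decreasing[of 0 "CARD('m)" c] c by simp
      then have lt: "critical_covolume \<nu> * (c ^ CARD('m) * r ^ CARD('m + 'n)) < 1"
        unfolding mult.left_commute[of "critical_covolume \<nu>"] rd by simp
      have "((\<lambda>s. critical_covolume \<nu> * (c ^ CARD('m) * s ^ CARD('m + 'n))) \<longlongrightarrow>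
          critical_covolume \<nu> * (c ^ CARD('m) * r ^ CARD('m + 'n))) (at_right r)"
        by (intro tendsto_intros)
      from order_tendstoD(2)[OF this lt]
      have "\<forall>\<^sub>F s in at_right r. critical_covolume \<nu> * (c ^ CARD('m) * s ^ CARD('m + 'n)) < 1" .
      then obtain b where b: "b > r" "\<And>s. r < s \<Longrightarrow> s < b \<Longrightarrow> critical_covolume \<nu> * (c ^ CARD('m) * s ^ CARD('m + 'n)) < 1"
        unfolding eventually_at_right_field by blast
      obtain s where s: "s \<in> \<rat>" "r < s" "s < b" using Rats_dense_in_real[OF b(1)] by blast
      have "((\<lambda>c'. critical_covolume \<nu> * (c' ^ CARD('m) * s ^ CARD('m + 'n))) \<longlongrightarrow>
          critical_covolume \<nu> * (c ^ CARD('m) * s ^ CARD('m + 'n))) (at_right c)"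
        by (intro tendsto_intros)
      from order_tendstoD(2)[OF this b(2)[OF s(2,3)]]
      have ev1: "\<forall>\<^sub>F c' in at_right c. critical_covolume \<nu> * (c' ^ CARD('m) * s ^ CARD('m + 'n)) < 1" .
      have "((\<lambda>c'. (1 + \<kappa> * (d * d * \<bar>c / c' - 1\<bar>)) * r) \<longlongrightarrow> (1 + \<kappa> * (d * d * \<bar>c / c - 1\<bar>)) * r) (at_right c)"
        using c by (intro tendsto_intros) auto
      then have ev2: "\<forall>\<^sub>F c' in at_right c. (1 + \<kappa> * (d * d * \<bar>c / c' - 1\<bar>)) * r < s"
        using c s(2) by (intro order_tendstoD(2)) auto
      obtain b' where b': "b' > c" "\<And>c'. c < c' \<Longrightarrow> c' < b' \<Longrightarrow>
          critical_covolume \<nu> * (c' ^ CARD('m) * s ^ CARD('m + 'n)) < 1 \<and> (1 + \<kappa> * (d * d * \<bar>c / c' - 1\<bar>)) * r < s"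
        using eventually_conj[OF ev1 ev2] unfolding eventually_at_right_field by blast
      obtain c' where c': "c' \<in> \<rat>" "c < c'" "c' < b'" using Rats_dense_in_real[OF b'(1)] by blast
      have "(c', s) \<in> I" using c' s b'(2)[OF c'(2,3)] c r by (auto simp: I_def)
      moreover have "D_set \<nu> (\<lambda>t. c * psi_exp \<alpha> t) \<subseteq> N (c', s)"
        unfolding N_def \<alpha>_def prod.case
        using b'(2)[OF c'(2,3)] c c'(2) r
        by (intro D_set_subset_never_visiting[OF assms c(1) _ \<kappa>(2,1), of c' r]) (auto simp: r_def d_def)
      ultimately show ?thesis by blast
    qed
    then have "(D_hat \<nu> :: (real^'n^'m) set) \<subseteq> (\<Union>i\<in>I. N i)"
      unfolding D_hat_def \<alpha>_def by (intro UN_least) auto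
    then have "negligible (D_hat \<nu> :: (real^'n^'m) set)"
      using neg negligible_subset by blast
    then show ?thesis by (simp add: negligible_iff_null_sets)
  qed
qed

end
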